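(* Let $s\in(0,1]$ and $p\in[1,+\infty)$ be such that $sp<N$ and $s\neq p$. Let $\Omega\subset\mathbb{R}^N$ be an open and bounded domain with Lipschitz boundary. Let $\widetilde s,\widetilde p$ satisfy $$0\le\widetilde s<s\qquad\text{and}\qquad 1\le\widetilde p\le\frac{Np}{N-(s-\widetilde s)p}.$$ Then there exists a positive constant $C=C(N,s,p,\widetilde s,\widetilde p,\Omega)$ such that, for any $u\in W^{s,p}(\Omega)$, $$\|u\|_{W^{\widetilde s,\widetilde p}(\Omega)}\le C\,\|u\|_{W^{s,p}(\Omega)},$$ namely, the space $W^{s,p}(\Omega)$ is continuously embedded in $W^{\widetilde s,\widetilde p}(\Omega)$. Moreover, the curve $\gamma:[0,1]\to\mathbb{R}^2$ defined as $$\gamma(\theta):=(s_\theta,p_\theta)=\left(\theta\widetilde s+(1-\theta)s,\ \frac{p\,\widetilde p}{\widetilde p+\theta(p-\widetilde p)}\right)$$ is such that, if $0\le\theta_1\le\theta_2\le1$, then the space $W^{s_{\theta_1},p_{\theta_1}}(\Omega)$ is continuously embedded in $W^{s_{\theta_2},p_{\theta_2}}(\Omega)$.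
   Context: $N\ge1$ is an integer and functions are real-valued and measurable. For $s\in[0,1]$ and $p\in[1,+\infty)$ define $[u]_{W^{0,p}(\Omega)}:=\|u\|_{L^p(\Omega)}$, $[u]_{W^{1,p}(\Omega)}:=\|\nabla u\|_{L^p(\Omega)}$ (weak gradient) and, for $s\in(0,1)$, $$[u]_{W^{s,p}(\Omega)}:=\left(c_{N,s,p}\iint_{\Omega\times\Omega}\frac{|u(x)-u(y)|^p}{|x-y|^{N+sp}}\,dx\,dy\right)^{1/p},\qquad c_{N,s,p}:=\frac{s\,2^{2s-1}\,\Gamma\left(\frac{ps+p+N-2}{2}\right)}{\pi^{N/2}\,\Gamma(1-s)}.$$ Set $W^{s,p}(\Omega):=\{u\in L^p(\Omega):[u]_{W^{s,p}(\Omega)}<+\infty\}$, with norm $\|u\|_{W^{0,p}(\Omega)}:=\|u\|_{L^p(\Omega)}$ if $s=0$ and $\|u\|_{W^{s,p}(\Omega)}:=\big([u]^p_{W^{s,p}(\Omega)}+\|u\|^p_{L^p(\Omega)}\big)^{1/p}$ if $s\in(0,1]$. *)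

theory Defs
  imports "HOL-Analysis.Analysis"
begin

section \<open>Bounded Lipschitz domains\<close>

text \<open>
  Near every boundary point \<open>z\<close> the set is, in suitable Cartesian coordinates, the strict
  epigraph of a Lipschitz function of \<open>N - 1\<close> variables.  The unit vector \<open>e\<close> is the
  direction of the last coordinate; the remaining \<open>N - 1\<close> coordinates of \<open>x\<close> are those of its
  orthogonal projection \<open>x - (x \<bullet> e) *\<^sub>R e\<close> onto the hyperplane orthogonal to \<open>e\<close>.
\<close>

definition lipschitz_boundary :: "(real ^ 'n) set \<Rightarrow> bool" where
  "lipschitz_boundary \<Omega> \<longleftrightarrow>
     (\<forall>z \<in> frontier \<Omega>. \<exists>r>0. \<exists>e. \<exists>L. \<exists>g :: real ^ 'n \<Rightarrow> real.
        norm e = 1 \<and> L-lipschitz_on {y. y \<bullet> e = 0} g \<and>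
        \<Omega> \<inter> ball z r = {x \<in> ball z r. g (x - (x \<bullet> e) *\<^sub>R e) < x \<bullet> e})"

definition bounded_lipschitz_domain :: "(real ^ 'n) set \<Rightarrow> bool" where
  "bounded_lipschitz_domain \<Omega> \<longleftrightarrow>
     open \<Omega> \<and> connected \<Omega> \<and> \<Omega> \<noteq> {} \<and> bounded \<Omega> \<and> lipschitz_boundary \<Omega>"


section \<open>Weak gradients\<close>

definition partial :: "'n \<Rightarrow> (real ^ 'n \<Rightarrow> real) \<Rightarrow> real ^ 'n \<Rightarrow> real" where
  "partial i f x = frechet_derivative f (at x) (axis i 1)"

text \<open>
  \<open>foldr partial is f\<close> is the iterated partial derivative of \<open>f\<close> along the list \<open>is\<close> of
  coordinates.  All of these are (Frechet) differentiable everywhere iff \<open>f\<close> is of class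
  \<open>C\<^sup>\<infinity>\<close>.
\<close>

definition smooth :: "(real ^ 'n \<Rightarrow> real) \<Rightarrow> bool" where
  "smooth f \<longleftrightarrow> (\<forall>is x. foldr partial is f differentiable (at x))"

definition test_function :: "(real ^ 'n) set \<Rightarrow> (real ^ 'n \<Rightarrow> real) \<Rightarrow> bool" where
  "test_function \<Omega> \<phi> \<longleftrightarrow>
     smooth \<phi> \<and> compact (closure {x. \<phi> x \<noteq> 0}) \<and> closure {x. \<phi> x \<noteq> 0} \<subseteq> \<Omega>"

definition locally_integrable :: "(real ^ 'n) set \<Rightarrow> (real ^ 'n \<Rightarrow> 'b::euclidean_space) \<Rightarrow> bool" where
  "locally_integrable \<Omega> f \<longleftrightarrow> (\<forall>K. compact K \<and> K \<subseteq> \<Omega> \<longrightarrow> f absolutely_integrable_on K)"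

definition has_weak_gradient ::
  "(real ^ 'n) set \<Rightarrow> (real ^ 'n \<Rightarrow> real) \<Rightarrow> (real ^ 'n \<Rightarrow> real ^ 'n) \<Rightarrow> bool" where
  "has_weak_gradient \<Omega> u g \<longleftrightarrow>
     locally_integrable \<Omega> u \<and> locally_integrable \<Omega> g \<and>
     (\<forall>\<phi> i. test_function \<Omega> \<phi> \<longrightarrow>
        (LINT x|lebesgue_on \<Omega>. u x * partial i \<phi> x) = - (LINT x|lebesgue_on \<Omega>. g x $ i * \<phi> x))"

text \<open>The weak gradient is unique up to null sets, so the choice is immaterial for its norm.\<close>

definition weak_gradient ::
  "(real ^ 'n) set \<Rightarrow> (real ^ 'n \<Rightarrow> real) \<Rightarrow> real ^ 'n \<Rightarrow> real ^ 'n" where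
  "weak_gradient \<Omega> u = (SOME g. has_weak_gradient \<Omega> u g)"


section \<open>Sobolev spaces of fractional order\<close>

text \<open>
  Norms take values in \<open>[0, \<infinity>]\<close>, so that finiteness is meaningful.  The power below is used
  for exponents \<open>a > 0\<close> only.
\<close>

definition ennreal_powr :: "ennreal \<Rightarrow> real \<Rightarrow> ennreal" where
  "ennreal_powr x a = (if x = \<infinity> then \<infinity> else ennreal (enn2real x powr a))"

definition Lp_norm :: "(real ^ 'n) set \<Rightarrow> real \<Rightarrow> (real ^ 'n \<Rightarrow> 'b::real_normed_vector) \<Rightarrow> ennreal" where
  "Lp_norm \<Omega> p f = ennreal_powr (\<integral>\<^sup>+ x. ennreal (norm (f x) powr p) \<partial>lebesgue_on \<Omega>) (1 / p)"

definition sobolev_const :: "nat \<Rightarrow> real \<Rightarrow> real \<Rightarrow> real" where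
  "sobolev_const N s p =
     s * 2 powr (2 * s - 1) * Gamma ((p * s + p + real N - 2) / 2)
       / (pi powr (real N / 2) * Gamma (1 - s))"

text \<open>On the (null) diagonal the quotient below is \<open>0 / 0 = 0\<close>.\<close>

definition sobolev_seminorm ::
  "(real ^ 'n) set \<Rightarrow> real \<Rightarrow> real \<Rightarrow> (real ^ 'n \<Rightarrow> real) \<Rightarrow> ennreal" where
  "sobolev_seminorm \<Omega> s p u =
     (if s = 0 then Lp_norm \<Omega> p u
      else if s = 1 then
        (if \<exists>g. has_weak_gradient \<Omega> u g then Lp_norm \<Omega> p (weak_gradient \<Omega> u) else \<infinity>)
      else
        ennreal_powr
          (ennreal (sobolev_const CARD('n) s p) *
            (\<integral>\<^sup>+ (x, y). ennreal (\<bar>u x - u y\<bar> powr p / norm (x - y) powr (real CARD('n) + s * p))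
               \<partial>(lebesgue_on \<Omega> \<Otimes>\<^sub>M lebesgue_on \<Omega>)))
          (1 / p))"

definition sobolev_space ::
  "(real ^ 'n) set \<Rightarrow> real \<Rightarrow> real \<Rightarrow> (real ^ 'n \<Rightarrow> real) set" where
  "sobolev_space \<Omega> s p =
     {u \<in> borel_measurable (lebesgue_on \<Omega>). Lp_norm \<Omega> p u < \<infinity> \<and> sobolev_seminorm \<Omega> s p u < \<infinity>}"

definition sobolev_norm ::
  "(real ^ 'n) set \<Rightarrow> real \<Rightarrow> real \<Rightarrow> (real ^ 'n \<Rightarrow> real) \<Rightarrow> ennreal" where
  "sobolev_norm \<Omega> s p u =
     (if s = 0 then Lp_norm \<Omega> p u
      else ennreal_powr
        (ennreal_powr (sobolev_seminorm \<Omega> s p u) p + ennreal_powr (Lp_norm \<Omega> p u) p) (1 / p))"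

definition continuously_embedded ::
  "(real ^ 'n) set \<Rightarrow> real \<Rightarrow> real \<Rightarrow> real \<Rightarrow> real \<Rightarrow> bool" where
  "continuously_embedded \<Omega> s p s' p' \<longleftrightarrow>
     sobolev_space \<Omega> s p \<subseteq> sobolev_space \<Omega> s' p' \<and>
     (\<exists>C>0. \<forall>u \<in> sobolev_space \<Omega> s p. sobolev_norm \<Omega> s' p' u \<le> ennreal C * sobolev_norm \<Omega> s p u)"

definition embedding_curve :: "real \<Rightarrow> real \<Rightarrow> real \<Rightarrow> real \<Rightarrow> real \<Rightarrow> real \<times> real" where
  "embedding_curve s p s' p' \<theta> =
     (\<theta> * s' + (1 - \<theta>) * s, p * p' / (p' + \<theta> * (p - p')))"

end

theory Submission
  imports Defs
begin

text \<open>
  Every \<open>u\<close> in \<open>W\<^sup>s\<^sup>,\<^sup>p(\<Omega>)\<close> has a Hajlasz gradient: a function \<open>g\<close> in \<open>L\<^sup>p(\<Omega>)\<close> with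
  \<open>\<bar>u x - u y\<bar> \<le> \<bar>x - y\<bar>\<^sup>s (g x + g y)\<close> almost everywhere and norm bounded by that of \<open>u\<close>.
  For \<open>s < 1\<close> one averages over the points of \<open>\<Omega>\<close> near \<open>x\<close>, which form a set of measure
  comparable to that of a ball by the cone property of \<open>\<Omega>\<close>.  For \<open>s = 1\<close> the averages of
  \<open>u\<close> over balls moving inside a cone change at a rate controlled by the maximal function of
  the gradient; this needs \<open>p > 1\<close> and is where \<open>s \<noteq> p\<close> enters.

  Conversely, let \<open>g\<close> be normalised in \<open>L\<^sup>p\<close>.  By Chebyshev and measure density a point \<open>x\<close>
  with \<open>g x = t\<close> has, at distance of order \<open>\<rho> = t powr (- p / N)\<close>, a point where \<open>g\<close> is at
  most \<open>t / 2\<close>.  Summing the resulting geometric series (here \<open>s p < N\<close>) gives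
  \<open>\<bar>u x - u y\<bar> \<le> C * t powr (1 - s * p / N)\<close> whenever \<open>g x, g y \<le> t\<close> and \<open>t \<ge> 1\<close>.
  In the double integral over \<open>g y \<le> g x = t\<close> use the Hajlasz inequality where
  \<open>\<bar>x - y\<bar> < \<rho>\<close> and the latter bound elsewhere; what remains is at most the
  integral of \<open>g\<^sup>p\<close>, for the critical exponent and all smaller ones alike.
\<close>

section \<open>Hajlasz gradients on measure dense sets\<close>

text \<open>The pointwise inequality takes the place of extension operators, interpolation and the
  classical Sobolev inequality: once \<open>g\<close> is available, the target estimate uses only
  that the domain is bounded and measure dense, so \<open>s < 1\<close> and \<open>s = 1\<close>
  share one argument. At distance \<open>\<rho> = t powr (- p / N)\<close> the two bounds on the
  oscillation, \<open>\<rho> powr s * t\<close> and \<open>t powr (1 - s * p / N)\<close>, coincide;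
  the near and the far part of the double integral therefore produce the same power of
  \<open>t\<close>. The obstacle at \<open>s = 1\<close> is that a weak gradient can only be paired
  with test functions, so \<open>u\<close> cannot be integrated along segments. Instead an explicit
  smooth kernel is transported along a path of balls inside the domain. It solves a continuity
  equation: its time derivative is minus the divergence of a field of test functions, which
  expresses the change of the average of \<open>u\<close> through the weak gradient. Along the curve
  \<open>s\<close> and \<open>1 / p\<close> are affine in the parameter and the critical condition
  bounds a slope, hence it passes to every subsegment.\<close>

definition measure_dense :: "'a::euclidean_space set \<Rightarrow> real \<Rightarrow> real \<Rightarrow> bool" where
  "measure_dense S c R \<longleftrightarrow> 0 < c \<and> 0 < R \<and>
     (\<forall>x\<in>S. \<forall>r. 0 < r \<longrightarrow> r \<le> R \<longrightarrow> ennreal (c * r ^ DIM('a)) \<le> emeasure lebesgue (S \<inter> ball x r))"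

text \<open>The exceptional set \<open>Z\<close> is explicit and the same for both variables: the
  chain argument has to pick actual points at which the inequality holds, which an almost-everywhere
  statement about pairs would not provide directly.\<close>

definition hajlasz_gradient ::
  "'a::euclidean_space set \<Rightarrow> 'a set \<Rightarrow> real \<Rightarrow> ('a \<Rightarrow> real) \<Rightarrow> ('a \<Rightarrow> real) \<Rightarrow> bool" where
  "hajlasz_gradient S Z s u g \<longleftrightarrow> Z \<in> null_sets lebesgue \<and> g \<in> borel_measurable (lebesgue_on S) \<and>
     (\<forall>x. 0 \<le> g x) \<and>
     (\<forall>x\<in>S-Z. \<forall>y\<in>S-Z. \<bar>u x - u y\<bar> \<le> norm (x - y) powr s * (g x + g y))"

section \<open>Chebyshev's inequality and chains of points with decreasing gradient\<close>

lemma emeasure_superlevel_le: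
  fixes f :: "'b \<Rightarrow> real"
  assumes [measurable]: "f \<in> borel_measurable M"
    and "0 < t" "0 < p" and int: "(\<integral>\<^sup>+x. ennreal (\<bar>f x\<bar> powr p) \<partial>M) \<le> 1"
  shows "emeasure M {x\<in>space M. t \<le> \<bar>f x\<bar>} \<le> ennreal (t powr - p)"
proof -
  have sub: "{x\<in>space M. t \<le> \<bar>f x\<bar>} \<subseteq> {x\<in>space M. 1 \<le> ennreal (t powr -p) * ennreal (\<bar>f x\<bar> powr p)}"
  proof safe
    fix x assume "t \<le> \<bar>f x\<bar>"
    then have "t powr p \<le> \<bar>f x\<bar> powr p" using assms by (intro powr_mono2) auto
    then have "1 \<le> t powr -p * \<bar>f x\<bar> powr p" using \<open>0 < t\<close> by (simp add: powr_minus field_simps)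
    then show "1 \<le> ennreal (t powr -p) * ennreal (\<bar>f x\<bar> powr p)"
      using ennreal_leI by (fastforce simp flip: ennreal_mult)
  qed
  have "emeasure M {x\<in>space M. t \<le> \<bar>f x\<bar>}
      \<le> emeasure M {x\<in>space M. 1 \<le> ennreal (t powr -p) * ennreal (\<bar>f x\<bar> powr p)}"
    by (intro emeasure_mono sub) measurable
  also have "\<dots> \<le> ennreal (t powr -p) * (\<integral>\<^sup>+x. ennreal (\<bar>f x\<bar> powr p) * indicator (space M) x \<partial>M)"
    by (intro nn_integral_Markov_inequality) auto
  also have "(\<integral>\<^sup>+x. ennreal (\<bar>f x\<bar> powr p) * indicator (space M) x \<partial>M)
      = (\<integral>\<^sup>+x. ennreal (\<bar>f x\<bar> powr p) \<partial>M)"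
    by (intro nn_integral_cong) auto
  also have "ennreal (t powr -p) * \<dots> \<le> ennreal (t powr -p) * 1"
    using int by (intro mult_left_mono) auto
  finally show ?thesis by simp
qed

text \<open>By Chebyshev the set where \<open>\<bar>f\<bar>\<close> is at least \<open>t\<close> has
  measure at most \<open>t powr - p\<close>, too little to cover \<open>A\<close>, even after the
  null set \<open>Z\<close> has been removed from \<open>A\<close>.\<close>

lemma exists_below_level:
  fixes S :: "'a::euclidean_space set" and f :: "'a \<Rightarrow> real"
  assumes S: "S \<in> sets lebesgue" and Z: "Z \<in> null_sets lebesgue" and A: "A \<in> sets lebesgue" "A \<subseteq> S"
    and f: "f \<in> borel_measurable (lebesgue_on S)"
    and "0 < t" "0 < p" and int: "(\<integral>\<^sup>+x. ennreal (\<bar>f x\<bar> powr p) \<partial>lebesgue_on S) \<le> 1"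
    and less: "ennreal (t powr -p) < emeasure lebesgue A"
  shows "\<exists>y\<in>A-Z. \<bar>f y\<bar> < t"
proof (rule ccontr)
  assume "\<not> ?thesis"
  then have sub: "A - Z \<subseteq> {x\<in>space (lebesgue_on S). t \<le> \<bar>f x\<bar>}" using A by (auto simp: not_less)
  have "emeasure lebesgue A = emeasure lebesgue (A - Z)"
    using A Z by (simp add: emeasure_Diff_null_set)
  also have "\<dots> = emeasure (lebesgue_on S) (A - Z)"
    using A by (intro emeasure_restrict_space[symmetric]) (use S in auto)
  also have "\<dots> \<le> emeasure (lebesgue_on S) {x\<in>space (lebesgue_on S). t \<le> \<bar>f x\<bar>}"
    using f by (intro emeasure_mono sub) measurable
  also have "\<dots> \<le> ennreal (t powr -p)"
    by (intro emeasure_superlevel_le assms)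
  finally show False using less by simp
qed

text \<open>A lower level means a larger radius in the search for the next point, so a chain has to
  stop at a level \<open>lam\<close> whose radius still does not exceed \<open>R\<close>. The
  induction runs over the number \<open>n\<close> of halvings that bring \<open>g x\<close> below
  \<open>lam\<close>; the constant \<open>C\<close> does not depend on \<open>n\<close>.\<close>

lemma hajlasz_chain:
  fixes S :: "'a::euclidean_space set" and u g :: "'a \<Rightarrow> real"
  defines "N \<equiv> real DIM('a)"
  assumes dense: "measure_dense S c R" and S: "S \<in> sets lebesgue"
    and s: "0 < s" "1 \<le> p" "s * p < N"
    and haj: "hajlasz_gradient S Z s u g"
    and int: "(\<integral>\<^sup>+x. ennreal (g x powr p) \<partial>lebesgue_on S) \<le> 1"
  defines "K \<equiv> (2 powr (p + 1) / c) powr (1 / N)" and "\<beta> \<equiv> 1 - s * p / N"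
  defines "C \<equiv> 2 * K powr s / (1 - 2 powr - \<beta>)"
  assumes lam: "0 < lam" "K * lam powr - (p / N) \<le> R"
  shows "\<forall>x\<in>S-Z. \<exists>x0\<in>S-Z. g x0 \<le> lam \<and> \<bar>u x - u x0\<bar> \<le> C * g x powr \<beta>"
proof -
  have N: "0 < N" by (simp add: N_def)
  have c: "0 < c" "0 < R" using dense by (auto simp: measure_dense_def)
  have K: "0 < K" using c by (simp add: K_def)
  have beta: "0 < \<beta>" using N s by (simp add: \<beta>_def field_simps)
  have b2: "2 powr -\<beta> < 1" using beta by (simp add: powr_less_one)
  have C: "0 \<le> C" "C * (1 - 2 powr -\<beta>) = 2 * K powr s" using b2 by (auto simp: C_def)
  have g: "g \<in> borel_measurable (lebesgue_on S)" "\<And>x. 0 \<le> g x" "Z \<in> null_sets lebesgue"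
    and uxy: "\<And>x y. x \<in> S - Z \<Longrightarrow> y \<in> S - Z \<Longrightarrow> \<bar>u x - u y\<bar> \<le> norm (x - y) powr s * (g x + g y)"
    using haj by (auto simp: hajlasz_gradient_def)
  have "\<forall>x\<in>S-Z. g x \<le> 2 ^ n * lam \<longrightarrow> (\<exists>x0\<in>S-Z. g x0 \<le> lam \<and> \<bar>u x - u x0\<bar> \<le> C * g x powr \<beta>)" for n
  proof (induction n)
    case 0
    then show ?case using C by (auto intro!: bexI[where x=x for x])
  next
    case (Suc n)
    show ?case
    proof (intro ballI impI)
      fix x assume x: "x \<in> S - Z" and gx: "g x \<le> 2 ^ Suc n * lam"
      show "\<exists>x0\<in>S-Z. g x0 \<le> lam \<and> \<bar>u x - u x0\<bar> \<le> C * g x powr \<beta>"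
      proof (cases "g x \<le> lam")
        case True
        then show ?thesis using x C by (intro bexI[of _ x]) auto
      next
        case False
        define t where "t = g x"
        have t: "0 < t" "lam < t" using False lam by (auto simp: t_def)
        \<comment> \<open>By the choice of \<open>K\<close>, \<open>c * r ^ DIM('a)\<close> equals
          \<open>2 powr (p + 1) * t powr - p\<close>, which is twice the Chebyshev bound at level
          \<open>t / 2\<close>; the factor two makes the comparison strict.\<close>
        define r where "r = K * t powr - (p / N)"
        have "t powr - (p/N) \<le> lam powr - (p/N)" using t lam s N by (intro powr_mono2') auto
        then have "r \<le> K * lam powr - (p / N)" using K by (simp add: r_def)
        moreover have "0 < r" using K t by (simp add: r_def)
        ultimately have r: "0 < r" "r \<le> R" using lam by linarith+
        have KN: "K powr N = 2 powr (p + 1) / c" using N c by (simp add: K_def powr_powr)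
        have "r ^ DIM('a) = r powr N" using r by (simp add: N_def powr_realpow)
        also have "\<dots> = (2 powr (p + 1) / c) * t powr - p"
          using N K t by (simp add: r_def powr_mult powr_powr KN)
        finally have "c * r ^ DIM('a) = 2 powr (p + 1) * t powr -p" using c by simp
        moreover have "(t/2) powr -p = 2 powr p * t powr -p"
          using t by (simp add: powr_divide powr_minus field_simps)
        moreover have "0 < 2 powr p * t powr -p" using t by simp
        ultimately have "(t/2) powr -p < c * r ^ DIM('a)"
          using powr_add[of 2 p 1] t by simp
        then have "ennreal ((t/2) powr -p) < ennreal (c * r ^ DIM('a))"
          by (intro ennreal_lessI) (use c r in auto)
        also have "\<dots> \<le> emeasure lebesgue (S \<inter> ball x r)"
          using dense x r by (auto simp: measure_dense_def)
        finally have ex: "ennreal ((t/2) powr -p) < emeasure lebesgue (S \<inter> ball x r)" .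
        have ab: "\<bar>g x\<bar> = g x" for x using g(2) by simp
        have "\<exists>y\<in>S \<inter> ball x r - Z. \<bar>g y\<bar> < t/2"
          using t s int S by (intro exists_below_level[OF S g(3) _ _ g(1), of _ "t/2" p] ex) (auto simp: ab)
        then obtain y where y: "y \<in> S - Z" "norm (x - y) < r" "g y < t/2"
          using g by (auto simp: dist_norm)
        have "g y \<le> 2 ^ n * lam" using y gx by (simp add: t_def)
        then obtain x0 where x0: "x0 \<in> S - Z" "g x0 \<le> lam" "\<bar>u y - u x0\<bar> \<le> C * g y powr \<beta>"
          using Suc y by blast
        have "\<bar>u x - u y\<bar> \<le> norm (x - y) powr s * (g x + g y)" by (rule uxy[OF x y(1)])
        also have "\<dots> \<le> r powr s * (2 * t)"
          using y r s t g(2)[of y] by (intro mult_mono powr_mono2) (auto simp: t_def)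
        also have "r powr s = K powr s * t powr - (s * p / N)"
          using K t by (simp add: r_def powr_mult powr_powr mult.commute)
        also have "K powr s * t powr - (s * p / N) * (2 * t) = 2 * K powr s * t powr \<beta>"
          using t powr_add[of t 1 "-(s*p/N)"] by (simp add: \<beta>_def)
        finally have 1: "\<bar>u x - u y\<bar> \<le> 2 * K powr s * t powr \<beta>" .
        \<comment> \<open>The induction closes because
          \<open>C = 2 * K powr s + C * 2 powr - \<beta>\<close>: the first term pays for the jump
          from \<open>x\<close> to \<open>y\<close>, the second for the rest of the chain, which
          starts below level \<open>t / 2\<close>.\<close>
        have "g y powr \<beta> \<le> (t/2) powr \<beta>" using y beta g by (intro powr_mono2) auto
        also have "\<dots> = 2 powr -\<beta> * t powr \<beta>" using t by (simp add: powr_divide powr_minus field_simps)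
        finally have "C * g y powr \<beta> \<le> C * (2 powr -\<beta> * t powr \<beta>)" using C by (intro mult_left_mono)
        with 1 x0 have "\<bar>u x - u x0\<bar> \<le> C * (1 - 2 powr -\<beta>) * t powr \<beta> + C * (2 powr -\<beta> * t powr \<beta>)"
          unfolding C by linarith
        also have "\<dots> = C * t powr \<beta>" by (simp add: algebra_simps)
        finally show ?thesis using x0 by (auto simp: t_def)
      qed
    qed
  qed
  moreover have "\<exists>n. g x \<le> 2 ^ n * lam" for x
  proof -
    obtain n where "g x / lam < 2 ^ n" using real_arch_pow[of 2] by auto
    then show ?thesis using lam by (intro exI[of _ n]) (simp add: field_simps)
  qed
  ultimately show ?thesis by blast
qed

section \<open>Integrals of power kernels over dyadic annuli\<close>

lemma exists_dyadic_between:
  fixes a :: real assumes "0 < a" "a < 1"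
  shows "\<exists>j::nat. (1/2) ^ Suc j \<le> a \<and> a < (1/2) ^ j"
proof -
  let ?P = "\<lambda>n::nat. (1/2::real) ^ n \<le> a"
  obtain n where "?P n" using real_arch_pow_inv[of a "1/2"] assms by (auto intro: less_imp_le)
  moreover have "\<not> ?P 0" using assms by simp
  ultimately obtain j where "\<forall>i\<le>j. \<not> ?P i" "?P (Suc j)"
    using ex_least_nat_less[of ?P n] by metis
  then show ?thesis by (intro exI[of _ j]) (auto simp: not_le)
qed

lemma power_powr_swap:
  assumes "0 < (a::real)" shows "(a ^ j) powr e = (a powr e) ^ j"
proof -
  have "(a ^ j) powr e = a powr (real j * e)"
    using assms by (simp only: powr_realpow[symmetric] powr_powr)
  also have "real j * e = e * real j" by (rule mult.commute)
  also have "a powr (e * real j) = (a powr e) powr real j" by (rule powr_powr[symmetric])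
  also have "\<dots> = (a powr e) ^ j" by (rule powr_realpow) (use assms in simp)
  finally show ?thesis .
qed

lemma half_power_powr: "((1/2::real) ^ j) powr e = (2 powr -e) ^ j"
proof -
  have "(1/2::real) powr e = 2 powr -e" by (simp only: powr_minus_divide powr_divide powr_one_eq_one)
  then show ?thesis by (simp only: power_powr_swap[of "1/2"] zero_less_divide_1_iff zero_less_numeral)
qed

lemma emeasure_lebesgue_ball:
  fixes x :: "'a::euclidean_space"
  shows "0 \<le> r \<Longrightarrow> emeasure lebesgue (ball x r) = ennreal (unit_ball_vol DIM('a) * r ^ DIM('a))"
  by (simp add: emeasure_ball)

text \<open>The integrand is dominated by a sum of multiples of indicators of balls, and the
  integrals of these terms form a geometric series. Shrinking radii handle a kernel that is singular
  at \<open>x\<close>, growing radii one with a tail at infinity.\<close>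

lemma nn_integral_dyadic_le:
  fixes b :: "nat \<Rightarrow> real" and x :: "'a::euclidean_space"
  assumes pw: "\<And>y. F y \<noteq> 0 \<Longrightarrow> \<exists>j. norm (x - y) < r j \<and> F y \<le> ennreal (b j)"
    and r: "\<And>j. 0 \<le> r j" and b: "\<And>j. 0 \<le> b j"
    and geo: "\<And>j. b j * r j ^ DIM('a) \<le> K * q ^ j" and q: "0 \<le> q" "q < 1" and K: "0 \<le> K"
  shows "(\<integral>\<^sup>+y. F y \<partial>lebesgue) \<le> ennreal (unit_ball_vol DIM('a) * K / (1 - q))"
proof -
  have "(\<integral>\<^sup>+y. F y \<partial>lebesgue) \<le> (\<integral>\<^sup>+y. (\<Sum>j. ennreal (b j) * indicator (ball x (r j)) y) \<partial>lebesgue)"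
  proof (intro nn_integral_mono)
    fix y
    show "F y \<le> (\<Sum>j. ennreal (b j) * indicator (ball x (r j)) y)"
    proof (cases "F y = 0")
      case False
      then obtain j where j: "norm (x - y) < r j" "F y \<le> ennreal (b j)" using pw by blast
      then have "F y \<le> ennreal (b j) * indicator (ball x (r j)) y"
        by (auto simp: dist_norm)
      also have "\<dots> = (\<Sum>i\<in>{j}. ennreal (b i) * indicator (ball x (r i)) y)"
        by (simp only: sum.insert finite.emptyI empty_iff sum.empty not_False_eq_True add_0_right)
      also have "\<dots> \<le> (\<Sum>j. ennreal (b j) * indicator (ball x (r j)) y)"
        by (intro sum_le_suminf) auto
      finally show ?thesis .
    qed auto
  qed
  also have "\<dots> = (\<Sum>j. \<integral>\<^sup>+y. ennreal (b j) * indicator (ball x (r j)) y \<partial>lebesgue)"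
    by (intro nn_integral_suminf borel_measurable_times_ennreal borel_measurable_const
        borel_measurable_indicator) (auto intro: fmeasurableD)
  also have "\<dots> = (\<Sum>j. ennreal (b j) * ennreal (unit_ball_vol DIM('a) * r j ^ DIM('a)))"
  proof (intro suminf_cong)
    fix j
    have "ball x (r j) \<in> sets lebesgue" by (auto intro: fmeasurableD)
    then show "(\<integral>\<^sup>+y. ennreal (b j) * indicator (ball x (r j)) y \<partial>lebesgue)
        = ennreal (b j) * ennreal (unit_ball_vol DIM('a) * r j ^ DIM('a))"
      by (simp add: nn_integral_cmult_indicator emeasure_ball r)
  qed
  also have "\<dots> \<le> (\<Sum>j. ennreal (unit_ball_vol DIM('a) * K * q ^ j))"
  proof (intro suminf_le)
    fix j
    have "ennreal (b j) * ennreal (unit_ball_vol DIM('a) * r j ^ DIM('a))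
        = ennreal (unit_ball_vol DIM('a) * (b j * r j ^ DIM('a)))"
      using b r by (simp add: ennreal_mult[symmetric] mult_ac)
    also have "\<dots> \<le> ennreal (unit_ball_vol DIM('a) * (K * q ^ j))"
      using geo by (intro ennreal_leI mult_left_mono) auto
    finally show "ennreal (b j) * ennreal (unit_ball_vol DIM('a) * r j ^ DIM('a))
        \<le> ennreal (unit_ball_vol DIM('a) * K * q ^ j)" by (simp add: mult_ac)
  qed auto
  also have "\<dots> = ennreal (\<Sum>j. unit_ball_vol DIM('a) * K * q ^ j)"
    using q K by (intro suminf_ennreal2) (auto intro!: summable_mult summable_geometric)
  also have "(\<Sum>j. unit_ball_vol DIM('a) * K * q ^ j) = unit_ball_vol DIM('a) * K / (1 - q)"
    using q by (subst suminf_mult) (auto intro!: summable_geometric simp: suminf_geometric)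
  finally show ?thesis .
qed

lemma nn_integral_kernel_inner:
  fixes x :: "'a::euclidean_space" and e \<rho> :: real
  assumes e: "0 < e" and rho: "0 < \<rho>"
  shows "(\<integral>\<^sup>+y. ennreal (norm (x - y) powr (e - DIM('a))) * indicator {y. norm (x - y) < \<rho>} y \<partial>lebesgue)
     \<le> ennreal (unit_ball_vol DIM('a) * (2 ^ DIM('a) * \<rho> powr e) / (1 - 2 powr -e))"
proof (rule nn_integral_dyadic_le[where r="\<lambda>j. \<rho> * (1/2)^j"
      and b="\<lambda>j. (\<rho> * (1/2)^j) powr e * (\<rho> * (1/2)^Suc j) powr - DIM('a)"
      and K="2 ^ DIM('a) * \<rho> powr e" and q="2 powr - e"])
  fix y assume "ennreal (norm (x - y) powr (e - DIM('a))) * indicator {y. norm (x - y) < \<rho>} y \<noteq> 0"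
  \<comment> \<open>At \<open>y = x\<close> the kernel is \<open>0 powr _ = 0\<close>, so only
    points different from \<open>x\<close> have to be covered.\<close>
  then have y: "0 < norm (x - y)" "norm (x - y) < \<rho>" by (auto split: split_indicator_asm)
  then obtain j where j: "(1/2)^Suc j \<le> norm (x - y) / \<rho>" "norm (x - y) / \<rho> < (1/2)^j"
    using exists_dyadic_between[of "norm (x - y) / \<rho>"] rho by auto
  then have j: "\<rho> * (1/2)^Suc j \<le> norm (x - y)" "norm (x - y) < \<rho> * (1/2)^j"
    using rho by (auto simp: field_simps)
  \<comment> \<open>The exponent \<open>e - DIM('a)\<close> can have either sign, so it is split:
    the power \<open>e\<close> is bounded at the outer radius of the annulus and the negative power
    at the inner one.\<close>
  have "norm (x - y) powr (e - DIM('a)) = norm (x - y) powr e * norm (x - y) powr - DIM('a)"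
    using y by (simp add: powr_add[symmetric])
  also have "\<dots> \<le> (\<rho> * (1/2)^j) powr e * (\<rho> * (1/2)^Suc j) powr - DIM('a)"
    using j e rho y by (intro mult_mono powr_mono2 powr_mono2') auto
  finally show "\<exists>j. norm (x - y) < \<rho> * (1/2)^j \<and>
     ennreal (norm (x - y) powr (e - DIM('a))) * indicator {y. norm (x - y) < \<rho>} y
       \<le> ennreal ((\<rho> * (1/2)^j) powr e * (\<rho> * (1/2)^Suc j) powr - DIM('a))"
    using j y by (auto simp: ennreal_leI intro!: exI[of _ j])
next
  fix j
  have "(\<rho> * (1/2)^Suc j) powr - DIM('a) * (\<rho> * (1/2)^j) ^ DIM('a) = 2 ^ DIM('a)"
  proof -
    define a where "a = \<rho> * (1/2)^j"
    have a: "0 < a" using rho by (simp add: a_def)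
    have "\<rho> * (1/2)^Suc j = a / 2" by (simp add: a_def)
    moreover have "(a/2) powr - DIM('a) = 2 ^ DIM('a) / a ^ DIM('a)"
      using a powr_minus_divide[of "a/2" "DIM('a)"] powr_realpow[of "a/2" "DIM('a)"] by (simp add: power_divide)
    ultimately show ?thesis using a by (simp only: flip: a_def) simp
  qed
  moreover have "(\<rho> * (1/2)^j) powr e = \<rho> powr e * (2 powr -e)^j"
    using rho by (simp only: powr_mult half_power_powr)
  ultimately show "(\<rho> * (1/2)^j) powr e * (\<rho> * (1/2)^Suc j) powr - DIM('a) * (\<rho> * (1/2)^j) ^ DIM('a)
      \<le> 2 ^ DIM('a) * \<rho> powr e * (2 powr - e)^j"
    by (simp only: mult.assoc) (simp only: mult.left_commute[of "2 ^ DIM('a)"] mult.commute[of "2 ^ DIM('a)"] mult.assoc order_refl)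
next
  show "2 powr - e < 1" using e by (intro powr_less_one) auto
next
  fix j show "0 \<le> \<rho> * (1/2)^j"
    using rho by (intro mult_nonneg_nonneg) auto
qed (auto intro!: mult_nonneg_nonneg)

lemma nn_integral_kernel_outer:
  fixes x :: "'a::euclidean_space" and e \<rho> :: real
  assumes e: "0 < e" and rho: "0 < \<rho>"
  shows "(\<integral>\<^sup>+y. ennreal (norm (x - y) powr (- e - DIM('a))) * indicator {y. \<rho> \<le> norm (x - y)} y \<partial>lebesgue)
     \<le> ennreal (unit_ball_vol DIM('a) * (2 ^ DIM('a) * \<rho> powr -e) / (1 - 2 powr -e))"
proof (rule nn_integral_dyadic_le[where r="\<lambda>j. 2 * \<rho> * 2^j"
      and b="\<lambda>j. (\<rho> * 2^j) powr (- e - DIM('a))"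
      and K="2 ^ DIM('a) * \<rho> powr - e" and q="2 powr - e"])
  fix y assume "ennreal (norm (x - y) powr (- e - DIM('a))) * indicator {y. \<rho> \<le> norm (x - y)} y \<noteq> 0"
  then have y: "0 < norm (x - y)" "\<rho> \<le> norm (x - y)" using rho by (auto split: split_indicator_asm)
  \<comment> \<open>The factor two in the denominator keeps the quotient below one also when
    \<open>norm (x - y) = \<rho>\<close>. It yields annuli that are closed at the outer end; the
    case distinction below turns them into annuli closed at the inner end.\<close>
  then have "\<exists>j. (1/2)^Suc j \<le> \<rho> / (2 * norm (x - y)) \<and> \<rho> / (2 * norm (x - y)) < (1/2)^j"
    using rho by (intro exists_dyadic_between) auto
  then obtain j where "(1/2)^Suc j \<le> \<rho> / (2 * norm (x - y))" "\<rho> / (2 * norm (x - y)) < (1/2)^j" by blast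
  then have j: "norm (x - y) \<le> \<rho> * 2^j" "\<rho> * 2 ^ j < 2 * norm (x - y)"
    using y by (auto simp: field_simps)
  then obtain i where i: "\<rho> * 2^i \<le> norm (x - y)" "norm (x - y) < \<rho> * 2^Suc i"
  proof (cases "norm (x - y) = \<rho> * 2^j")
    case True then show ?thesis using that[of j] rho by auto
  next
    case False
    then have "j \<noteq> 0" using j y by (intro notI) auto
    then obtain i where "j = Suc i" by (cases j) auto
    then show ?thesis using that[of i] j False by auto
  qed
  have "norm (x - y) powr (- e - DIM('a)) \<le> (\<rho> * 2^i) powr (- e - DIM('a))"
    using i e rho y by (intro powr_mono2') auto
  then show "\<exists>j. norm (x - y) < 2 * \<rho> * 2^j \<and>
     ennreal (norm (x - y) powr (- e - DIM('a))) * indicator {y. \<rho> \<le> norm (x - y)} y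
       \<le> ennreal ((\<rho> * 2^j) powr (- e - DIM('a)))"
    using i y by (auto simp: ennreal_leI intro!: exI[of _ i])
next
  fix j
  define a where "a = \<rho> * 2^j"
  have a: "0 < a" using rho by (simp add: a_def)
  have "a powr (- e - DIM('a)) * (2 * a) ^ DIM('a) = 2 ^ DIM('a) * a powr -e"
    using a by (simp add: powr_diff powr_realpow power_mult_distrib)
  also have "a powr -e = \<rho> powr -e * (2 powr -e)^j"
    unfolding a_def by (simp only: powr_mult power_powr_swap[OF zero_less_numeral])
  finally show "(\<rho> * 2^j) powr (- e - DIM('a)) * (2 * \<rho> * 2^j) ^ DIM('a)
      \<le> 2 ^ DIM('a) * \<rho> powr - e * (2 powr - e)^j"
    by (simp add: a_def mult.assoc)
next
  show "2 powr - e < 1" using e by (intro powr_less_one) auto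
next
  fix j show "0 \<le> 2 * \<rho> * 2^j"
    using rho by (intro mult_nonneg_nonneg) auto
qed (auto intro!: mult_nonneg_nonneg)

section \<open>Gagliardo integrals controlled by a Hajlasz gradient\<close>

lemma nn_integral_lebesgue_on_le:
  assumes "S \<in> sets lebesgue"
  shows "(\<integral>\<^sup>+x. f x \<partial>lebesgue_on S) \<le> (\<integral>\<^sup>+x. f x \<partial>lebesgue)"
  using assms by (subst nn_integral_restrict_space) (auto intro!: nn_integral_mono split: split_indicator)

lemma measurable_id_lebesgue_on: "(\<lambda>x. x) \<in> borel_measurable (lebesgue_on (S :: 'a::euclidean_space set))"
  by (intro measurable_restrict_space1 measurable_completion) simp

lemma norm_diff_measurable_lebesgue_on:
  "(\<lambda>z. norm (fst z - snd z :: 'a::euclidean_space)) \<in> borel_measurable (lebesgue_on S \<Otimes>\<^sub>M lebesgue_on T)"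
proof -
  note measurable_compose[OF measurable_fst measurable_id_lebesgue_on, measurable]
    measurable_compose[OF measurable_snd measurable_id_lebesgue_on, measurable]
  show ?thesis by measurable
qed

lemma gagliardo_integrand_measurable:
  fixes u :: "'a::euclidean_space \<Rightarrow> real"
  assumes u: "u \<in> borel_measurable (lebesgue_on S)"
  shows "(\<lambda>z. ennreal (\<bar>u (fst z) - u (snd z)\<bar> powr p / norm (fst z - snd z) powr q))
     \<in> borel_measurable (lebesgue_on S \<Otimes>\<^sub>M lebesgue_on S)"
proof -
  note norm_diff_measurable_lebesgue_on[measurable] u[measurable]
  show ?thesis by measurable
qed

text \<open>At least one of \<open>h y \<le> h x\<close> and \<open>h x \<le> h y\<close> holds, so
  the integrand is dominated by its restriction to one half plus the mirror image of that
  restriction, and by Tonelli both have the same integral. Ties are counted twice, whence an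
  inequality.\<close>

lemma nn_integral_symmetric_le:
  fixes F :: "'b \<Rightarrow> 'b \<Rightarrow> ennreal" and h :: "'b \<Rightarrow> real"
  assumes "sigma_finite_measure M" and F: "(\<lambda>z. F (fst z) (snd z)) \<in> borel_measurable (M \<Otimes>\<^sub>M M)"
    and h: "h \<in> borel_measurable M" and sym: "\<And>x y. F x y = F y x"
  shows "(\<integral>\<^sup>+(x,y). F x y \<partial>(M \<Otimes>\<^sub>M M)) \<le> 2 * (\<integral>\<^sup>+x. \<integral>\<^sup>+y. F x y * indicator {y. h y \<le> h x} y \<partial>M \<partial>M)"
proof -
  interpret M: sigma_finite_measure M by fact
  interpret pair_sigma_finite M M ..
  note F[measurable] h[measurable]
  define G where "G z = F (fst z) (snd z) * indicator {z. h (snd z) \<le> h (fst z)} z" for z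
  have G[measurable]: "G \<in> borel_measurable (M \<Otimes>\<^sub>M M)" unfolding G_def by measurable
  then have G': "(\<lambda>z. G (snd z, fst z)) \<in> borel_measurable (M \<Otimes>\<^sub>M M)" by measurable
  have "(\<integral>\<^sup>+(x,y). F x y \<partial>(M \<Otimes>\<^sub>M M)) \<le> (\<integral>\<^sup>+z. G z + G (snd z, fst z) \<partial>(M \<Otimes>\<^sub>M M))"
    by (intro nn_integral_mono) (auto simp: G_def sym split: split_indicator)
  also have "\<dots> = (\<integral>\<^sup>+z. G z \<partial>(M \<Otimes>\<^sub>M M)) + (\<integral>\<^sup>+z. G (snd z, fst z) \<partial>(M \<Otimes>\<^sub>M M))"
    by (intro nn_integral_add G G')
  also have "(\<integral>\<^sup>+z. G (snd z, fst z) \<partial>(M \<Otimes>\<^sub>M M)) = (\<integral>\<^sup>+x. \<integral>\<^sup>+y. G (x, y) \<partial>M \<partial>M)"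
    using nn_integral_snd[OF G'] by simp
  also have "(\<integral>\<^sup>+z. G z \<partial>(M \<Otimes>\<^sub>M M)) = (\<integral>\<^sup>+x. \<integral>\<^sup>+y. G (x, y) \<partial>M \<partial>M)"
    using M.nn_integral_fst[OF G] by simp
  also have "(\<integral>\<^sup>+x. \<integral>\<^sup>+y. G (x, y) \<partial>M \<partial>M) + (\<integral>\<^sup>+x. \<integral>\<^sup>+y. G (x, y) \<partial>M \<partial>M)
      = 2 * (\<integral>\<^sup>+x. \<integral>\<^sup>+y. G (x, y) \<partial>M \<partial>M)" by (simp add: mult_2)
  also have "(\<integral>\<^sup>+x. \<integral>\<^sup>+y. G (x, y) \<partial>M \<partial>M) = (\<integral>\<^sup>+x. \<integral>\<^sup>+y. F x y * indicator {y. h y \<le> h x} y \<partial>M \<partial>M)"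
    by (intro nn_integral_cong) (auto simp: G_def split: split_indicator)
  finally show ?thesis .
qed

lemma AE_lebesgue_on_null:
  assumes "Z \<in> null_sets lebesgue" "S \<in> sets lebesgue" "\<And>x. x \<in> S - Z \<Longrightarrow> P x"
  shows "AE x in lebesgue_on S. P x"
proof -
  have "AE x in lebesgue. x \<notin> Z" using assms by (intro AE_not_in)
  then have "AE x in lebesgue. x \<in> S \<longrightarrow> P x" by eventually_elim (use assms in auto)
  then show ?thesis using assms by (subst AE_restrict_space_iff) auto
qed

lemma AE_lebesgue_on_null_set:
  assumes "AE x in lebesgue_on S. P x" and S: "S \<in> sets lebesgue"
  obtains Z where "Z \<in> null_sets lebesgue" "\<And>x. x \<in> S - Z \<Longrightarrow> P x"
proof -
  have "AE x in lebesgue. x \<in> S \<longrightarrow> P x" using assms by (subst (asm) AE_restrict_space_iff) auto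
  then obtain Z where Z: "{x \<in> space lebesgue. \<not> (x \<in> S \<longrightarrow> P x)} \<subseteq> Z"
    "emeasure lebesgue Z = 0" "Z \<in> sets lebesgue" by (rule AE_E)
  show ?thesis
  proof (rule that)
    show "Z \<in> null_sets lebesgue" by (rule null_setsI[OF Z(2,3)])
    show "P x" if "x \<in> S - Z" for x using Z(1) that by auto
  qed
qed

text \<open>Both parts of the integral scale alike: the kernel contributes
  \<open>\<rho> powr e1\<close> inside radius \<open>\<rho>\<close> and
  \<open>\<rho> powr - e2\<close> outside, and with \<open>\<rho> = h x powr - (p / N)\<close> both
  products are multiples of \<open>h x\<close> to the power
  \<open>p' * (1 - (s - s') * p / N)\<close>. Criticality says that this exponent is at most
  \<open>p\<close>, and \<open>h x\<close> is at least one.\<close>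

lemma hajlasz_gagliardo_inner:
  fixes S :: "'a::euclidean_space set" and u g h :: "'a \<Rightarrow> real"
  defines "N \<equiv> real DIM('a)"
  assumes S: "S \<in> sets lebesgue" and Z: "Z \<in> null_sets lebesgue"
    and s: "0 < s" "1 \<le> p" "0 < s'" "s' < s" "1 \<le> p'"
      "p' * (1 - (s - s') * p / N) \<le> p"
    and h1: "1 \<le> h x" and C2: "0 \<le> C2"
    and near: "\<And>y. y \<in> S - Z \<Longrightarrow> h y \<le> h x \<Longrightarrow> \<bar>u x - u y\<bar> \<le> norm (x - y) powr s * (2 * h x)"
    and far: "\<And>y. y \<in> S - Z \<Longrightarrow> h y \<le> h x \<Longrightarrow> \<bar>u x - u y\<bar> \<le> C2 * h x powr (1 - s * p / N)"
  defines "e1 \<equiv> (s - s') * p'" and "e2 \<equiv> s' * p'"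
  shows "(\<integral>\<^sup>+y. ennreal (\<bar>u x - u y\<bar> powr p' / norm (x - y) powr (N + s' * p')) *
           indicator {y. h y \<le> h x} y \<partial>lebesgue_on S)
     \<le> ennreal ((2 powr p' * (unit_ball_vol DIM('a) * 2 ^ DIM('a) / (1 - 2 powr - e1))
            + C2 powr p' * (unit_ball_vol DIM('a) * 2 ^ DIM('a) / (1 - 2 powr - e2))) * h x powr p)"
proof -
  have N: "0 < N" by (simp add: N_def)
  define \<beta> where "\<beta> = 1 - s * p / N"
  define \<rho> where "\<rho> = h x powr - (p / N)"
  have rho: "0 < \<rho>" using h1 by (simp add: \<rho>_def)
  have e: "0 < e1" "0 < e2" using s by (auto simp: e1_def e2_def)
  define V where "V = unit_ball_vol DIM('a) * 2 ^ DIM('a)"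
  have V: "0 \<le> V" by (simp add: V_def)
  have q: "2 powr - e1 < 1" "2 powr - e2 < 1" using e by (auto intro!: powr_less_one)
  define k1 where "k1 y = ennreal (norm (x - y) powr (e1 - N)) * indicator {y. norm (x - y) < \<rho>} y" for y
  define k2 where "k2 y = ennreal (norm (x - y) powr (- e2 - N)) * indicator {y. \<rho> \<le> norm (x - y)} y" for y
  have meas: "(\<lambda>y. norm (x - y)) \<in> borel_measurable lebesgue"
    by (intro measurable_completion) simp
  have k[measurable]: "k1 \<in> borel_measurable lebesgue" "k2 \<in> borel_measurable lebesgue"
    unfolding k1_def[abs_def] k2_def[abs_def] using meas by measurable
  have "(\<integral>\<^sup>+y. ennreal (\<bar>u x - u y\<bar> powr p' / norm (x - y) powr (N + s' * p')) *
           indicator {y. h y \<le> h x} y \<partial>lebesgue_on S)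
     \<le> (\<integral>\<^sup>+y. ennreal ((2 * h x) powr p') * k1 y + ennreal ((C2 * h x powr \<beta>) powr p') * k2 y \<partial>lebesgue_on S)"
  proof (intro nn_integral_mono_AE AE_lebesgue_on_null[OF Z S])
    fix y assume y: "y \<in> S - Z"
    show "ennreal (\<bar>u x - u y\<bar> powr p' / norm (x - y) powr (N + s' * p')) * indicator {y. h y \<le> h x} y
      \<le> ennreal ((2 * h x) powr p') * k1 y + ennreal ((C2 * h x powr \<beta>) powr p') * k2 y"
    proof (cases "h y \<le> h x \<and> x \<noteq> y")
      case True
      then have d: "0 < norm (x - y)" by simp
      show ?thesis
      proof (cases "norm (x - y) < \<rho>")
        case r: True
        have "\<bar>u x - u y\<bar> powr p' \<le> (norm (x - y) powr s * (2 * h x)) powr p'"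
          using near[OF y] True s by (intro powr_mono2) auto
        also have "\<dots> = (2 * h x) powr p' * norm (x - y) powr (s * p')"
          by (simp only: powr_mult powr_powr mult.commute)
        finally have "\<bar>u x - u y\<bar> powr p' / norm (x - y) powr (N + s' * p')
            \<le> (2 * h x) powr p' * norm (x - y) powr (s * p') / norm (x - y) powr (N + s' * p')"
          by (intro divide_right_mono) auto
        also have "\<dots> = (2 * h x) powr p' * norm (x - y) powr (e1 - N)"
          using powr_diff[of "norm (x - y)" "s * p'" "N + s' * p'"] by (simp add: e1_def algebra_simps)
        finally show ?thesis using True r
          by (simp add: k1_def k2_def ennreal_mult[symmetric] ennreal_leI)
      next
        case r: False
        have "\<bar>u x - u y\<bar> powr p' \<le> (C2 * h x powr \<beta>) powr p'"
          using far[OF y] True s by (intro powr_mono2) (auto simp: \<beta>_def)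
        then have "\<bar>u x - u y\<bar> powr p' / norm (x - y) powr (N + s' * p')
            \<le> (C2 * h x powr \<beta>) powr p' / norm (x - y) powr (N + s' * p')"
          by (intro divide_right_mono) auto
        also have "\<dots> = (C2 * h x powr \<beta>) powr p' * norm (x - y) powr (- e2 - N)"
        proof -
          have "- e2 - N = - (N + s' * p')" by (simp add: e2_def)
          then show ?thesis by (simp only: powr_minus_divide) simp
        qed
        finally show ?thesis using True r
          by (simp add: k1_def k2_def ennreal_mult[symmetric] ennreal_leI)
      qed
    qed (auto split: split_indicator)
  qed
  also have "\<dots> \<le> (\<integral>\<^sup>+y. ennreal ((2 * h x) powr p') * k1 y + ennreal ((C2 * h x powr \<beta>) powr p') * k2 y \<partial>lebesgue)"
    by (rule nn_integral_lebesgue_on_le[OF S])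
  also have "\<dots> = ennreal ((2 * h x) powr p') * (\<integral>\<^sup>+y. k1 y \<partial>lebesgue)
      + ennreal ((C2 * h x powr \<beta>) powr p') * (\<integral>\<^sup>+y. k2 y \<partial>lebesgue)"
    by (simp add: nn_integral_add nn_integral_cmult)
  also have "\<dots> \<le> ennreal ((2 * h x) powr p') * ennreal (V * \<rho> powr e1 / (1 - 2 powr - e1))
      + ennreal ((C2 * h x powr \<beta>) powr p') * ennreal (V * \<rho> powr - e2 / (1 - 2 powr - e2))"
    using nn_integral_kernel_inner[OF e(1) rho, of x] nn_integral_kernel_outer[OF e(2) rho, of x]
    unfolding k1_def k2_def V_def N_def mult.assoc
    by (intro add_mono mult_left_mono) auto
  also have "\<dots> = ennreal ((2 * h x) powr p' * (V * \<rho> powr e1 / (1 - 2 powr - e1))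
      + (C2 * h x powr \<beta>) powr p' * (V * \<rho> powr - e2 / (1 - 2 powr - e2)))"
    using V q by (simp add: ennreal_mult[symmetric] ennreal_plus[symmetric] del: ennreal_plus)
  also have "\<dots> \<le> ennreal ((2 powr p' * (V / (1 - 2 powr - e1)) + C2 powr p' * (V / (1 - 2 powr - e2))) * h x powr p)"
  proof (intro ennreal_leI)
    define a where "a = p' * (1 - (s - s') * p / N)"
    have ha: "h x powr a \<le> h x powr p" using h1 s by (intro powr_mono) (auto simp: a_def)
    have "h x powr p' * \<rho> powr e1 = h x powr (p' + - (p / N) * e1)"
      by (simp only: \<rho>_def powr_powr powr_add)
    also have "p' + - (p / N) * e1 = a"
    proof -
      have "(s - s') * p / N = (s - s') * (p / N)" by simp
      then show ?thesis unfolding a_def e1_def by (simp only:) (simp only: algebra_simps)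
    qed
    finally have 1: "(2 * h x) powr p' * \<rho> powr e1 = 2 powr p' * h x powr a"
      by (simp only: powr_mult mult.assoc)
    have "(h x powr \<beta>) powr p' * \<rho> powr - e2 = h x powr (\<beta> * p' + - (p / N) * - e2)"
      by (simp only: \<rho>_def powr_powr powr_add)
    also have "\<beta> * p' + - (p / N) * - e2 = a"
    proof -
      define k where "k = p / N"
      have k: "s * p / N = s * k" "(s - s') * p / N = (s - s') * k" by (simp_all add: k_def)
      show ?thesis unfolding a_def e2_def \<beta>_def k k_def[symmetric] by (simp only: algebra_simps)
    qed
    finally have 2: "(C2 * h x powr \<beta>) powr p' * \<rho> powr - e2 = C2 powr p' * h x powr a"
      by (simp only: powr_mult mult.assoc)
    have "(2 * h x) powr p' * (V * \<rho> powr e1 / (1 - 2 powr - e1))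
      + (C2 * h x powr \<beta>) powr p' * (V * \<rho> powr - e2 / (1 - 2 powr - e2))
      = ((2 * h x) powr p' * \<rho> powr e1) * (V / (1 - 2 powr - e1))
      + ((C2 * h x powr \<beta>) powr p' * \<rho> powr - e2) * (V / (1 - 2 powr - e2))"
      by (simp add: mult_ac)
    also have "\<dots> = (2 powr p' * (V / (1 - 2 powr - e1)) + C2 powr p' * (V / (1 - 2 powr - e2))) * h x powr a"
      unfolding 1 2 by (simp add: algebra_simps)
    also have "\<dots> \<le> (2 powr p' * (V / (1 - 2 powr - e1)) + C2 powr p' * (V / (1 - 2 powr - e2))) * h x powr p"
      using V q by (intro mult_left_mono ha add_nonneg_nonneg mult_nonneg_nonneg divide_nonneg_nonneg) auto
    finally show "(2 * h x) powr p' * (V * \<rho> powr e1 / (1 - 2 powr - e1))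
      + (C2 * h x powr \<beta>) powr p' * (V * \<rho> powr - e2 / (1 - 2 powr - e2))
      \<le> (2 powr p' * (V / (1 - 2 powr - e1)) + C2 powr p' * (V / (1 - 2 powr - e2))) * h x powr p" .
  qed
  finally show ?thesis by (simp add: V_def)
qed

lemma ennreal_integral_const_bound:
  assumes "emeasure M (space M) \<noteq> \<infinity>" "0 \<le> (k::real)" "f \<in> borel_measurable M" "(\<integral>\<^sup>+x. f x \<partial>M) \<le> ennreal a" "0 \<le> a"
  shows "(\<integral>\<^sup>+x. f x + ennreal k \<partial>M) \<le> ennreal (a + k * measure M (space M))"
proof -
  have "(\<integral>\<^sup>+x. f x + ennreal k \<partial>M) = (\<integral>\<^sup>+x. f x \<partial>M) + ennreal k * emeasure M (space M)"
    using assms by (subst nn_integral_add) auto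
  also have "\<dots> \<le> ennreal a + ennreal k * ennreal (measure M (space M))"
    using assms by (intro add_mono mult_left_mono) (auto simp: emeasure_eq_ennreal_measure)
  also have "\<dots> = ennreal (a + k * measure M (space M))"
    using assms by (simp add: ennreal_mult[symmetric] ennreal_plus[symmetric] del: ennreal_plus)
  finally show ?thesis .
qed

text \<open>The hypotheses are normalised to integrals of at most one, so that Chebyshev applies
  without constants; homogeneity gives back the general case later. The double integral is
  restricted to \<open>0 < s'\<close>, since for \<open>s' = 0\<close> the geometric series of its
  far part would have ratio one.\<close>

theorem hajlasz_embedding:
  fixes S :: "'a::euclidean_space set"
  defines "N \<equiv> real DIM('a)"
  assumes dense: "measure_dense S c R" and S: "S \<in> sets lebesgue" "bounded S" "S \<noteq> {}"
    and s: "0 < s" "1 \<le> p" "s * p < N" and s': "0 \<le> s'" "s' < s" "1 \<le> p'"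
    and crit: "p' * (N - (s - s') * p) \<le> N * p"
  obtains C where "0 < C"
    "\<And>u g Z. u \<in> borel_measurable (lebesgue_on S) \<Longrightarrow> hajlasz_gradient S Z s u g \<Longrightarrow>
       (\<integral>\<^sup>+x. ennreal (g x powr p) \<partial>lebesgue_on S) \<le> 1 \<Longrightarrow>
       (\<integral>\<^sup>+x. ennreal (\<bar>u x\<bar> powr p) \<partial>lebesgue_on S) \<le> 1 \<Longrightarrow>
       (\<integral>\<^sup>+x. ennreal (\<bar>u x\<bar> powr p') \<partial>lebesgue_on S) \<le> ennreal C \<and>
       (0 < s' \<longrightarrow> (\<integral>\<^sup>+(x,y). ennreal (\<bar>u x - u y\<bar> powr p' / norm (x - y) powr (N + s' * p'))
           \<partial>(lebesgue_on S \<Otimes>\<^sub>M lebesgue_on S)) \<le> ennreal C)"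
proof -
  have N: "0 < N" by (simp add: N_def)
  define \<beta> where "\<beta> = 1 - s * p / N"
  have beta: "0 < \<beta>" using N s by (simp add: \<beta>_def field_simps)
  have Sfin: "S \<in> lmeasurable" using S by (intro bounded_set_imp_lmeasurable)
  define m where "m = measure lebesgue S"
  have m: "emeasure lebesgue S = ennreal m" using Sfin by (simp add: m_def emeasure_eq_measure2)
  have mS: "measure (lebesgue_on S) (space (lebesgue_on S)) = m"
    using S by (simp add: m_def measure_restrict_space)
  have eS: "emeasure (lebesgue_on S) (space (lebesgue_on S)) = ennreal m"
    using S m by (simp add: emeasure_restrict_space)
  interpret finite_measure "lebesgue_on S" by (intro finite_measureI) (simp only: eS ennreal_neq_top infinity_ennreal_def not_False_eq_True)
  obtain x1 where "x1 \<in> S" using S by auto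
  have cR: "0 < c" "0 < R" using dense by (auto simp: measure_dense_def)
  have "ennreal (c * R ^ DIM('a)) \<le> emeasure lebesgue (S \<inter> ball x1 R)"
    using dense \<open>x1 \<in> S\<close> by (auto simp: measure_dense_def)
  also have "\<dots> \<le> emeasure lebesgue S" using S by (intro emeasure_mono) auto
  finally have "c * R ^ DIM('a) \<le> m" unfolding m by (simp add: m_def)
  then have m0: "0 < m" using cR by (smt (verit) mult_pos_pos zero_less_power)
  obtain d where d: "0 < d" "\<And>x y. x \<in> S \<Longrightarrow> y \<in> S \<Longrightarrow> norm (x - y) \<le> d"
  proof -
    obtain b where b: "\<forall>x\<in>S. norm x \<le> b" "0 < b" using S by (auto simp: bounded_pos)
    have "norm (x - y) \<le> 2 * b" if "x \<in> S" "y \<in> S" for x y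
      using b(1)[rule_format, OF that(1)] b(1)[rule_format, OF that(2)] norm_triangle_ineq4[of x y] by linarith
    then show ?thesis using b by (intro that[of "2 * b"]) auto
  qed
  define K where "K = (2 powr (p + 1) / c) powr (1 / N)"
  define C1 where "C1 = 2 * K powr s / (1 - 2 powr - \<beta>)"
  have "2 powr -\<beta> < 1" using beta by (intro powr_less_one) auto
  then have C1: "0 \<le> C1" by (auto simp: C1_def)
  \<comment> \<open>Three demands on the level: it is at least one, so that powers can be compared
    by their exponents; the radii of all chains stay below \<open>R\<close>; and the superlevel set
    at \<open>lam / 2\<close> has smaller measure than \<open>S\<close>, which produces the
    reference point \<open>y0\<close> below.\<close>
  obtain lam where lam: "1 \<le> lam" "K * lam powr - (p / N) \<le> R" "(lam / 2) powr - p < m"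
  proof -
    have "filterlim (\<lambda>l::real. K * l powr - (p / N)) (nhds 0) at_top"
      using s N by (intro tendsto_mult_right_zero tendsto_neg_powr filterlim_ident) auto
    then have 1: "\<forall>\<^sub>F l in at_top. K * l powr - (p / N) < R" using cR by (auto intro: order_tendstoD)
    have "filterlim (\<lambda>l::real. l / 2) at_top at_top"
      using filterlim_tendsto_pos_mult_at_top[OF tendsto_const[of "1/2 :: real"] _ filterlim_ident] by simp
    then have "filterlim (\<lambda>l::real. (l / 2) powr - p) (nhds 0) at_top"
      using s by (intro tendsto_neg_powr) auto
    then have 2: "\<forall>\<^sub>F l in at_top. (l / 2) powr - p < m" using m0 by (auto intro: order_tendstoD)
    have "\<forall>\<^sub>F l in at_top. K * l powr - (p / N) < R \<and> (l / 2) powr - p < m \<and> 1 \<le> l"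
      by (intro eventually_conj 1 2 eventually_ge_at_top)
    then obtain l where "K * l powr - (p / N) < R \<and> (l / 2) powr - p < m \<and> 1 \<le> l"
      using eventually_happens'[OF trivial_limit_at_top_linorder] by blast
    then have "1 \<le> l" "K * l powr - (p / N) \<le> R" "(l / 2) powr - p < m" by (simp_all only: less_imp_le)
    then show ?thesis by (rule that)
  qed
  \<comment> \<open>Two chains, one from each point, end in points where \<open>g\<close> is at most
    \<open>lam\<close>. These are at distance at most \<open>d\<close>, so joining them costs
    \<open>d powr s * (2 * lam)\<close>.\<close>
  define C2 where "C2 = 2 * C1 + 2 * lam * d powr s"
  have C2: "0 \<le> C2" using C1 lam by (simp add: C2_def)
  define C3 where "C3 = 1 + lam powr p * m"
  define e1 where "e1 = (s - s') * p'"
  define e2 where "e2 = s' * p'"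
  define C4 where "C4 = 2 powr p' * (unit_ball_vol DIM('a) * 2 ^ DIM('a) / (1 - 2 powr - e1))
            + C2 powr p' * (unit_ball_vol DIM('a) * 2 ^ DIM('a) / (1 - 2 powr - e2))"
  define C5 where "C5 = (lam + C2) powr p'"
  define C where "C = max (C5 * C3) (2 * (C4 * C3)) + 1"
  have C3: "0 \<le> C3" using m0 by (simp add: C3_def)
  have C5: "0 \<le> C5" by (simp add: C5_def)
  have crit': "p' * (1 - (s - s') * p / N) \<le> p" using crit N by (simp add: field_simps)
  \<comment> \<open>The pointwise bound on \<open>u\<close> produces the exponent
    \<open>\<beta> * p'\<close>, which does not exceed the one in the critical condition because
    \<open>s - s' \<le> s\<close>.\<close>
  have "p' * (1 - s * p / N) \<le> p' * (1 - (s - s') * p / N)"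
    using s s' N by (intro mult_left_mono diff_left_mono divide_right_mono mult_right_mono) auto
  then have bp: "\<beta> * p' \<le> p" using crit' by (simp add: \<beta>_def mult.commute)
  show ?thesis
  proof (rule that)
    have "0 \<le> C5 * C3" using C3 C5 by simp
    then show "0 < C" by (simp add: C_def max_def)
    fix u g Z
    assume u: "u \<in> borel_measurable (lebesgue_on S)" and haj: "hajlasz_gradient S Z s u g"
      and gint: "(\<integral>\<^sup>+x. ennreal (g x powr p) \<partial>lebesgue_on S) \<le> 1"
      and uint: "(\<integral>\<^sup>+x. ennreal (\<bar>u x\<bar> powr p) \<partial>lebesgue_on S) \<le> 1"
    have Z: "Z \<in> null_sets lebesgue" and g: "g \<in> borel_measurable (lebesgue_on S)" "\<And>x. 0 \<le> g x"
      and uxy: "\<And>x y. x \<in> S - Z \<Longrightarrow> y \<in> S - Z \<Longrightarrow> \<bar>u x - u y\<bar> \<le> norm (x - y) powr s * (g x + g y)"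
      using haj by (auto simp: hajlasz_gradient_def)
    note u[measurable] g(1)[measurable]
    \<comment> \<open>Truncation from below at \<open>lam\<close> makes every level at least one,
      and it adds only \<open>lam powr p * m\<close> to the integral because \<open>S\<close> has
      finite measure.\<close>
    define h where "h x = max (g x) lam" for x
    have h[measurable]: "h \<in> borel_measurable (lebesgue_on S)" unfolding h_def[abs_def] by measurable
    have h1: "1 \<le> h x" "lam \<le> h x" "g x \<le> h x" for x using lam by (auto simp: h_def)
    have hp: "1 \<le> h x powr \<beta>" for x using h1 beta by (simp add: ge_one_powr_ge_zero)
    have chain: "\<forall>x\<in>S-Z. \<exists>x0\<in>S-Z. g x0 \<le> lam \<and> \<bar>u x - u x0\<bar> \<le> C1 * g x powr \<beta>"
      using hajlasz_chain[OF dense S(1) s(1,2) s(3)[unfolded N_def] haj gint, of lam] lam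
      unfolding C1_def K_def \<beta>_def N_def by auto
    have osc: "\<bar>u x - u y\<bar> \<le> C2 * max (h x) (h y) powr \<beta>" if xy: "x \<in> S - Z" "y \<in> S - Z" for x y
    proof -
      define H where "H = max (h x) (h y)"
      have H: "h x \<le> H" "h y \<le> H" by (auto simp: H_def)
      obtain x0 y0 where 0: "x0 \<in> S - Z" "g x0 \<le> lam" "\<bar>u x - u x0\<bar> \<le> C1 * g x powr \<beta>"
        "y0 \<in> S - Z" "g y0 \<le> lam" "\<bar>u y - u y0\<bar> \<le> C1 * g y powr \<beta>"
        using chain xy by metis
      have "\<bar>u x0 - u y0\<bar> \<le> norm (x0 - y0) powr s * (g x0 + g y0)" using 0 uxy by blast
      also have "\<dots> \<le> d powr s * (2 * lam)"
        using 0 d s g by (intro mult_mono powr_mono2) (auto intro: add_nonneg_nonneg)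
      finally have "\<bar>u x0 - u y0\<bar> \<le> 2 * lam * d powr s * 1" by (simp add: mult_ac)
      also have "\<dots> \<le> 2 * lam * d powr s * H powr \<beta>"
        using H h1[of x] beta lam by (intro mult_left_mono ge_one_powr_ge_zero) auto
      finally have 1: "\<bar>u x0 - u y0\<bar> \<le> 2 * lam * d powr s * H powr \<beta>" .
      have "C1 * g x powr \<beta> \<le> C1 * H powr \<beta>" "C1 * g y powr \<beta> \<le> C1 * H powr \<beta>"
        using H h1(3)[of x] h1(3)[of y] g beta C1 by (auto intro!: mult_left_mono powr_mono2)
      with 0 1 have "\<bar>u x - u y\<bar> \<le> C1 * H powr \<beta> + C1 * H powr \<beta> + 2 * lam * d powr s * H powr \<beta>"
        by linarith
      also have "\<dots> = C2 * H powr \<beta>" by (simp add: C2_def algebra_simps)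
      finally show ?thesis by (simp add: H_def)
    qed
    have hint: "(\<integral>\<^sup>+x. ennreal (h x powr p) \<partial>lebesgue_on S) \<le> ennreal C3"
    proof -
      have "(\<integral>\<^sup>+x. ennreal (h x powr p) \<partial>lebesgue_on S)
          \<le> (\<integral>\<^sup>+x. ennreal (g x powr p) + ennreal (lam powr p) \<partial>lebesgue_on S)"
        by (intro nn_integral_mono) (auto simp: h_def max_def ennreal_plus[symmetric] intro!: ennreal_leI simp del: ennreal_plus)
      also have "\<dots> \<le> ennreal (1 + lam powr p * measure (lebesgue_on S) (space (lebesgue_on S)))"
        using gint eS by (intro ennreal_integral_const_bound) auto
      finally show ?thesis by (simp only: C3_def mS)
    qed
    obtain y0 where y0: "y0 \<in> S - Z" "\<bar>u y0\<bar> \<le> lam" "g y0 \<le> lam"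
    proof -
      \<comment> \<open>Halving compensates for the maximum: since \<open>1 \<le> p\<close>, the
        factor \<open>1 / 2 powr p \<le> 1/2\<close> brings the sum of the two normalised integrals
        back to one. A single point is then good for \<open>u\<close> and for \<open>g\<close> at
        once.\<close>
      define f where "f x = max \<bar>u x\<bar> (g x) / 2" for x
      have f[measurable]: "f \<in> borel_measurable (lebesgue_on S)" unfolding f_def[abs_def] by measurable
      have "(\<integral>\<^sup>+x. ennreal (\<bar>f x\<bar> powr p) \<partial>lebesgue_on S)
        \<le> (\<integral>\<^sup>+x. ennreal (1/2) * (ennreal (\<bar>u x\<bar> powr p) + ennreal (g x powr p)) \<partial>lebesgue_on S)"
      proof (intro nn_integral_mono)
        fix x
        have "2 powr 1 \<le> 2 powr p" using s by (intro powr_mono) auto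
        then have "1 / 2 powr p \<le> 1/2" by (simp add: field_simps)
        have fx: "\<bar>f x\<bar> = max \<bar>u x\<bar> (g x) / 2" using g(2)[of x] by (simp add: f_def)
        have "\<bar>f x\<bar> powr p = (1 / 2 powr p) * max \<bar>u x\<bar> (g x) powr p" 
          using powr_divide[of "max \<bar>u x\<bar> (g x)" 2 p] by (simp only: fx) simp
        also have "\<dots> \<le> (1/2) * (\<bar>u x\<bar> powr p + g x powr p)"
          by (intro mult_mono \<open>1 / 2 powr p \<le> 1/2\<close>) (auto simp: max_def)
        finally show "ennreal (\<bar>f x\<bar> powr p) \<le> ennreal (1/2) * (ennreal (\<bar>u x\<bar> powr p) + ennreal (g x powr p))"
          unfolding ennreal_plus[OF powr_ge_zero powr_ge_zero, symmetric]
          by (subst ennreal_mult[symmetric]) (auto intro: ennreal_leI)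
      qed
      also have "\<dots> = ennreal (1/2) * ((\<integral>\<^sup>+x. ennreal (\<bar>u x\<bar> powr p) \<partial>lebesgue_on S) + (\<integral>\<^sup>+x. ennreal (g x powr p) \<partial>lebesgue_on S))"
        by (subst nn_integral_cmult) (auto simp: nn_integral_add)
      also have "\<dots> \<le> ennreal (1/2) * (1 + 1)" using uint gint by (intro mult_left_mono add_mono) auto
      also have "\<dots> = ennreal (1/2) * ennreal 2" by simp
      also have "\<dots> = 1" by (subst ennreal_mult[symmetric]) auto
      finally have fint: "(\<integral>\<^sup>+x. ennreal (\<bar>f x\<bar> powr p) \<partial>lebesgue_on S) \<le> 1" .
      have "\<exists>y\<in>S-Z. \<bar>f y\<bar> < lam / 2"
        using lam s m m0 by (intro exists_below_level[OF S(1) Z S(1) order_refl f _ _ fint]) (auto intro!: ennreal_lessI)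
      then show ?thesis using that by (auto simp: f_def)
    qed
    have ub: "\<bar>u x\<bar> powr p' \<le> C5 * h x powr p" if x: "x \<in> S - Z" for x
    proof -
      \<comment> \<open>Since \<open>g y0 \<le> lam\<close>, the point \<open>y0\<close> has the
        least possible value of \<open>h\<close>, so the oscillation between \<open>x\<close> and
        \<open>y0\<close> is governed by \<open>h x\<close> alone.\<close>
      have "max (h x) (h y0) = h x" using y0 h1(2)[of x] by (simp add: h_def)
      then have "\<bar>u x - u y0\<bar> \<le> C2 * h x powr \<beta>" using osc[OF x y0(1)] by simp
      moreover have "lam * 1 \<le> lam * h x powr \<beta>" using hp lam by (intro mult_left_mono) auto
      ultimately have "\<bar>u x\<bar> \<le> (lam + C2) * h x powr \<beta>" using y0 by (simp add: algebra_simps)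
      then have "\<bar>u x\<bar> powr p' \<le> ((lam + C2) * h x powr \<beta>) powr p'" using s' by (intro powr_mono2) auto
      also have "\<dots> = C5 * h x powr (\<beta> * p')" by (simp add: C5_def powr_mult powr_powr)
      also have "\<dots> \<le> C5 * h x powr p" using bp h1 C5 by (intro mult_left_mono powr_mono) auto
      finally show ?thesis .
    qed
    have "(\<integral>\<^sup>+x. ennreal (\<bar>u x\<bar> powr p') \<partial>lebesgue_on S) \<le> (\<integral>\<^sup>+x. ennreal C5 * ennreal (h x powr p) \<partial>lebesgue_on S)"
      by (intro nn_integral_mono_AE AE_lebesgue_on_null[OF Z S(1)])
        (use ub C5 in \<open>auto simp: ennreal_mult[symmetric] intro!: ennreal_leI\<close>)
    also have "\<dots> = ennreal C5 * (\<integral>\<^sup>+x. ennreal (h x powr p) \<partial>lebesgue_on S)" by (intro nn_integral_cmult) measurable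
    also have "\<dots> \<le> ennreal C5 * ennreal C3" by (intro mult_left_mono hint) auto
    also have "\<dots> = ennreal (C5 * C3)" using C3 C5 by (simp add: ennreal_mult)
    also have "\<dots> \<le> ennreal C" by (intro ennreal_leI) (simp add: C_def)
    finally have 1: "(\<integral>\<^sup>+x. ennreal (\<bar>u x\<bar> powr p') \<partial>lebesgue_on S) \<le> ennreal C" .
    have 2: "(\<integral>\<^sup>+(x,y). ennreal (\<bar>u x - u y\<bar> powr p' / norm (x - y) powr (N + s' * p'))
           \<partial>(lebesgue_on S \<Otimes>\<^sub>M lebesgue_on S)) \<le> ennreal C" if "0 < s'"
    proof -
      have q: "2 powr - e1 < 1" "2 powr - e2 < 1" using s s' that by (auto simp: e1_def e2_def intro!: powr_less_one)
      have C4: "0 \<le> C4" using q unfolding C4_def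
        by (intro add_nonneg_nonneg mult_nonneg_nonneg divide_nonneg_nonneg) auto
      have "(\<integral>\<^sup>+(x,y). ennreal (\<bar>u x - u y\<bar> powr p' / norm (x - y) powr (N + s' * p'))
           \<partial>(lebesgue_on S \<Otimes>\<^sub>M lebesgue_on S))
        \<le> 2 * (\<integral>\<^sup>+x. \<integral>\<^sup>+y. ennreal (\<bar>u x - u y\<bar> powr p' / norm (x - y) powr (N + s' * p')) *
             indicator {y. h y \<le> h x} y \<partial>lebesgue_on S \<partial>lebesgue_on S)"
        by (intro nn_integral_symmetric_le gagliardo_integrand_measurable u h)
          (auto simp: abs_minus_commute norm_minus_commute intro: sigma_finite_measure_axioms)
      also have "\<dots> \<le> 2 * (\<integral>\<^sup>+x. ennreal C4 * ennreal (h x powr p) \<partial>lebesgue_on S)"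
      proof (intro mult_left_mono nn_integral_mono_AE AE_lebesgue_on_null[OF Z S(1)])
        fix x assume x: "x \<in> S - Z"
        have near: "\<bar>u x - u y\<bar> \<le> norm (x - y) powr s * (2 * h x)" if "y \<in> S - Z" "h y \<le> h x" for y
        proof -
          have "\<bar>u x - u y\<bar> \<le> norm (x - y) powr s * (g x + g y)" by (intro uxy x that)
          also have "\<dots> \<le> norm (x - y) powr s * (2 * h x)"
            using h1(3)[of x] h1(3)[of y] that by (intro mult_left_mono) auto
          finally show ?thesis .
        qed
        have far: "\<bar>u x - u y\<bar> \<le> C2 * h x powr \<beta>" if "y \<in> S - Z" "h y \<le> h x" for y
          using osc[OF x that(1)] that(2) by (simp add: max_def)
        show "(\<integral>\<^sup>+y. ennreal (\<bar>u x - u y\<bar> powr p' / norm (x - y) powr (N + s' * p')) *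
             indicator {y. h y \<le> h x} y \<partial>lebesgue_on S) \<le> ennreal C4 * ennreal (h x powr p)"
          using hajlasz_gagliardo_inner[of S Z s p s' p' h x C2 u, OF S(1) Z s(1,2) that s'(2,3)
              crit'[unfolded N_def] h1(1) C2 near far[unfolded \<beta>_def N_def]] C4
          by (simp add: C4_def e1_def e2_def N_def ennreal_mult)
      qed auto
      also have "\<dots> = 2 * (ennreal C4 * (\<integral>\<^sup>+x. ennreal (h x powr p) \<partial>lebesgue_on S))"
        by (subst nn_integral_cmult) auto
      also have "\<dots> \<le> 2 * (ennreal C4 * ennreal C3)" by (intro mult_left_mono hint) auto
      also have "\<dots> = ennreal (2 * (C4 * C3))" using C3 C4 by (simp add: ennreal_mult)
      also have "\<dots> \<le> ennreal C" by (intro ennreal_leI) (simp add: C_def)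
      finally show ?thesis .
    qed
    from 1 2 show "(\<integral>\<^sup>+x. ennreal (\<bar>u x\<bar> powr p') \<partial>lebesgue_on S) \<le> ennreal C \<and>
       (0 < s' \<longrightarrow> (\<integral>\<^sup>+(x,y). ennreal (\<bar>u x - u y\<bar> powr p' / norm (x - y) powr (N + s' * p'))
           \<partial>(lebesgue_on S \<Otimes>\<^sub>M lebesgue_on S)) \<le> ennreal C)" by blast
  qed
qed

section \<open>Lipschitz domains\<close>

text \<open>In graph coordinates at a boundary point, moving up by \<open>t\<close> and then by less
  than a small multiple of \<open>t\<close> in any direction stays above the graph, because the
  graph has bounded slope. The same direction \<open>e\<close> serves all points near
  \<open>z\<close>; around an interior point any direction does.\<close>

lemma local_uniform_cone:
  fixes \<Omega> :: "(real ^ 'n) set"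
  assumes "bounded_lipschitz_domain \<Omega>" "z \<in> closure \<Omega>"
  shows "\<exists>\<rho> \<kappa>. 0 < \<rho> \<and> 0 < \<kappa> \<and> \<kappa> \<le> 1 \<and> (\<exists>e. norm e = 1 \<and>
     (\<forall>w\<in>\<Omega> \<inter> ball z (2 * \<rho>). \<forall>t. 0 < t \<longrightarrow> t \<le> \<rho> \<longrightarrow> ball (w + t *\<^sub>R e) (\<kappa> * t) \<subseteq> \<Omega>))"
proof (cases "z \<in> \<Omega>")
  case True
  moreover have "open \<Omega>" using assms by (simp add: bounded_lipschitz_domain_def)
  ultimately obtain r where r: "0 < r" "ball z r \<subseteq> \<Omega>" by (meson openE)
  obtain e :: "real ^ 'n" where e: "norm e = 1" using norm_axis_1 by blast
  have "ball (w + t *\<^sub>R e) (1 * t) \<subseteq> \<Omega>" if "w \<in> ball z (2 * (r/4))" "0 < t" "t \<le> r/4" for w t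
  proof
    fix y assume "y \<in> ball (w + t *\<^sub>R e) (1 * t)"
    then have "norm (y - (w + t *\<^sub>R e)) < t" by (simp add: dist_norm norm_minus_commute)
    moreover have "norm (t *\<^sub>R e) = t" using e that by simp
    moreover have "norm (w - z) < r/2" using that by (simp add: dist_norm norm_minus_commute)
    moreover have "y - z = (y - (w + t *\<^sub>R e)) + t *\<^sub>R e + (w - z)" by simp
    then have "norm (y - z) \<le> norm (y - (w + t *\<^sub>R e)) + norm (t *\<^sub>R e) + norm (w - z)"
      using norm_triangle_ineq[of "y - (w + t *\<^sub>R e)" "t *\<^sub>R e"]
        norm_triangle_ineq[of "(y - (w + t *\<^sub>R e)) + t *\<^sub>R e" "w - z"] by simp
    ultimately have "norm (y - z) < r" using that by linarith
    then have "y \<in> ball z r" by (simp add: dist_norm norm_minus_commute)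
    then show "y \<in> \<Omega>" by (rule subsetD[OF r(2)])
  qed
  then have "\<forall>w\<in>\<Omega> \<inter> ball z (2 * (r/4)). \<forall>t. 0 < t \<longrightarrow> t \<le> r/4 \<longrightarrow> ball (w + t *\<^sub>R e) (1 * t) \<subseteq> \<Omega>"
    by blast
  moreover have "0 < r/4" "0 < (1::real)" "(1::real) \<le> 1" using r by simp_all
  ultimately show ?thesis using e
    by - (rule exI[of _ "r/4"], rule exI[of _ 1], intro conjI, assumption+, rule exI[of _ e], intro conjI)
next
  case False
  have "open \<Omega>" using assms(1) unfolding bounded_lipschitz_domain_def by blast
  then have zf: "z \<in> frontier \<Omega>" using False assms(2) unfolding frontier_def by (simp only: interior_open Diff_iff) simp
  have lb: "lipschitz_boundary \<Omega>" using assms(1) unfolding bounded_lipschitz_domain_def by blast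
  obtain r e L and g :: "real ^ 'n \<Rightarrow> real" where r: "0 < r" and e: "norm e = 1"
    and L: "L-lipschitz_on {y. y \<bullet> e = 0} g"
    and eq: "\<Omega> \<inter> ball z r = {x \<in> ball z r. g (x - (x \<bullet> e) *\<^sub>R e) < x \<bullet> e}"
    using lb[unfolded lipschitz_boundary_def, rule_format, OF zf] by blast
  have L0: "0 \<le> L" using L by (rule lipschitz_on_nonneg)
  have ee: "e \<bullet> e = 1" using e by (simp add: norm_eq_1)
  \<comment> \<open>The value with \<open>L * \<kappa> = 1 - \<kappa>\<close>: the graph rises by at
    most \<open>L * \<kappa> * t\<close>, while the gain in height exceeds
    \<open>t - \<kappa> * t\<close>.\<close>
  define \<kappa> where "\<kappa> = 1 / (1 + L)"
  have k: "0 < \<kappa>" "\<kappa> \<le> 1" "L * \<kappa> = 1 - \<kappa>" using L0 by (auto simp: \<kappa>_def field_simps)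
  \<comment> \<open>The quarter radius keeps everything inside \<open>ball z r\<close>: the base
    point is within \<open>r/2\<close> of \<open>z\<close>, the height is at most
    \<open>r/4\<close>, and the radius of the small ball is at most \<open>r/4\<close>.\<close>
  have "ball (w + t *\<^sub>R e) (\<kappa> * t) \<subseteq> \<Omega>" if w: "w \<in> \<Omega>" "w \<in> ball z (2 * (r/4))" and t: "0 < t" "t \<le> r/4" for w t
  proof
    fix y assume "y \<in> ball (w + t *\<^sub>R e) (\<kappa> * t)"
    define v where "v = y - (w + t *\<^sub>R e)"
    have v: "norm v < \<kappa> * t" using \<open>y \<in> _\<close> by (simp add: v_def dist_norm norm_minus_commute)
    have "\<kappa> * t \<le> t" using k t by (simp add: mult_le_cancel_right1)
    moreover have "norm (t *\<^sub>R e) = t" using e t by simp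
    moreover have "norm (w - z) < r/2" using w by (simp add: dist_norm norm_minus_commute)
    moreover have "y - z = v + t *\<^sub>R e + (w - z)" by (simp add: v_def)
    then have "norm (y - z) \<le> norm v + norm (t *\<^sub>R e) + norm (w - z)"
      by (simp only:) (rule order_trans[OF norm_triangle_ineq add_right_mono[OF norm_triangle_ineq]])
    ultimately have "norm (y - z) < r" using t v by linarith
    then have yz: "y \<in> ball z r" by (simp add: dist_norm norm_minus_commute)
    have wz: "w \<in> \<Omega> \<inter> ball z r" using w r by auto
    then have gw: "g (w - (w \<bullet> e) *\<^sub>R e) < w \<bullet> e" unfolding eq by auto
    define P where "P x = x - (x \<bullet> e) *\<^sub>R e" for x
    have P: "P x \<in> {y. y \<bullet> e = 0}" for x by (simp add: P_def inner_diff_left ee)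
    have Pyw: "P y - P w = P v"
      by (simp add: P_def v_def inner_diff_left inner_add_left ee algebra_simps)
    define a where "a = v \<bullet> e"
    have a: "v \<bullet> e = a" "e \<bullet> v = a" by (simp_all add: a_def inner_commute)
    have "(norm (P v))\<^sup>2 = (v - a *\<^sub>R e) \<bullet> (v - a *\<^sub>R e)"
      by (simp only: power2_norm_eq_inner P_def a)
    also have "\<dots> = v \<bullet> v - a\<^sup>2"
      by (simp add: inner_diff_left inner_diff_right ee a power2_eq_square)
    finally have "(norm (P v))\<^sup>2 = (norm v)\<^sup>2 - a\<^sup>2" by (simp only: power2_norm_eq_inner[of v])
    then have "(norm (P v))\<^sup>2 \<le> (norm v)\<^sup>2" using zero_le_power2[of a] by linarith
    then have "norm (P v) \<le> norm v" by (rule power2_le_imp_le) (rule norm_ge_zero)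
    have "\<bar>g (P y) - g (P w)\<bar> \<le> L * norm (P y - P w)"
      using lipschitz_onD[OF L P P, of y w] by (simp add: dist_norm)
    also have "\<dots> \<le> L * (\<kappa> * t)"
    proof (rule mult_left_mono[OF _ L0])
      show "norm (P y - P w) \<le> \<kappa> * t" unfolding Pyw using \<open>norm (P v) \<le> norm v\<close> v by linarith
    qed
    also have "L * (\<kappa> * t) = (L * \<kappa>) * t" by (rule mult.assoc[symmetric])
    also have "\<dots> = t - \<kappa> * t" unfolding k(3) by (rule left_diff_distrib[of 1 \<kappa> t, unfolded mult_1])
    finally have "g (P y) \<le> g (P w) + (t - \<kappa> * t)" by linarith
    moreover have "\<bar>v \<bullet> e\<bar> \<le> norm v" using Cauchy_Schwarz_ineq2[of v e] e by simp
    moreover have "y \<bullet> e = w \<bullet> e + t + v \<bullet> e" by (simp add: v_def inner_diff_left inner_add_left ee)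
    ultimately have "g (P y) < y \<bullet> e" using gw v by (simp add: P_def)
    then have "y \<in> \<Omega> \<inter> ball z r" unfolding eq using yz by (simp add: P_def)
    then show "y \<in> \<Omega>" by simp
  qed
  then have "\<forall>w\<in>\<Omega> \<inter> ball z (2 * (r/4)). \<forall>t. 0 < t \<longrightarrow> t \<le> r/4 \<longrightarrow> ball (w + t *\<^sub>R e) (\<kappa> * t) \<subseteq> \<Omega>"
    by blast
  moreover have "0 < r/4" using r by simp
  ultimately show ?thesis using e k(1,2)
    by - (rule exI[of _ "r/4"], rule exI[of _ \<kappa>], intro conjI, assumption+, rule exI[of _ e], intro conjI)
qed

text \<open>A finite subcover of the closure gives common constants. The local statement holds on a
  ball of twice the covering radius, so two points closer than \<open>T\<close> fall under the same
  local cone and share the direction \<open>e\<close>. The balls attached to them at equal height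
  are then translates of each other, which is what the comparison of two averages needs.\<close>

lemma uniform_cone:
  fixes \<Omega> :: "(real ^ 'n) set"
  assumes "bounded_lipschitz_domain \<Omega>"
  obtains \<kappa> T where "0 < \<kappa>" "\<kappa> \<le> 1" "0 < T"
    "\<And>x y. x \<in> \<Omega> \<Longrightarrow> y \<in> \<Omega> \<Longrightarrow> norm (x - y) < T \<Longrightarrow> \<exists>e. norm e = 1 \<and>
       (\<forall>t. 0 < t \<longrightarrow> t \<le> T \<longrightarrow> ball (x + t *\<^sub>R e) (\<kappa> * t) \<subseteq> \<Omega> \<and> ball (y + t *\<^sub>R e) (\<kappa> * t) \<subseteq> \<Omega>)"
proof -
  define Q where "Q z \<rho> \<kappa> \<longleftrightarrow> (\<exists>e. norm e = 1 \<and>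
     (\<forall>w\<in>\<Omega> \<inter> ball z (2 * \<rho>). \<forall>t. 0 < t \<longrightarrow> t \<le> \<rho> \<longrightarrow> ball (w + t *\<^sub>R e) (\<kappa> * t) \<subseteq> \<Omega>))"
    for z \<rho> \<kappa>
  have "\<exists>\<rho> \<kappa>. 0 < \<rho> \<and> 0 < \<kappa> \<and> \<kappa> \<le> 1 \<and> Q z \<rho> \<kappa>" if "z \<in> closure \<Omega>" for z
    unfolding Q_def using assms that by (rule local_uniform_cone)
  then obtain \<rho> \<kappa> where cone: "\<And>z. z \<in> closure \<Omega> \<Longrightarrow> 0 < \<rho> z \<and> 0 < \<kappa> z \<and> \<kappa> z \<le> 1 \<and> Q z (\<rho> z) (\<kappa> z)"
    by metis
  have "compact (closure \<Omega>)" "\<Omega> \<noteq> {}" using assms by (auto simp: bounded_lipschitz_domain_def)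
  moreover have "closure \<Omega> \<subseteq> (\<Union>z\<in>closure \<Omega>. ball z (\<rho> z))" using cone by force
  ultimately obtain F where F: "F \<subseteq> closure \<Omega>" "finite F" "closure \<Omega> \<subseteq> (\<Union>z\<in>F. ball z (\<rho> z))"
    by (metis (no_types, lifting) compactE_image open_ball)
  have "F \<noteq> {}" using F \<open>\<Omega> \<noteq> {}\<close> closure_subset by fastforce
  define T where "T = Min (\<rho> ` F)"
  define k where "k = Min (\<kappa> ` F)"
  have T: "0 < T" "\<And>z. z \<in> F \<Longrightarrow> T \<le> \<rho> z" using F \<open>F \<noteq> {}\<close> cone by (auto simp: T_def)
  have k: "0 < k" "\<And>z. z \<in> F \<Longrightarrow> k \<le> \<kappa> z" using F \<open>F \<noteq> {}\<close> cone by (auto simp: k_def)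
  have "k \<le> 1" using k(2) cone F \<open>F \<noteq> {}\<close> by (meson equals0I order_trans subsetD)
  show ?thesis
  proof (rule that[OF k(1) \<open>k \<le> 1\<close> T(1)])
    fix x y assume xy: "x \<in> \<Omega>" "y \<in> \<Omega>" "norm (x - y) < T"
    then obtain z where z: "z \<in> F" "x \<in> ball z (\<rho> z)" using F closure_subset by blast
    have yx: "y \<in> ball z (2 * \<rho> z)" "x \<in> ball z (2 * \<rho> z)"
      using z xy T(2)[OF z(1)] T(1) dist_triangle[of z y x] by (auto simp: dist_norm)
    have "Q z (\<rho> z) (\<kappa> z)" using cone F z by blast
    then obtain e where e: "norm e = 1" "\<And>w t. w\<in>\<Omega> \<inter> ball z (2 * \<rho> z) \<Longrightarrow> 0 < t \<Longrightarrow> t \<le> \<rho> z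
        \<Longrightarrow> ball (w + t *\<^sub>R e) (\<kappa> z * t) \<subseteq> \<Omega>" unfolding Q_def by metis
    have ball_le: "ball w (k * t) \<subseteq> ball w (\<kappa> z * t)" if "0 < t" for w t
      using k(2)[OF z(1)] that by (intro subset_ball mult_right_mono) auto
    have "ball (w + t *\<^sub>R e) (k * t) \<subseteq> \<Omega>" if "w \<in> {x, y}" "0 < t" "t \<le> T" for w t
    proof -
      have "w \<in> \<Omega> \<inter> ball z (2 * \<rho> z)" using that xy yx by blast
      moreover have "t \<le> \<rho> z" using T(2)[OF z(1)] that by linarith
      ultimately have "ball (w + t *\<^sub>R e) (\<kappa> z * t) \<subseteq> \<Omega>" using e(2)[OF _ that(2)] by blast
      then show ?thesis using ball_le[OF that(2)] by blast
    qed
    then show "\<exists>e. norm e = 1 \<and>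
       (\<forall>t. 0 < t \<longrightarrow> t \<le> T \<longrightarrow> ball (x + t *\<^sub>R e) (k * t) \<subseteq> \<Omega> \<and> ball (y + t *\<^sub>R e) (k * t) \<subseteq> \<Omega>)"
      using e(1) by blast
  qed
qed

text \<open>The part of the cone inside \<open>ball x r\<close> contains the ball of radius
  \<open>\<kappa> * (r / 2)\<close> around the point of its axis at height
  \<open>r / 2\<close>.\<close>

lemma bounded_lipschitz_domain_measure_dense:
  fixes \<Omega> :: "(real ^ 'n) set"
  assumes "bounded_lipschitz_domain \<Omega>"
  obtains c R where "measure_dense \<Omega> c R"
proof -
  obtain \<kappa> T where kT: "0 < \<kappa>" "\<kappa> \<le> 1" "0 < T"
    "\<And>x y. x \<in> \<Omega> \<Longrightarrow> y \<in> \<Omega> \<Longrightarrow> norm (x - y) < T \<Longrightarrow> \<exists>e. norm e = 1 \<and>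
       (\<forall>t. 0 < t \<longrightarrow> t \<le> T \<longrightarrow> ball (x + t *\<^sub>R e) (\<kappa> * t) \<subseteq> \<Omega> \<and> ball (y + t *\<^sub>R e) (\<kappa> * t) \<subseteq> \<Omega>)"
    using uniform_cone[OF assms] by blast
  define c where "c = unit_ball_vol DIM(real ^ 'n) * (\<kappa> / 2) ^ DIM(real ^ 'n)"
  have "ennreal (c * r ^ DIM(real ^ 'n)) \<le> emeasure lebesgue (\<Omega> \<inter> ball x r)"
    if x: "x \<in> \<Omega>" and r: "0 < r" "r \<le> T" for x r
  proof -
    obtain e where e: "norm e = 1" "\<forall>t. 0 < t \<longrightarrow> t \<le> T \<longrightarrow> ball (x + t *\<^sub>R e) (\<kappa> * t) \<subseteq> \<Omega>"
      using kT(4)[OF x x] kT(3) by auto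
    have e: "norm e = 1" "ball (x + (r/2) *\<^sub>R e) (\<kappa> * (r/2)) \<subseteq> \<Omega>"
      using e(1) e(2)[rule_format, of "r/2"] r by auto
    have "ball (x + (r/2) *\<^sub>R e) (\<kappa> * (r/2)) \<subseteq> ball x r"
    proof (rule ball_subset_ball_iff[THEN iffD2], rule disjI1)
      have "\<kappa> * (r/2) \<le> r/2" using kT r by (simp add: mult_le_cancel_right1)
      moreover have "dist (x + (r/2) *\<^sub>R e) x = r / 2" using e r by (simp add: dist_norm)
      ultimately show "dist (x + (r/2) *\<^sub>R e) x + \<kappa> * (r/2) \<le> r" by linarith
    qed
    with e have sub: "ball (x + (r/2) *\<^sub>R e) (\<kappa> * (r/2)) \<subseteq> \<Omega> \<inter> ball x r" by blast
    have "ennreal (c * r ^ DIM(real ^ 'n)) = emeasure lebesgue (ball (x + (r/2) *\<^sub>R e) (\<kappa> * (r/2)))"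
    proof -
      have "c * r ^ DIM(real ^ 'n) = unit_ball_vol DIM(real ^ 'n) * (\<kappa> * (r/2)) ^ DIM(real ^ 'n)"
        by (simp add: c_def power_mult_distrib power_divide)
      then show ?thesis using kT r by (subst emeasure_lebesgue_ball) auto
    qed
    also have "\<dots> \<le> emeasure lebesgue (\<Omega> \<inter> ball x r)"
      using assms by (intro emeasure_mono sub sets.Int) (auto simp: bounded_lipschitz_domain_def intro: fmeasurableD)
    finally show ?thesis .
  qed
  moreover have "0 < c" using kT by (simp add: c_def)
  ultimately show ?thesis using kT by (intro that[of c T]) (auto simp: measure_dense_def)
qed

section \<open>Hajlasz gradients from the Gagliardo seminorm\<close>

lemma hajlasz_of_gagliardo:
  fixes S :: "'a::euclidean_space set"
  defines "N \<equiv> real DIM('a)"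
  assumes dense: "measure_dense S c R" and S: "S \<in> sets lebesgue" "bounded S" and s: "0 < s" "1 \<le> p"
  obtains K where "0 < K"
    "\<And>u A. u \<in> borel_measurable (lebesgue_on S) \<Longrightarrow> 0 < A \<Longrightarrow>
       (\<integral>\<^sup>+(x,y). ennreal (\<bar>u x - u y\<bar> powr p / norm (x - y) powr (N + s * p))
           \<partial>(lebesgue_on S \<Otimes>\<^sub>M lebesgue_on S)) \<le> ennreal (A powr p) \<Longrightarrow>
       \<exists>Z g. hajlasz_gradient S Z s u g \<and> (\<integral>\<^sup>+x. ennreal (g x powr p) \<partial>lebesgue_on S) \<le> ennreal ((K * A) powr p)"
proof -
  have N: "0 < N" by (simp add: N_def)
  have cR: "0 < c" "0 < R" using dense by (auto simp: measure_dense_def)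
  have Sfin: "S \<in> lmeasurable" using S by (intro bounded_set_imp_lmeasurable)
  interpret finite_measure "lebesgue_on S" using Sfin by (intro finite_measure_lebesgue_on)
  obtain b where b: "\<forall>x\<in>S. norm x \<le> b" "0 < b" using S by (auto simp: bounded_pos)
  \<comment> \<open>The averaging radius must not exceed \<open>R\<close>, while two points of
    \<open>S\<close> may be as far as \<open>2 * b\<close> apart; shrinking the distance by the
    factor \<open>\<theta>\<close> reconciles the two at the price of a constant.\<close>
  define \<theta> where "\<theta> = min 1 (R / (2 * b))"
  have th: "0 < \<theta>" "\<theta> \<le> 1" using cR b by (auto simp: \<theta>_def)
  define q where "q = N + s * p"
  have q: "0 < q" using N s by (simp add: q_def add_pos_nonneg)
  define K0 where "K0 = 2 powr p * 2 powr q / (c * \<theta> ^ DIM('a))"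
  have K0: "0 < K0" using cR th by (simp add: K0_def)
  define K where "K = 2 * K0 powr (1 / p)"
  have K: "0 < K" using K0 by (simp add: K_def)
  show ?thesis
  proof (rule that[OF K])
    fix u :: "'a \<Rightarrow> real" and A :: real
    assume u: "u \<in> borel_measurable (lebesgue_on S)" and A: "0 < A"
      and int: "(\<integral>\<^sup>+(x,y). ennreal (\<bar>u x - u y\<bar> powr p / norm (x - y) powr (N + s * p))
           \<partial>(lebesgue_on S \<Otimes>\<^sub>M lebesgue_on S)) \<le> ennreal (A powr p)"
    define F where "F x y = ennreal (\<bar>u x - u y\<bar> powr p / norm (x - y) powr q)" for x y
    have F: "(\<lambda>z. F (fst z) (snd z)) \<in> borel_measurable (lebesgue_on S \<Otimes>\<^sub>M lebesgue_on S)"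
      unfolding F_def by (rule gagliardo_integrand_measurable[OF u])
    define f where "f x = (\<integral>\<^sup>+y. F x y \<partial>lebesgue_on S)" for x
    have f[measurable]: "f \<in> borel_measurable (lebesgue_on S)"
      using borel_measurable_nn_integral_fst[OF F] by (simp add: f_def[abs_def])
    have "(\<integral>\<^sup>+x. f x \<partial>lebesgue_on S) = (\<integral>\<^sup>+z. F (fst z) (snd z) \<partial>(lebesgue_on S \<Otimes>\<^sub>M lebesgue_on S))"
      using nn_integral_fst[OF F] by (simp add: f_def)
    also have "\<dots> \<le> ennreal (A powr p)" using int by (simp add: F_def q_def case_prod_beta')
    finally have fint: "(\<integral>\<^sup>+x. f x \<partial>lebesgue_on S) \<le> ennreal (A powr p)" .
    then have "(\<integral>\<^sup>+x. f x \<partial>lebesgue_on S) \<noteq> \<infinity>" by (auto simp: top_unique)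
    then have "AE x in lebesgue_on S. f x \<noteq> \<infinity>" by (intro nn_integral_PInf_AE f)
    then obtain Z where Z: "Z \<in> null_sets lebesgue" "\<And>x. x \<in> S - Z \<Longrightarrow> f x \<noteq> \<infinity>"
      by (rule AE_lebesgue_on_null_set[OF _ S(1)]) blast
    \<comment> \<open>Up to the constant, \<open>g x\<close> is the \<open>L^p\<close> norm in
      \<open>y\<close> of the difference quotient based at \<open>x\<close>. Where it is infinite
      \<open>enn2real\<close> returns 0, but such points of \<open>S\<close> lie in the null set
      \<open>Z\<close>.\<close>
    define g where "g x = K * enn2real (f x) powr (1 / p)" for x
    have gm[measurable]: "g \<in> borel_measurable (lebesgue_on S)" unfolding g_def[abs_def] by measurable
    have "\<bar>u x - u y\<bar> \<le> norm (x - y) powr s * (g x + g y)" if xy: "x \<in> S - Z" "y \<in> S - Z" for x y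
    proof (cases "x = y")
      case False
      define r where "r = norm (x - y)"
      have r: "0 < r" using False by (simp add: r_def)
      have "norm x \<le> b" "norm y \<le> b" using b(1) xy by auto
      then have "r \<le> 2 * b" using norm_triangle_ineq4[of x y] by (simp add: r_def)
      then have "\<theta> * r \<le> R / (2 * b) * (2 * b)" using r b th by (intro mult_mono) (auto simp: \<theta>_def)
      then have tr: "0 < \<theta> * r" "\<theta> * r \<le> R" using th r b by auto
      define a where "a = enn2real (f x)"
      define a' where "a' = enn2real (f y)"
      have fa: "f x = ennreal a" "f y = ennreal a'" "0 \<le> a" "0 \<le> a'"
        using xy Z by (auto simp: a_def a'_def ennreal_enn2real_if)
      define B where "B = S \<inter> ball x (\<theta> * r)"
      have B: "B \<in> sets (lebesgue_on S)" using S
        by (auto simp: B_def sets_restrict_space image_iff intro!: bexI[of _ "ball x (\<theta> * r)"] fmeasurableD)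
      have Bm: "ennreal (c * (\<theta> * r) ^ DIM('a)) \<le> emeasure (lebesgue_on S) B"
      proof -
        have "emeasure (lebesgue_on S) B = emeasure lebesgue B"
          using S by (intro emeasure_restrict_space) (auto simp: B_def)
        then show ?thesis using dense xy tr by (auto simp: measure_dense_def B_def)
      qed
      define w where "w = ennreal (2 powr p * (2 * r) powr q)"
      \<comment> \<open>Integrated over \<open>z\<close>, this compares \<open>u x\<close> with
        \<open>u y\<close> through all intermediate points of \<open>B\<close> at once. Both
        \<open>norm (x - z)\<close> and \<open>norm (y - z)\<close> are at most
        \<open>2 * r\<close>, so introducing the denominators of the difference quotients costs only
        \<open>(2 * r) powr q\<close>.\<close>
      have pt: "ennreal (\<bar>u x - u y\<bar> powr p) * indicator B z \<le> w * (F x z + F y z)" if z: "z \<in> S" for z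
      proof (cases "z \<in> B")
        case True
        have "\<theta> * r \<le> r" using th r by (simp add: mult_le_cancel_right1)
        then have d: "norm (x - z) \<le> 2 * r" "norm (y - z) \<le> 2 * r"
        proof -
          have "norm (x - z) < \<theta> * r" using True by (simp add: B_def dist_norm)
          moreover have "norm (y - z) \<le> norm (x - z) + r"
            using norm_triangle_ineq4[of "x - z" "x - y"] by (simp add: r_def)
          ultimately show "norm (x - z) \<le> 2 * r" "norm (y - z) \<le> 2 * r"
            using \<open>\<theta> * r \<le> r\<close> r by linarith+
        qed
        have key: "ennreal (\<bar>u v - u z\<bar> powr p) \<le> ennreal ((2 * r) powr q) * F v z" if "norm (v - z) \<le> 2 * r" for v
        proof (cases "v = z")
          case False
          have "\<bar>u v - u z\<bar> powr p = norm (v - z) powr q * (\<bar>u v - u z\<bar> powr p / norm (v - z) powr q)"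
            using False by simp
          also have "\<dots> \<le> (2 * r) powr q * (\<bar>u v - u z\<bar> powr p / norm (v - z) powr q)"
            using that q by (intro mult_right_mono powr_mono2) auto
          finally show ?thesis by (simp add: F_def ennreal_mult[symmetric] ennreal_leI)
        qed auto
        have "\<bar>u x - u y\<bar> \<le> \<bar>u x - u z\<bar> + \<bar>u y - u z\<bar>" by linarith
        also have "a + b \<le> 2 * max a b" for a b :: real by (simp add: max_def)
        finally have "\<bar>u x - u y\<bar> \<le> 2 * max \<bar>u x - u z\<bar> \<bar>u y - u z\<bar>" .
        then have "\<bar>u x - u y\<bar> powr p \<le> (2 * max \<bar>u x - u z\<bar> \<bar>u y - u z\<bar>) powr p"
          using s by (intro powr_mono2) auto
        also have "\<dots> \<le> 2 powr p * (\<bar>u x - u z\<bar> powr p + \<bar>u y - u z\<bar> powr p)"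
          by (simp add: powr_mult max_def)
        finally have "ennreal (\<bar>u x - u y\<bar> powr p) \<le> ennreal (2 powr p) * (ennreal (\<bar>u x - u z\<bar> powr p) + ennreal (\<bar>u y - u z\<bar> powr p))"
          unfolding ennreal_plus[OF powr_ge_zero powr_ge_zero, symmetric]
          by (subst ennreal_mult[symmetric]) (auto intro: ennreal_leI)
        also have "\<dots> \<le> ennreal (2 powr p) * (ennreal ((2 * r) powr q) * F x z + ennreal ((2 * r) powr q) * F y z)"
          by (intro mult_left_mono add_mono key d) auto
        also have "\<dots> = w * (F x z + F y z)"
          by (simp add: w_def ennreal_mult algebra_simps)
        finally show ?thesis using True by simp
      qed auto
      have "ennreal (\<bar>u x - u y\<bar> powr p) * ennreal (c * (\<theta> * r) ^ DIM('a))
          \<le> ennreal (\<bar>u x - u y\<bar> powr p) * emeasure (lebesgue_on S) B" by (intro mult_left_mono Bm) auto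
      also have "\<dots> = (\<integral>\<^sup>+z. ennreal (\<bar>u x - u y\<bar> powr p) * indicator B z \<partial>lebesgue_on S)"
        using B by (simp add: nn_integral_cmult_indicator)
      also have "\<dots> \<le> (\<integral>\<^sup>+z. w * (F x z + F y z) \<partial>lebesgue_on S)"
        by (intro nn_integral_mono pt) simp
      also have "\<dots> = w * (f x + f y)"
      proof -
        have [measurable]: "F v \<in> borel_measurable (lebesgue_on S)" if "v \<in> S" for v
          using measurable_compose_Pair1[OF _ F, of v] that by simp
        show ?thesis using xy by (simp add: nn_integral_cmult nn_integral_add f_def)
      qed
      also have "\<dots> = ennreal (2 powr p * (2 * r) powr q * (a + a'))"
        using fa by (simp add: w_def ennreal_mult[symmetric] ennreal_plus[symmetric] del: ennreal_plus)
      finally have H: "\<bar>u x - u y\<bar> powr p * (c * (\<theta> * r) ^ DIM('a)) \<le> 2 powr p * (2 * r) powr q * (a + a')"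
        using fa cR tr by (simp add: ennreal_mult[symmetric] ennreal_le_iff mult_nonneg_nonneg)
      \<comment> \<open>Since \<open>q = N + s * p\<close>, the factor \<open>r ^ DIM('a)\<close>
        cancels against the measure of the averaging ball and leaves
        \<open>r powr (s * p)\<close>.\<close>
      have e1: "(2 * r) powr q = 2 powr q * (r ^ DIM('a) * r powr (s * p))"
        using r by (simp add: q_def N_def powr_mult powr_add powr_realpow)
      have "\<bar>u x - u y\<bar> powr p * (c * \<theta> ^ DIM('a)) * r ^ DIM('a)
          \<le> (2 powr p * 2 powr q * r powr (s * p) * (a + a')) * r ^ DIM('a)"
        using H unfolding e1 power_mult_distrib by (simp only: mult_ac)
      then have "\<bar>u x - u y\<bar> powr p * (c * \<theta> ^ DIM('a)) \<le> 2 powr p * 2 powr q * r powr (s * p) * (a + a')"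
        using r by (simp add: mult_le_cancel_right)
      then have "\<bar>u x - u y\<bar> powr p \<le> K0 * r powr (s * p) * (a + a')"
        using cR th by (simp add: K0_def field_simps)
      also have "\<dots> \<le> K0 * r powr (s * p) * (2 * max a a')" using K0 fa by (intro mult_left_mono) auto
      finally have "(\<bar>u x - u y\<bar> powr p) powr (1/p) \<le> (K0 * r powr (s * p) * (2 * max a a')) powr (1/p)"
        using s by (intro powr_mono2) auto
      moreover have "(\<bar>u x - u y\<bar> powr p) powr (1/p) = \<bar>u x - u y\<bar>" using s by (simp add: powr_powr)
      moreover have "(K0 * r powr (s * p) * (2 * max a a')) powr (1/p)
          = K0 powr (1/p) * r powr s * (2 powr (1/p) * max a a' powr (1/p))"
        using s by (simp add: powr_mult powr_powr)
      moreover have "2 powr (1/p) * max a a' powr (1/p) \<le> 2 * (a powr (1/p) + a' powr (1/p))"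
      proof (intro mult_mono)
        show "2 powr (1/p) \<le> (2::real)" using powr_mono[of "1/p" 1 2] s by simp
      qed (auto simp: max_def)
      then have "K0 powr (1/p) * r powr s * (2 powr (1/p) * max a a' powr (1/p))
         \<le> K0 powr (1/p) * r powr s * (2 * (a powr (1/p) + a' powr (1/p)))" by (intro mult_left_mono) auto
      moreover have "\<dots> = r powr s * (g x + g y)" by (simp add: g_def K_def a_def a'_def algebra_simps)
      ultimately show ?thesis unfolding r_def by linarith
    qed (use K in \<open>auto simp: g_def\<close>)
    then have "hajlasz_gradient S Z s u g"
      using Z gm K by (auto simp: hajlasz_gradient_def g_def)
    moreover have "(\<integral>\<^sup>+x. ennreal (g x powr p) \<partial>lebesgue_on S) \<le> ennreal ((K * A) powr p)"
    proof -
      have "(\<integral>\<^sup>+x. ennreal (g x powr p) \<partial>lebesgue_on S) \<le> (\<integral>\<^sup>+x. ennreal (K powr p) * f x \<partial>lebesgue_on S)"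
      proof (intro nn_integral_mono)
        fix x
        have "g x powr p = K powr p * enn2real (f x)" using s by (simp add: g_def powr_mult powr_powr)
        then have "ennreal (g x powr p) = ennreal (K powr p) * ennreal (enn2real (f x))" by (simp add: ennreal_mult)
        also have "\<dots> \<le> ennreal (K powr p) * f x" by (intro mult_left_mono) (auto simp: ennreal_enn2real_if)
        finally show "ennreal (g x powr p) \<le> ennreal (K powr p) * f x" .
      qed
      also have "\<dots> = ennreal (K powr p) * (\<integral>\<^sup>+x. f x \<partial>lebesgue_on S)" by (intro nn_integral_cmult) measurable
      also have "\<dots> \<le> ennreal (K powr p) * ennreal (A powr p)" by (intro mult_left_mono fint) auto
      also have "\<dots> = ennreal ((K * A) powr p)" by (simp add: powr_mult ennreal_mult)
      finally show ?thesis .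
    qed
    ultimately show "\<exists>Z g. hajlasz_gradient S Z s u g \<and>
       (\<integral>\<^sup>+x. ennreal (g x powr p) \<partial>lebesgue_on S) \<le> ennreal ((K * A) powr p)" by blast
  qed
qed

section \<open>The maximal theorem\<close>

text \<open>The Hardy-Littlewood maximal function, with the radii \<open>R / 2 ^ j\<close> only and
  with \<open>r ^ DIM('a)\<close> in place of the volume of a ball. Countably many radii make
  measurability immediate, and any other radius below \<open>R\<close> loses at most a factor
  \<open>2 ^ DIM('a)\<close>. Integrating over \<open>S\<close> amounts to extending
  \<open>w\<close> by zero.\<close>

definition dyadic_maximal ::
  "'a::euclidean_space set \<Rightarrow> real \<Rightarrow> ('a \<Rightarrow> ennreal) \<Rightarrow> 'a \<Rightarrow> ennreal" where
  "dyadic_maximal S R w x =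
     (SUP j::nat. ennreal (1 / (R / 2 ^ j) ^ DIM('a)) *
        (\<integral>\<^sup>+y. w y * indicator {y. norm (x - y) < R / 2 ^ j} y \<partial>lebesgue_on S))"

lemma dyadic_maximal_upper:
  fixes w :: "'a::euclidean_space \<Rightarrow> ennreal"
  assumes "0 < R"
  shows "(\<integral>\<^sup>+y. w y * indicator {y. norm (x - y) < R / 2 ^ j} y \<partial>lebesgue_on S)
    \<le> ennreal ((R / 2 ^ j) ^ DIM('a)) * dyadic_maximal S R w x"
proof -
  define I where "I = (\<integral>\<^sup>+y. w y * indicator {y. norm (x - y) < R / 2 ^ j} y \<partial>lebesgue_on S)"
  have pos: "0 < (R / 2 ^ j) ^ DIM('a)" using assms by simp
  have "ennreal (1 / (R / 2 ^ j) ^ DIM('a)) * I \<le> dyadic_maximal S R w x"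
    unfolding dyadic_maximal_def I_def by (rule SUP_upper) simp
  then have "ennreal ((R / 2 ^ j) ^ DIM('a)) * (ennreal (1 / (R / 2 ^ j) ^ DIM('a)) * I)
     \<le> ennreal ((R / 2 ^ j) ^ DIM('a)) * dyadic_maximal S R w x" by (rule mult_left_mono) simp
  moreover have "ennreal ((R / 2 ^ j) ^ DIM('a)) * (ennreal (1 / (R / 2 ^ j) ^ DIM('a)) * I) = I"
  proof -
    have "ennreal ((R / 2 ^ j) ^ DIM('a)) * ennreal (1 / (R / 2 ^ j) ^ DIM('a)) = 1"
      using pos assms by (subst ennreal_mult[symmetric]) auto
    then show ?thesis by (simp only: mult.assoc[symmetric] mult_1)
  qed
  ultimately show ?thesis unfolding I_def by simp
qed

lemma dyadic_maximal_measurable: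
  fixes w :: "'a::euclidean_space \<Rightarrow> ennreal"
  assumes w: "w \<in> borel_measurable (lebesgue_on S)" and S: "S \<in> lmeasurable"
  shows "dyadic_maximal S R w \<in> borel_measurable (lebesgue_on S)"
proof -
  interpret finite_measure "lebesgue_on S" using S by (intro finite_measure_lebesgue_on)
  note w[measurable] norm_diff_measurable_lebesgue_on[measurable]
  have "(\<lambda>x. \<integral>\<^sup>+y. w y * indicator {y. norm (x - y) < r} y \<partial>lebesgue_on S) \<in> borel_measurable (lebesgue_on S)" for r
  proof (rule borel_measurable_nn_integral)
    have "(\<lambda>z. w (snd z) * indicator {z. norm (fst z - snd z) < r} z) \<in> borel_measurable (lebesgue_on S \<Otimes>\<^sub>M lebesgue_on S)"
      by measurable
    also have "(\<lambda>z. w (snd z) * indicator {z. norm (fst z - snd z) < r} z)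
        = (\<lambda>(x, y). w y * indicator {y. norm (x - y) < r} y)"
      by (auto split: split_indicator)
    finally show "(\<lambda>(x, y). w y * indicator {y. norm (x - y) < r} y) \<in> borel_measurable (lebesgue_on S \<Otimes>\<^sub>M lebesgue_on S)" .
  qed
  then show ?thesis unfolding dyadic_maximal_def[abs_def]
    by (intro borel_measurable_SUP borel_measurable_times_ennreal borel_measurable_const) auto
qed

text \<open>Each point of the level set carries a ball whose volume is controlled by the integral of
  \<open>w\<close> over it. The Vitali covering lemma, applicable because the radii are bounded by
  \<open>R\<close>, selects disjoint balls whose fivefold enlargements still cover the set; this is
  the origin of \<open>5 ^ DIM('a)\<close>.\<close>

lemma dyadic_maximal_weak_type:
  fixes w :: "'a::euclidean_space \<Rightarrow> ennreal"
  assumes w: "w \<in> borel_measurable (lebesgue_on S)" and S: "S \<in> sets lebesgue" and R: "0 < R" and t: "0 < t"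
  shows "emeasure (lebesgue_on S) {x\<in>S. ennreal t < dyadic_maximal S R w x}
    \<le> ennreal (5 ^ DIM('a) * unit_ball_vol DIM('a) / t) * (\<integral>\<^sup>+x. w x \<partial>lebesgue_on S)"
proof -
  define E where "E = {x\<in>S. ennreal t < dyadic_maximal S R w x}"
  have "\<exists>j. ennreal t < ennreal (1 / (R / 2 ^ j) ^ DIM('a)) *
        (\<integral>\<^sup>+y. w y * indicator {y. norm (x - y) < R / 2 ^ j} y \<partial>lebesgue_on S)" if "x \<in> E" for x
    using that unfolding E_def dyadic_maximal_def less_SUP_iff by blast
  then obtain j where j: "\<And>x. x \<in> E \<Longrightarrow> ennreal t < ennreal (1 / (R / 2 ^ j x) ^ DIM('a)) *
        (\<integral>\<^sup>+y. w y * indicator {y. norm (x - y) < R / 2 ^ j x} y \<partial>lebesgue_on S)" by metis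
  define r where "r x = R / 2 ^ j x" for x
  have r: "0 < r x" "r x \<le> R" for x using R by (auto simp: r_def field_simps)
  have vol: "ennreal (unit_ball_vol DIM('a) * (5 * r x) ^ DIM('a))
      \<le> ennreal (5 ^ DIM('a) * unit_ball_vol DIM('a) / t) *
        (\<integral>\<^sup>+y. w y * indicator {y. norm (x - y) < r x} y \<partial>lebesgue_on S)" if "x \<in> E" for x
  proof -
    define I where "I = (\<integral>\<^sup>+y. w y * indicator {y. norm (x - y) < r x} y \<partial>lebesgue_on S)"
    define V where "V = unit_ball_vol DIM('a) * (5 * r x) ^ DIM('a)"
    have V: "0 \<le> V" using r[of x] by (simp add: V_def)
    have "ennreal V = ennreal (V / t) * ennreal t" using t V by (simp add: ennreal_mult[symmetric])
    also have "\<dots> \<le> ennreal (V / t) * (ennreal (1 / r x ^ DIM('a)) * I)"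
      using j[OF that] by (intro mult_left_mono) (auto simp: I_def r_def)
    also have "\<dots> = ennreal (V / t * (1 / r x ^ DIM('a))) * I"
    proof -
      have "ennreal (V / t * (1 / r x ^ DIM('a))) = ennreal (V / t) * ennreal (1 / r x ^ DIM('a))"
        using V t r[of x] by (intro ennreal_mult) auto
      then show ?thesis by (simp only: mult.assoc)
    qed
    also have "V / t * (1 / r x ^ DIM('a)) = 5 ^ DIM('a) * unit_ball_vol DIM('a) / t"
      using r[of x] by (simp add: V_def power_mult_distrib)
    finally show ?thesis by (simp add: V_def I_def)
  qed
  have "E \<subseteq> (\<Union>x\<in>E. cball x (r x))"
  proof
    fix x assume "x \<in> E"
    then show "x \<in> (\<Union>x\<in>E. cball x (r x))" using r(1)[of x] by (intro UN_I[of x]) auto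
  qed
  then obtain C where C: "countable C" "C \<subseteq> E"
     "pairwise (\<lambda>i k. disjnt (cball i (r i)) (cball k (r k))) C"
     "E \<subseteq> (\<Union>i\<in>C. cball i (5 * r i))"
    by (rule Vitali_covering_lemma_cballs[where a="\<lambda>x. x" and r=r and B=R]) (use r in auto)
  have cb: "cball i \<rho> \<inter> S \<in> sets (lebesgue_on S)" for i :: 'a and \<rho>
    using S by (auto simp: sets_restrict_space intro!: image_eqI[of _ _ "cball i \<rho>"] fmeasurableD)
  have bm: "{y \<in> S. norm (i - y) < \<rho>} \<in> sets (lebesgue_on S)" for i :: 'a and \<rho>
  proof -
    have "{y \<in> S. norm (i - y) < \<rho>} = ball i \<rho> \<inter> S" by (auto simp: dist_norm)
    then show ?thesis using S by (auto simp: sets_restrict_space intro!: image_eqI[of _ _ "ball i \<rho>"] fmeasurableD)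
  qed
  have wm: "(\<lambda>y. w y * indicator {y. norm (i - y) < r i} y) \<in> borel_measurable (lebesgue_on S)" for i
  proof -
    have "(\<lambda>y. w y * indicator {y \<in> S. norm (i - y) < r i} y) \<in> borel_measurable (lebesgue_on S)"
      using bm w by (intro borel_measurable_times_ennreal borel_measurable_indicator)
    then show ?thesis by (rule measurable_cong[THEN iffD1, rotated]) (auto split: split_indicator)
  qed
  \<comment> \<open>The sum over the selected balls is written as an integral against
    \<open>count_space C\<close>, so that it can be exchanged with the Lebesgue integral. If
    \<open>E\<close> were not measurable, its \<open>emeasure\<close> would be 0 by
    convention.\<close>
  have "emeasure (lebesgue_on S) E \<le> (\<integral>\<^sup>+x. \<integral>\<^sup>+i. indicator (cball i (5 * r i) \<inter> S) x \<partial>count_space C \<partial>lebesgue_on S)"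
  proof (cases "E \<in> sets (lebesgue_on S)")
    case True
    then have "emeasure (lebesgue_on S) E = (\<integral>\<^sup>+x. indicator E x \<partial>lebesgue_on S)" by simp
    also have "\<dots> \<le> (\<integral>\<^sup>+x. \<integral>\<^sup>+i. indicator (cball i (5 * r i) \<inter> S) x \<partial>count_space C \<partial>lebesgue_on S)"
    proof (intro nn_integral_mono)
      fix x
      show "indicator E x \<le> (\<integral>\<^sup>+i. indicator (cball i (5 * r i) \<inter> S) x \<partial>count_space C)"
      proof (cases "x \<in> E")
        case True
        then obtain i where i: "i \<in> C" "x \<in> cball i (5 * r i)" using C by blast
        have "indicator E x = (indicator (cball i (5 * r i) \<inter> S) x :: ennreal)" using i True by (simp add: E_def)
        also have "\<dots> \<le> (\<integral>\<^sup>+i. indicator (cball i (5 * r i) \<inter> S) x \<partial>count_space C)"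
          by (rule nn_integral_ge_point[OF i(1)])
        finally show ?thesis .
      qed auto
    qed
    finally show ?thesis .
  qed (simp add: emeasure_notin_sets)
  also have "\<dots> = (\<integral>\<^sup>+i. \<integral>\<^sup>+x. indicator (cball i (5 * r i) \<inter> S) x \<partial>lebesgue_on S \<partial>count_space C)"
    using cb C by (intro nn_integral_count_space_nn_integral borel_measurable_indicator)
  also have "\<dots> \<le> (\<integral>\<^sup>+i. ennreal (5 ^ DIM('a) * unit_ball_vol DIM('a) / t) *
        (\<integral>\<^sup>+y. w y * indicator {y. norm (i - y) < r i} y \<partial>lebesgue_on S) \<partial>count_space C)"
  proof (intro nn_integral_mono)
    fix i assume "i \<in> space (count_space C)"
    then have i: "i \<in> E" using C by auto
    have "(\<integral>\<^sup>+x. indicator (cball i (5 * r i) \<inter> S) x \<partial>lebesgue_on S) = emeasure (lebesgue_on S) (cball i (5 * r i) \<inter> S)"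
      by (rule nn_integral_indicator[OF cb])
    also have "\<dots> = emeasure lebesgue (cball i (5 * r i) \<inter> S)"
      using S by (intro emeasure_restrict_space) auto
    also have "\<dots> \<le> emeasure lebesgue (cball i (5 * r i))"
      by (intro emeasure_mono) (auto intro: fmeasurableD)
    also have "\<dots> = ennreal (unit_ball_vol DIM('a) * (5 * r i) ^ DIM('a))"
      using r[of i] by (simp add: emeasure_cball)
    also note vol[OF i]
    finally show "(\<integral>\<^sup>+x. indicator (cball i (5 * r i) \<inter> S) x \<partial>lebesgue_on S)
      \<le> ennreal (5 ^ DIM('a) * unit_ball_vol DIM('a) / t) *
        (\<integral>\<^sup>+y. w y * indicator {y. norm (i - y) < r i} y \<partial>lebesgue_on S)" .
  qed
  also have "\<dots> = ennreal (5 ^ DIM('a) * unit_ball_vol DIM('a) / t) *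
     (\<integral>\<^sup>+i. \<integral>\<^sup>+y. w y * indicator {y. norm (i - y) < r i} y \<partial>lebesgue_on S \<partial>count_space C)"
    by (rule nn_integral_cmult) simp
  also have "(\<integral>\<^sup>+i. \<integral>\<^sup>+y. w y * indicator {y. norm (i - y) < r i} y \<partial>lebesgue_on S \<partial>count_space C)
     = (\<integral>\<^sup>+y. \<integral>\<^sup>+i. w y * indicator {y. norm (i - y) < r i} y \<partial>count_space C \<partial>lebesgue_on S)"
    using wm C by (intro nn_integral_count_space_nn_integral[symmetric])
  also have "\<dots> \<le> (\<integral>\<^sup>+y. w y \<partial>lebesgue_on S)"
  proof (intro nn_integral_mono)
    \<comment> \<open>The selected balls are disjoint before enlargement, so at most one of them
      contains \<open>y\<close> and the sum of their indicators is at most one.\<close>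
    fix y
    have "(\<integral>\<^sup>+i. indicator {y. norm (i - y) < r i} y \<partial>count_space C) \<le> (1::ennreal)"
    proof (cases "\<exists>k\<in>C. norm (k - y) < r k")
      case True
      then obtain k where k: "k \<in> C" "norm (k - y) < r k" by blast
      have eq: "indicator {y. norm (i - y) < r i} y = (indicator {k} i :: ennreal)" if i: "i \<in> C" for i
      proof (cases "i = k")
        case False
        then have "disjnt (cball i (r i)) (cball k (r k))" using C(3) k i by (auto simp: pairwise_def)
        moreover have "y \<in> cball k (r k)" using k by (simp add: dist_norm)
        ultimately have "y \<notin> cball i (r i)" by (auto simp: disjnt_def)
        then show ?thesis using False by (simp add: dist_norm)
      qed (use k in simp)
      have "(\<integral>\<^sup>+i. indicator {y. norm (i - y) < r i} y \<partial>count_space C) = (\<integral>\<^sup>+i. indicator {k} i \<partial>count_space C)"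
        by (intro nn_integral_cong) (simp only: space_count_space eq)
      also have "\<dots> = emeasure (count_space C) {k}" using k by (intro nn_integral_indicator) auto
      also have "\<dots> = 1" using k by (simp add: emeasure_count_space)
      finally show ?thesis by simp
    next
      case False
      then have "(\<integral>\<^sup>+i. indicator {y. norm (i - y) < r i} y \<partial>count_space C) = (\<integral>\<^sup>+i. 0 \<partial>count_space C :: ennreal)"
        by (intro nn_integral_cong) auto
      then show ?thesis by simp
    qed
    then have "w y * (\<integral>\<^sup>+i. indicator {y. norm (i - y) < r i} y \<partial>count_space C) \<le> w y * 1"
      by (intro mult_left_mono) auto
    then show "(\<integral>\<^sup>+i. w y * indicator {y. norm (i - y) < r i} y \<partial>count_space C) \<le> w y"
      by (subst nn_integral_cmult) auto
  qed
  finally show ?thesis unfolding E_def by (simp add: mult_left_mono)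
qed

section \<open>Layer cake formula and the strong type bound\<close>

lemma nn_integral_powr_interval:
  assumes p: "0 < p" and m: "0 \<le> m"
  shows "(\<integral>\<^sup>+t. ennreal (p * t powr (p - 1)) * indicator {0..m} t \<partial>lborel) = ennreal (m powr p)"
proof -
  have "((\<lambda>t. t powr (p - 1)) has_integral (m powr p / p)) {0..m}"
    using has_integral_powr_from_0[of "p - 1" m] p m by simp
  then have "((\<lambda>t. p * t powr (p - 1)) has_integral (p * (m powr p / p))) {0..m}"
    by (rule has_integral_mult_right)
  then have "integral\<^sup>N lborel (\<lambda>t. indicator {0..m} t * (p * t powr (p - 1))) = p * (m powr p / p)"
    using p by (intro nn_integral_has_integral_lebesgue) auto
  moreover have "ennreal (p * t powr (p - 1)) * indicator {0..m} t = ennreal (indicator {0..m} t * (p * t powr (p - 1)))" for t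
    by (simp split: split_indicator)
  ultimately show ?thesis using p by simp
qed

text \<open>Tonelli for the region under the graph of \<open>m\<close>. The measure is a general
  sigma-finite one because the strong type bound uses the formula twice, for Lebesgue measure and
  for the measure with density \<open>w\<close>.\<close>

lemma layer_cake:
  assumes "sigma_finite_measure M" and m[measurable]: "m \<in> borel_measurable M" and m0: "\<And>x. 0 \<le> m x" and p: "0 < p"
  shows "(\<integral>\<^sup>+x. ennreal (m x powr p) \<partial>M)
    = (\<integral>\<^sup>+t. ennreal (p * t powr (p - 1)) * indicator {0..} t * emeasure M {x\<in>space M. t \<le> m x} \<partial>lborel)"
proof -
  interpret M: sigma_finite_measure M by fact
  interpret pair_sigma_finite M lborel ..
  have "(\<integral>\<^sup>+x. ennreal (m x powr p) \<partial>M) = (\<integral>\<^sup>+x. \<integral>\<^sup>+t. ennreal (p * t powr (p - 1)) * indicator {0..m x} t \<partial>lborel \<partial>M)"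
    using nn_integral_powr_interval[OF p m0] by simp
  also have "\<dots> = (\<integral>\<^sup>+x. \<integral>\<^sup>+t. ennreal (p * t powr (p - 1)) * indicator {0..} t * indicator {z. snd z \<le> m (fst z)} (x, t) \<partial>lborel \<partial>M)"
    by (intro nn_integral_cong) (auto split: split_indicator)
  also have "\<dots> = (\<integral>\<^sup>+t. \<integral>\<^sup>+x. ennreal (p * t powr (p - 1)) * indicator {0..} t * indicator {z. snd z \<le> m (fst z)} (x, t) \<partial>M \<partial>lborel)"
    by (rule Fubini'[symmetric]) measurable
  also have "\<dots> = (\<integral>\<^sup>+t. ennreal (p * t powr (p - 1)) * indicator {0..} t * emeasure M {x\<in>space M. t \<le> m x} \<partial>lborel)"
  proof (intro nn_integral_cong)
    fix t
    have "(\<integral>\<^sup>+x. ennreal (p * t powr (p - 1)) * indicator {0..} t * indicator {z. snd z \<le> m (fst z)} (x, t) \<partial>M)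
      = (\<integral>\<^sup>+x. ennreal (p * t powr (p - 1)) * indicator {0..} t * indicator {x\<in>space M. t \<le> m x} x \<partial>M)"
      by (intro nn_integral_cong) (auto split: split_indicator)
    also have "\<dots> = ennreal (p * t powr (p - 1)) * indicator {0..} t * emeasure M {x\<in>space M. t \<le> m x}"
      by (rule nn_integral_cmult_indicator) measurable
    finally show "(\<integral>\<^sup>+x. ennreal (p * t powr (p - 1)) * indicator {0..} t * indicator {z. snd z \<le> m (fst z)} (x, t) \<partial>M)
      = ennreal (p * t powr (p - 1)) * indicator {0..} t * emeasure M {x\<in>space M. t \<le> m x}" .
  qed
  finally show ?thesis .
qed

text \<open>Interpolation in the manner of Marcinkiewicz. For each height \<open>t\<close> the
  function is cut at a fixed multiple of \<open>t\<close>: the small part raises the maximal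
  function by at most \<open>t / 2\<close>, and the large part is left to the weak type
  bound.\<close>

theorem dyadic_maximal_strong_type:
  fixes S :: "'a::euclidean_space set"
  assumes S: "S \<in> lmeasurable" and p: "1 < p" and R: "0 < R"
  obtains K where "0 < K"
    "\<And>w A. w \<in> borel_measurable (lebesgue_on S) \<Longrightarrow> (\<And>x. 0 \<le> w x) \<Longrightarrow>
       (\<integral>\<^sup>+x. ennreal (w x powr p) \<partial>lebesgue_on S) \<le> ennreal A \<Longrightarrow>
       (AE x in lebesgue_on S. dyadic_maximal S R (\<lambda>y. ennreal (w y)) x \<noteq> \<infinity>) \<and>
       (\<integral>\<^sup>+x. ennreal (enn2real (dyadic_maximal S R (\<lambda>y. ennreal (w y)) x) powr p) \<partial>lebesgue_on S) \<le> ennreal (K * A)"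
proof -
  have S': "S \<in> sets lebesgue" using S by (rule fmeasurableD)
  interpret finite_measure "lebesgue_on S" using S by (intro finite_measure_lebesgue_on)
  define \<omega> where "\<omega> = unit_ball_vol DIM('a)"
  have om: "0 < \<omega>" by (simp add: \<omega>_def)
  \<comment> \<open>In the normalisation of \<open>dyadic_maximal\<close>, a function bounded by
    \<open>a * t\<close> has averages of at most \<open>\<omega> * (a * t) = t / 2\<close>.\<close>
  define a where "a = 1 / (2 * \<omega>)"
  have a: "0 < a" using om by (simp add: a_def)
  define W where "W = 5 ^ DIM('a) * \<omega>"
  have W: "0 < W" using om by (simp add: W_def)
  define K where "K = 4 * W * p / (p - 1) * a powr - (p - 1)"
  have K: "0 < K" using W p a by (simp add: K_def)
  show ?thesis
  proof (rule that[OF K])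
    fix w :: "'a \<Rightarrow> real" and A :: real
    assume w[measurable]: "w \<in> borel_measurable (lebesgue_on S)" and w0: "\<And>x. 0 \<le> w x"
      and int: "(\<integral>\<^sup>+x. ennreal (w x powr p) \<partial>lebesgue_on S) \<le> ennreal A"
    define \<mu> where "\<mu> = dyadic_maximal S R (\<lambda>y. ennreal (w y))"
    have mu[measurable]: "\<mu> \<in> borel_measurable (lebesgue_on S)"
      unfolding \<mu>_def by (intro dyadic_maximal_measurable S) measurable
    have fin: "(\<integral>\<^sup>+x. ennreal (w x) \<partial>lebesgue_on S) < \<infinity>"
    proof -
      have le: "w x \<le> w x powr p + 1" for x
      proof (cases "w x \<le> 1")
        case False
        then have "w x powr 1 \<le> w x powr p" using p by (intro powr_mono) auto
        then show ?thesis using False by simp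
      qed (simp add: add_increasing)
      have "(\<integral>\<^sup>+x. ennreal (w x) \<partial>lebesgue_on S) \<le> (\<integral>\<^sup>+x. ennreal (w x powr p) + ennreal 1 \<partial>lebesgue_on S)"
        by (intro nn_integral_mono) (use le in \<open>simp add: ennreal_leI flip: ennreal_plus ennreal_1\<close>)
      also have "\<dots> = (\<integral>\<^sup>+x. ennreal (w x powr p) \<partial>lebesgue_on S) + emeasure (lebesgue_on S) (space (lebesgue_on S))"
        by (subst nn_integral_add) auto
      also have "\<dots> < \<infinity>"
        using int emeasure_finite by (auto simp: less_top[symmetric] top_unique)
      finally show ?thesis .
    qed
    \<comment> \<open>The integral of \<open>w\<close> over one of its own superlevel sets is the
      \<open>\<nu>\<close>-measure of that set. The remaining integral over \<open>t\<close> thereby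
      becomes a second layer cake formula, with exponent \<open>p - 1\<close>, whose positivity is
      the hypothesis \<open>1 < p\<close>.\<close>
    define \<nu> where "\<nu> = density (lebesgue_on S) (\<lambda>x. ennreal (w x))"
    have nu: "finite_measure \<nu>"
    proof (rule finite_measureI)
      have "emeasure \<nu> (space \<nu>) = (\<integral>\<^sup>+x. ennreal (w x) * indicator (space (lebesgue_on S)) x \<partial>lebesgue_on S)"
        unfolding \<nu>_def by (subst emeasure_density) auto
      also have "\<dots> = (\<integral>\<^sup>+x. ennreal (w x) \<partial>lebesgue_on S)" by (intro nn_integral_cong) simp
      finally show "emeasure \<nu> (space \<nu>) \<noteq> \<infinity>" using fin by simp
    qed
    have level: "emeasure (lebesgue_on S) {x\<in>space (lebesgue_on S). t \<le> enn2real (\<mu> x)}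
        \<le> ennreal (4 * W / t) * emeasure \<nu> {x\<in>space \<nu>. t \<le> w x / a}" if t: "0 < t" for t
    proof -
      define v where "v x = ennreal (w x) * indicator {x. t \<le> w x / a} x" for x
      have v[measurable]: "v \<in> borel_measurable (lebesgue_on S)"
      proof -
        have "(\<lambda>x. ennreal (w x) * indicator {x\<in>space (lebesgue_on S). t \<le> w x / a} x) \<in> borel_measurable (lebesgue_on S)"
          by measurable
        then show ?thesis unfolding v_def
          by (rule measurable_cong[THEN iffD1, rotated]) (auto split: split_indicator)
      qed
      have mle: "\<mu> x \<le> dyadic_maximal S R v x + ennreal (t / 2)" for x
        unfolding \<mu>_def
      proof (subst dyadic_maximal_def, rule SUP_least)
        fix j
        define r where "r = R / 2 ^ j"
        have r: "0 < r" using R by (simp add: r_def)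
        define B where "B = {y \<in> S. norm (x - y) < r}"
        have B: "B \<in> sets (lebesgue_on S)"
        proof -
          have "B = ball x r \<inter> S" by (auto simp: dist_norm B_def)
          then show ?thesis using S' by (auto simp: sets_restrict_space intro!: image_eqI[of _ _ "ball x r"] fmeasurableD)
        qed
        have "(\<integral>\<^sup>+y. ennreal (w y) * indicator {y. norm (x - y) < r} y \<partial>lebesgue_on S)
          \<le> (\<integral>\<^sup>+y. v y * indicator B y + ennreal (a * t) * indicator B y \<partial>lebesgue_on S)"
        proof (intro nn_integral_mono)
          fix y assume "y \<in> space (lebesgue_on S)"
          then have y: "y \<in> S" by simp
          have "ennreal (w y) \<le> v y + ennreal (a * t)"
          proof (cases "t \<le> w y / a")
            case False
            then have "w y \<le> a * t" using a by (simp add: field_simps)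
            then show ?thesis using False by (simp add: v_def ennreal_leI)
          qed (simp add: v_def)
          then show "ennreal (w y) * indicator {y. norm (x - y) < r} y
              \<le> v y * indicator B y + ennreal (a * t) * indicator B y"
            using y by (auto simp: B_def split: split_indicator)
        qed
        also have "\<dots> = (\<integral>\<^sup>+y. v y * indicator B y \<partial>lebesgue_on S) + (\<integral>\<^sup>+y. ennreal (a * t) * indicator B y \<partial>lebesgue_on S)"
          using B by (intro nn_integral_add) auto
        also have "(\<integral>\<^sup>+y. v y * indicator B y \<partial>lebesgue_on S) = (\<integral>\<^sup>+y. v y * indicator {y. norm (x - y) < r} y \<partial>lebesgue_on S)"
          by (intro nn_integral_cong) (auto simp: B_def split: split_indicator)
        also have "(\<integral>\<^sup>+y. ennreal (a * t) * indicator B y \<partial>lebesgue_on S) = ennreal (a * t) * emeasure (lebesgue_on S) B"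
          using B by (simp add: nn_integral_cmult_indicator)
        also have "emeasure (lebesgue_on S) B \<le> ennreal (\<omega> * r ^ DIM('a))"
        proof -
          have "emeasure (lebesgue_on S) B = emeasure lebesgue B"
            using S' by (intro emeasure_restrict_space) (auto simp: B_def)
          also have "\<dots> \<le> emeasure lebesgue (ball x r)"
            by (intro emeasure_mono) (auto simp: B_def dist_norm intro: fmeasurableD)
          also have "\<dots> = ennreal (\<omega> * r ^ DIM('a))" using r by (simp add: emeasure_ball \<omega>_def)
          finally show ?thesis .
        qed
        finally have le: "(\<integral>\<^sup>+y. ennreal (w y) * indicator {y. norm (x - y) < r} y \<partial>lebesgue_on S)
          \<le> (\<integral>\<^sup>+y. v y * indicator {y. norm (x - y) < r} y \<partial>lebesgue_on S) + ennreal (a * t) * ennreal (\<omega> * r ^ DIM('a))"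
          by (simp add: add_left_mono mult_left_mono)
        have "ennreal (1 / r ^ DIM('a)) * (\<integral>\<^sup>+y. ennreal (w y) * indicator {y. norm (x - y) < r} y \<partial>lebesgue_on S)
          \<le> ennreal (1 / r ^ DIM('a)) * ((\<integral>\<^sup>+y. v y * indicator {y. norm (x - y) < r} y \<partial>lebesgue_on S) + ennreal (a * t) * ennreal (\<omega> * r ^ DIM('a)))"
          by (rule mult_left_mono[OF le]) simp
        also have "\<dots> = ennreal (1 / r ^ DIM('a)) * (\<integral>\<^sup>+y. v y * indicator {y. norm (x - y) < r} y \<partial>lebesgue_on S)
            + ennreal (1 / r ^ DIM('a)) * (ennreal (a * t) * ennreal (\<omega> * r ^ DIM('a)))"
          by (rule distrib_left)
        also have "ennreal (1 / r ^ DIM('a)) * (ennreal (a * t) * ennreal (\<omega> * r ^ DIM('a))) = ennreal (t / 2)"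
        proof -
          have "1 / r ^ DIM('a) * ((a * t) * (\<omega> * r ^ DIM('a))) = t / 2"
            using r om by (simp add: a_def)
          moreover have "0 \<le> a * t" "0 \<le> \<omega> * r ^ DIM('a)" "0 \<le> 1 / r ^ DIM('a)" using a t om r by auto
          ultimately show ?thesis by (metis ennreal_mult mult_nonneg_nonneg)
        qed
        also have "ennreal (1 / r ^ DIM('a)) * (\<integral>\<^sup>+y. v y * indicator {y. norm (x - y) < r} y \<partial>lebesgue_on S)
            \<le> dyadic_maximal S R v x"
          unfolding dyadic_maximal_def r_def by (rule SUP_upper) simp
        finally show "ennreal (1 / (R / 2 ^ j) ^ DIM('a)) * (\<integral>\<^sup>+y. ennreal (w y) * indicator {y. norm (x - y) < R / 2 ^ j} y \<partial>lebesgue_on S)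
          \<le> dyadic_maximal S R v x + ennreal (t / 2)" by (simp add: r_def add_right_mono)
      qed
      \<comment> \<open>Any threshold below \<open>t / 2\<close> would do; \<open>t / 4\<close>
        leaves room for the strict inequality in the weak type bound.\<close>
      have "{x\<in>space (lebesgue_on S). t \<le> enn2real (\<mu> x)} \<subseteq> {x\<in>S. ennreal (t / 4) < dyadic_maximal S R v x}"
      proof safe
        fix x assume x: "x \<in> space (lebesgue_on S)" "t \<le> enn2real (\<mu> x)"
        then show "x \<in> S" by simp
        show "ennreal (t / 4) < dyadic_maximal S R v x"
        proof (rule ccontr)
          assume "\<not> ?thesis"
          then have "\<mu> x \<le> ennreal (t / 4) + ennreal (t / 2)"
            using order_trans[OF mle add_right_mono[of "dyadic_maximal S R v x" "ennreal (t / 4)" "ennreal (t / 2)"]]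
            by (simp add: not_less)
          also have "\<dots> = ennreal (t / 4 + t / 2)" using t by (intro ennreal_plus[symmetric]) auto
          finally have "enn2real (\<mu> x) \<le> t / 4 + t / 2" using t by (intro enn2real_leI) auto
          then show False using x t by simp
        qed
      qed
      then have "emeasure (lebesgue_on S) {x\<in>space (lebesgue_on S). t \<le> enn2real (\<mu> x)}
         \<le> emeasure (lebesgue_on S) {x\<in>S. ennreal (t / 4) < dyadic_maximal S R v x}"
      proof (rule emeasure_mono)
        have "{x\<in>space (lebesgue_on S). ennreal (t / 4) < dyadic_maximal S R v x} \<in> sets (lebesgue_on S)"
          using dyadic_maximal_measurable[OF v S] by measurable
        then show "{x\<in>S. ennreal (t / 4) < dyadic_maximal S R v x} \<in> sets (lebesgue_on S)" by simp
      qed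
      also have "\<dots> \<le> ennreal (5 ^ DIM('a) * unit_ball_vol DIM('a) / (t / 4)) * (\<integral>\<^sup>+x. v x \<partial>lebesgue_on S)"
        using t by (intro dyadic_maximal_weak_type v S' R) simp
      also have "5 ^ DIM('a) * unit_ball_vol DIM('a) / (t / 4) = 4 * W / t" by (simp add: W_def \<omega>_def)
      also have "(\<integral>\<^sup>+x. v x \<partial>lebesgue_on S) = emeasure \<nu> {x\<in>space \<nu>. t \<le> w x / a}"
      proof -
        have "emeasure \<nu> {x\<in>space \<nu>. t \<le> w x / a}
          = (\<integral>\<^sup>+x. ennreal (w x) * indicator {x\<in>space (lebesgue_on S). t \<le> w x / a} x \<partial>lebesgue_on S)"
          unfolding \<nu>_def space_density by (rule emeasure_density) measurable
        also have "\<dots> = (\<integral>\<^sup>+x. v x \<partial>lebesgue_on S)"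
          by (intro nn_integral_cong) (auto simp: v_def split: split_indicator)
        finally show ?thesis ..
      qed
      finally show ?thesis .
    qed
    have "(\<integral>\<^sup>+x. ennreal (enn2real (\<mu> x) powr p) \<partial>lebesgue_on S)
      = (\<integral>\<^sup>+t. ennreal (p * t powr (p - 1)) * indicator {0..} t *
           emeasure (lebesgue_on S) {x\<in>space (lebesgue_on S). t \<le> enn2real (\<mu> x)} \<partial>lborel)"
      using p by (intro layer_cake sigma_finite_measure_axioms) auto
    also have "\<dots> \<le> (\<integral>\<^sup>+t. ennreal (4 * W * p / (p - 1)) *
        (ennreal ((p - 1) * t powr (p - 1 - 1)) * indicator {0..} t * emeasure \<nu> {x\<in>space \<nu>. t \<le> w x / a}) \<partial>lborel)"
    proof (intro nn_integral_mono)
      fix t :: real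
      show "ennreal (p * t powr (p - 1)) * indicator {0..} t *
           emeasure (lebesgue_on S) {x\<in>space (lebesgue_on S). t \<le> enn2real (\<mu> x)}
        \<le> ennreal (4 * W * p / (p - 1)) *
        (ennreal ((p - 1) * t powr (p - 1 - 1)) * indicator {0..} t * emeasure \<nu> {x\<in>space \<nu>. t \<le> w x / a})"
      proof (cases "0 < t")
        case True
        have "ennreal (p * t powr (p - 1)) * emeasure (lebesgue_on S) {x\<in>space (lebesgue_on S). t \<le> enn2real (\<mu> x)}
          \<le> ennreal (p * t powr (p - 1)) * (ennreal (4 * W / t) * emeasure \<nu> {x\<in>space \<nu>. t \<le> w x / a})"
          by (intro mult_left_mono level True) simp
        also have "\<dots> = ennreal (p * t powr (p - 1) * (4 * W / t)) * emeasure \<nu> {x\<in>space \<nu>. t \<le> w x / a}"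
        proof -
          have "ennreal (p * t powr (p - 1) * (4 * W / t)) = ennreal (p * t powr (p - 1)) * ennreal (4 * W / t)"
            by (rule ennreal_mult) (use p True W in auto)
          then show ?thesis by (simp only: mult.assoc)
        qed
        \<comment> \<open>The weak type bound costs one power of \<open>t\<close>. The factor
          \<open>p / (p - 1)\<close> adapts the weight to the layer cake formula with exponent
          \<open>p - 1\<close>.\<close>
        also have "p * t powr (p - 1) * (4 * W / t) = 4 * W * p / (p - 1) * ((p - 1) * t powr (p - 1 - 1))"
        proof -
          have "t powr (p - 1) = t powr (p - 1 - 1) * t" using True powr_add[of t "p - 1 - 1" 1] by simp
          then show ?thesis using True p by simp
        qed
        also have "ennreal \<dots> = ennreal (4 * W * p / (p - 1)) * ennreal ((p - 1) * t powr (p - 1 - 1))"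
          using W p by (intro ennreal_mult) auto
        finally show ?thesis using True by (simp add: mult.assoc)
      next
        case False
        then show ?thesis by (cases "t = 0") auto
      qed
    qed
    also have "\<dots> = ennreal (4 * W * p / (p - 1)) * (\<integral>\<^sup>+t. ennreal ((p - 1) * t powr (p - 1 - 1)) * indicator {0..} t * emeasure \<nu> {x\<in>space \<nu>. t \<le> w x / a} \<partial>lborel)"
    proof (rule nn_integral_cmult)
      interpret N: finite_measure \<nu> by (rule nu)
      have wn[measurable]: "w \<in> borel_measurable \<nu>" by (simp add: \<nu>_def)
      have "(\<lambda>t. emeasure \<nu> (Pair t -` {z \<in> space (lborel \<Otimes>\<^sub>M \<nu>). fst z \<le> w (snd z) / a})) \<in> borel_measurable lborel"
        by (rule N.measurable_emeasure_Pair) measurable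
      moreover have "Pair t -` {z \<in> space (lborel \<Otimes>\<^sub>M \<nu>). fst z \<le> w (snd z) / a} = {x\<in>space \<nu>. t \<le> w x / a}" for t
        by (auto simp: space_pair_measure)
      ultimately have [measurable]: "(\<lambda>t. emeasure \<nu> {x\<in>space \<nu>. t \<le> w x / a}) \<in> borel_measurable lborel" by simp
      show "(\<lambda>t. ennreal ((p - 1) * t powr (p - 1 - 1)) * indicator {0..} t * emeasure \<nu> {x\<in>space \<nu>. t \<le> w x / a}) \<in> borel_measurable lborel"
        by measurable
    qed
    also have "(\<integral>\<^sup>+t. ennreal ((p - 1) * t powr (p - 1 - 1)) * indicator {0..} t * emeasure \<nu> {x\<in>space \<nu>. t \<le> w x / a} \<partial>lborel)
        = (\<integral>\<^sup>+x. ennreal ((w x / a) powr (p - 1)) \<partial>\<nu>)"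
      using p w0 a by (intro layer_cake[symmetric] finite_measure.axioms(1) nu) (auto simp: \<nu>_def)
    also have "\<dots> = (\<integral>\<^sup>+x. ennreal (w x) * ennreal ((w x / a) powr (p - 1)) \<partial>lebesgue_on S)"
      unfolding \<nu>_def by (rule nn_integral_density) measurable
    also have "\<dots> = (\<integral>\<^sup>+x. ennreal (a powr - (p - 1)) * ennreal (w x powr p) \<partial>lebesgue_on S)"
    proof (intro nn_integral_cong)
      fix x
      have "w x * (w x / a) powr (p - 1) = a powr - (p - 1) * w x powr p"
      proof (cases "w x = 0")
        case False
        then have "w x powr p = w x * w x powr (p - 1)" using w0[of x] powr_add[of "w x" 1 "p - 1"] by simp
        moreover have "a powr - (p - 1) = 1 / a powr (p - 1)" by (rule powr_minus_divide)
        ultimately show ?thesis by (simp only: powr_divide) simp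
      qed (use p in simp)
      then show "ennreal (w x) * ennreal ((w x / a) powr (p - 1)) = ennreal (a powr - (p - 1)) * ennreal (w x powr p)"
        using w0 by (simp only: ennreal_mult[symmetric] powr_ge_zero)
    qed
    also have "\<dots> = ennreal (a powr - (p - 1)) * (\<integral>\<^sup>+x. ennreal (w x powr p) \<partial>lebesgue_on S)"
      by (rule nn_integral_cmult) measurable
    also have "\<dots> \<le> ennreal (a powr - (p - 1)) * ennreal A" by (intro mult_left_mono int) simp
    finally have "(\<integral>\<^sup>+x. ennreal (enn2real (\<mu> x) powr p) \<partial>lebesgue_on S)
      \<le> ennreal (4 * W * p / (p - 1)) * (ennreal (a powr - (p - 1)) * ennreal A)" by (simp add: mult_left_mono)
    also have "\<dots> = ennreal (4 * W * p / (p - 1) * a powr - (p - 1)) * ennreal A"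
      using W p by (subst ennreal_mult) (auto simp: mult.assoc)
    also have "\<dots> = ennreal (K * A)"
      using K by (simp only: K_def[symmetric]) (simp add: ennreal_mult')
    finally have strong: "(\<integral>\<^sup>+x. ennreal (enn2real (\<mu> x) powr p) \<partial>lebesgue_on S) \<le> ennreal (K * A)" .
    \<comment> \<open>Finiteness needs its own argument: \<open>enn2real\<close> sends infinity to
      0, so the integral bound does not see the points where the maximal function is infinite. The
      weak type bound at arbitrarily large heights shows that they form a null set.\<close>
    have "AE x in lebesgue_on S. \<mu> x \<noteq> \<infinity>"
    proof (rule AE_I)
      show "{x \<in> space (lebesgue_on S). \<not> \<mu> x \<noteq> \<infinity>} \<subseteq> {x \<in> space (lebesgue_on S). \<mu> x = \<infinity>}" by auto
      show "{x \<in> space (lebesgue_on S). \<mu> x = \<infinity>} \<in> sets (lebesgue_on S)" by measurable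
      define e where "e = emeasure (lebesgue_on S) {x \<in> space (lebesgue_on S). \<mu> x = \<infinity>}"
      define I where "I = enn2real (\<integral>\<^sup>+x. ennreal (w x) \<partial>lebesgue_on S)"
      have I: "(\<integral>\<^sup>+x. ennreal (w x) \<partial>lebesgue_on S) = ennreal I" "0 \<le> I" using fin by (auto simp: I_def)
      have le: "e \<le> ennreal (W / t * I)" if "0 < t" for t
      proof -
        have "{x \<in> space (lebesgue_on S). ennreal t < \<mu> x} \<in> sets (lebesgue_on S)" by measurable
        then have "e \<le> emeasure (lebesgue_on S) {x\<in>S. ennreal t < dyadic_maximal S R (\<lambda>y. ennreal (w y)) x}"
          unfolding e_def \<mu>_def by (intro emeasure_mono) auto
        also have "\<dots> \<le> ennreal (5 ^ DIM('a) * unit_ball_vol DIM('a) / t) * (\<integral>\<^sup>+x. ennreal (w x) \<partial>lebesgue_on S)"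
          by (intro dyadic_maximal_weak_type S' R that) measurable
        also have "\<dots> = ennreal (W / t) * ennreal I" unfolding I(1) W_def \<omega>_def ..
        also have "\<dots> = ennreal (W / t * I)"
          by (rule ennreal_mult[symmetric]) (use that W I in auto)
        finally show ?thesis .
      qed
      have "e \<le> 0 + ennreal \<epsilon>" if "0 < \<epsilon>" for \<epsilon>
      proof -
        define t where "t = W * (I + 1) / \<epsilon>"
        have t: "0 < t" using W I that by (auto simp: t_def intro!: divide_pos_pos mult_pos_pos)
        have "W / t * I = \<epsilon> * (I / (I + 1))" using W I that by (simp add: t_def)
        also have "\<dots> \<le> \<epsilon> * 1" using I that by (intro mult_left_mono) auto
        finally show ?thesis using le[OF t] by (simp add: order_trans[OF _ ennreal_leI])
      qed
      then have "e \<le> 0" by (rule ennreal_le_epsilon)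
      then show "emeasure (lebesgue_on S) {x \<in> space (lebesgue_on S). \<mu> x = \<infinity>} = 0" by (simp add: e_def)
    qed
    with strong show "(AE x in lebesgue_on S. dyadic_maximal S R (\<lambda>y. ennreal (w y)) x \<noteq> \<infinity>) \<and>
       (\<integral>\<^sup>+x. ennreal (enn2real (dyadic_maximal S R (\<lambda>y. ennreal (w y)) x) powr p) \<partial>lebesgue_on S) \<le> ennreal (K * A)"
      unfolding \<mu>_def by (rule conjI[rotated])
  qed
qed

section \<open>Averages against a moving smooth bump\<close>

text \<open>Dividing the flat function \<open>exp (- 1 / t)\<close> by powers of \<open>t\<close>
  gives a family whose derivatives are linear combinations of its own members, so that all orders of
  differentiation are treated at once.\<close>

definition flat_exp :: "nat \<Rightarrow> real \<Rightarrow> real" where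
  "flat_exp m t = (if 0 < t then exp (- 1 / t) / t ^ m else 0)"

lemma flat_exp_nonpos [simp]: "t \<le> 0 \<Longrightarrow> flat_exp m t = 0"
  by (simp add: flat_exp_def)

text \<open>For \<open>h > 0\<close> and \<open>x = 1 / h\<close> the quotient is
  \<open>x ^ (m + 1) * exp (- x)\<close>. The limit is the derivative at the origin, the only point
  where differentiating \<open>flat_exp\<close> is not plain calculus.\<close>

lemma flat_exp_over_id_tendsto_0: "((\<lambda>h. flat_exp m h / h) \<longlongrightarrow> 0) (at 0)"
proof -
  have "((\<lambda>h. flat_exp m h / h) \<longlongrightarrow> 0) (at_left 0)"
  proof (rule Lim_transform_eventually[OF tendsto_const])
    show "\<forall>\<^sub>F h in at_left 0. 0 = flat_exp m h / h"
      by (auto simp: eventually_at_filter)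
  qed
  moreover have "((\<lambda>h. flat_exp m h / h) \<longlongrightarrow> 0) (at_right 0)"
  proof (rule Lim_transform_eventually)
    show "((\<lambda>h. inverse h ^ Suc m / exp (inverse h)) \<longlongrightarrow> (0::real)) (at_right 0)"
      by (rule filterlim_compose[OF tendsto_power_div_exp_0 filterlim_inverse_at_top_right])
    have "inverse h ^ Suc m / exp (inverse h) = flat_exp m h / h" if "0 < h" for h :: real
      using that by (simp add: flat_exp_def exp_minus divide_simps)
    then show "\<forall>\<^sub>F h in at_right 0. inverse h ^ Suc m / exp (inverse h) = flat_exp m h / h"
      by (auto simp: eventually_at_filter)
  qed
  ultimately show ?thesis by (simp add: filterlim_at_split)
qed

lemma flat_exp_has_derivative:
  "(flat_exp m has_real_derivative flat_exp (m + 2) t - real m * flat_exp (m + 1) t) (at t)"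
proof -
  consider "t < 0" | "t = 0" | "0 < t" by linarith
  then show ?thesis
  proof cases
    case 1
    have "((\<lambda>t. 0) has_real_derivative 0) (at t)" by simp
    then have "(flat_exp m has_real_derivative 0) (at t)"
      by (rule has_field_derivative_transform_within_open[where S="{..<0}"]) (use 1 in auto)
    then show ?thesis using 1 by simp
  next
    case 2
    have "(flat_exp m has_real_derivative 0) (at 0)"
      using flat_exp_over_id_tendsto_0[of m] by (simp add: has_field_derivative_iff)
    then show ?thesis using 2 by simp
  next
    case 3
    have "((\<lambda>t. exp (- 1 / t) / t ^ m) has_real_derivative
        ((exp (- 1 / t) * (1 / t\<^sup>2)) * t ^ m - exp (- 1 / t) * (real m * t ^ (m - 1))) / (t ^ m * t ^ m)) (at t)"
      using 3 by (auto intro!: derivative_eq_intros simp: power2_eq_square)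
    moreover have "((exp (- 1 / t) * (1 / t\<^sup>2)) * t ^ m - exp (- 1 / t) * (real m * t ^ (m - 1))) / (t ^ m * t ^ m)
       = flat_exp (m + 2) t - real m * flat_exp (m + 1) t"
      using 3 by (cases m; simp add: flat_exp_def divide_simps power2_eq_square; simp add: algebra_simps)
    ultimately have "((\<lambda>t. exp (- 1 / t) / t ^ m) has_real_derivative
       flat_exp (m + 2) t - real m * flat_exp (m + 1) t) (at t)" by simp
    then show ?thesis
      by (rule has_field_derivative_transform_within_open[where S="{0<..}"]) (use 3 in \<open>auto simp: flat_exp_def\<close>)
  qed
qed

lemma continuous_on_flat_exp: "continuous_on A (flat_exp m)"
  by (meson DERIV_isCont continuous_at_imp_continuous_on flat_exp_has_derivative)

lemma flat_exp_0_bounds: "0 \<le> flat_exp 0 t" "flat_exp 0 t \<le> 1"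
  by (auto simp: flat_exp_def)

text \<open>For \<open>\<rho> > 0\<close> it is positive exactly on the open ball of radius
  \<open>\<rho>\<close> around \<open>c\<close>. The inner product keeps it a polynomial in
  \<open>x\<close>, hence differentiable at the centre as well.\<close>

definition bump_arg :: "real ^ 'n \<Rightarrow> real \<Rightarrow> real ^ 'n \<Rightarrow> real" where
  "bump_arg c \<rho> x = 1 - (x - c) \<bullet> (x - c) / \<rho>\<^sup>2"

text \<open>\<open>smooth\<close> speaks of all iterated partial derivatives, for which closed forms
  would be unwieldy. This class consists of differentiable functions, is closed under
  \<open>partial\<close> and contains the kernel, so smoothness follows by induction on the list of
  coordinates.\<close>

inductive bump_class :: "real ^ 'n \<Rightarrow> real \<Rightarrow> (real ^ 'n \<Rightarrow> real) \<Rightarrow> bool" for c \<rho> where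
  base: "bump_class c \<rho> (\<lambda>x. flat_exp m (bump_arg c \<rho> x))"
| scale: "bump_class c \<rho> f \<Longrightarrow> bump_class c \<rho> (\<lambda>x. a * f x)"
| sum: "bump_class c \<rho> f \<Longrightarrow> bump_class c \<rho> g \<Longrightarrow> bump_class c \<rho> (\<lambda>x. f x + g x)"
| coord: "bump_class c \<rho> f \<Longrightarrow> bump_class c \<rho> (\<lambda>x. (x - c) $ i * f x)"

lemma bump_arg_has_derivative:
  "(bump_arg c \<rho> has_derivative (\<lambda>h. - 2 / \<rho>\<^sup>2 * ((x - c) \<bullet> h))) (at x)"
proof -
  have "((\<lambda>x. 1 - (x - c) \<bullet> (x - c) / \<rho>\<^sup>2) has_derivative (\<lambda>h. 0 - ((x - c) \<bullet> h + h \<bullet> (x - c)) / \<rho>\<^sup>2)) (at x)"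
  proof -
    have v: "((\<lambda>x. x - c) has_derivative (\<lambda>h. h)) (at x)"
      by (auto intro!: derivative_eq_intros)
    show ?thesis
      by (intro has_derivative_diff has_derivative_const
          bounded_linear.has_derivative[OF bounded_linear_divide has_derivative_inner[OF v v]])
  qed
  moreover have "0 - ((x - c) \<bullet> h + h \<bullet> (x - c)) / \<rho>\<^sup>2 = - 2 / \<rho>\<^sup>2 * ((x - c) \<bullet> h)" for h
    by (simp add: inner_commute[of h])
  ultimately show ?thesis unfolding bump_arg_def[abs_def] by (simp only:)
qed

lemma flat_exp_bump_has_derivative:
  "((\<lambda>x. flat_exp m (bump_arg c \<rho> x)) has_derivative
     (\<lambda>h. (flat_exp (m + 2) (bump_arg c \<rho> x) - real m * flat_exp (m + 1) (bump_arg c \<rho> x))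
        * (- 2 / \<rho>\<^sup>2 * ((x - c) \<bullet> h)))) (at x)"
  using has_derivative_compose[OF bump_arg_has_derivative
      flat_exp_has_derivative[unfolded has_field_derivative_def]] by (simp add: mult.commute)

lemma coord_has_derivative:
  fixes c :: "real ^ 'n"
  shows "((\<lambda>x. (x - c) $ i) has_derivative (\<lambda>h. h $ i)) (at x)"
proof -
  have "bounded_linear (\<lambda>h::real^'n. h $ i)" by (rule bounded_linear_vec_nth)
  then have "((\<lambda>x. x $ i - c $ i) has_derivative (\<lambda>h. h $ i - 0)) (at x)"
    by (intro has_derivative_diff bounded_linear_imp_has_derivative has_derivative_const)
  then show ?thesis by simp
qed

lemma bump_class_has_derivative:
  assumes "bump_class c \<rho> f"
  shows "\<exists>D. (\<forall>x. (f has_derivative D x) (at x)) \<and> (\<forall>i. bump_class c \<rho> (\<lambda>x. D x (axis i 1)))"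
  using assms
proof induction
  case (base m)
  have "bump_class c \<rho> (\<lambda>x. (flat_exp (m + 2) (bump_arg c \<rho> x) - real m * flat_exp (m + 1) (bump_arg c \<rho> x))
        * (- 2 / \<rho>\<^sup>2 * ((x - c) \<bullet> axis i 1)))" for i
  proof -
    have "bump_class c \<rho> (\<lambda>x. (- 2 / \<rho>\<^sup>2) * ((x - c) $ i * flat_exp (m + 2) (bump_arg c \<rho> x))
        + (2 * real m / \<rho>\<^sup>2) * ((x - c) $ i * flat_exp (m + 1) (bump_arg c \<rho> x)))"
      by (intro bump_class.intros)
    moreover have "(- 2 / \<rho>\<^sup>2) * ((x - c) $ i * flat_exp (m + 2) (bump_arg c \<rho> x))
        + (2 * real m / \<rho>\<^sup>2) * ((x - c) $ i * flat_exp (m + 1) (bump_arg c \<rho> x))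
       = (flat_exp (m + 2) (bump_arg c \<rho> x) - real m * flat_exp (m + 1) (bump_arg c \<rho> x))
        * (- 2 / \<rho>\<^sup>2 * ((x - c) \<bullet> axis i 1))" for x
      by (simp only: inner_axis) (simp add: divide_inverse algebra_simps)
    ultimately show ?thesis by simp
  qed
  then show ?case
    by (intro exI[of _ "\<lambda>x h. (flat_exp (m + 2) (bump_arg c \<rho> x) - real m * flat_exp (m + 1) (bump_arg c \<rho> x))
        * (- 2 / \<rho>\<^sup>2 * ((x - c) \<bullet> h))"] conjI allI flat_exp_bump_has_derivative)
next
  case (scale f a)
  then obtain D where D: "\<And>x. (f has_derivative D x) (at x)" "\<And>i. bump_class c \<rho> (\<lambda>x. D x (axis i 1))" by blast
  have "((\<lambda>x. a * f x) has_derivative (\<lambda>h. a * D x h)) (at x)" for x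
    by (rule has_derivative_mult_right[OF D(1)])
  moreover have "bump_class c \<rho> (\<lambda>x. a * D x (axis i 1))" for i by (rule bump_class.scale[OF D(2)])
  ultimately show ?case by (intro exI[of _ "\<lambda>x h. a * D x h"]) blast
next
  case (sum f g)
  then obtain D E where D: "\<And>x. (f has_derivative D x) (at x)" "\<And>i. bump_class c \<rho> (\<lambda>x. D x (axis i 1))"
    and E: "\<And>x. (g has_derivative E x) (at x)" "\<And>i. bump_class c \<rho> (\<lambda>x. E x (axis i 1))" by blast
  have "((\<lambda>x. f x + g x) has_derivative (\<lambda>h. D x h + E x h)) (at x)" for x
    by (rule has_derivative_add[OF D(1) E(1)])
  moreover have "bump_class c \<rho> (\<lambda>x. D x (axis i 1) + E x (axis i 1))" for i by (rule bump_class.sum[OF D(2) E(2)])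
  ultimately show ?case by (intro exI[of _ "\<lambda>x h. D x h + E x h"]) blast
next
  case (coord f j)
  then obtain D where D: "\<And>x. (f has_derivative D x) (at x)" "\<And>i. bump_class c \<rho> (\<lambda>x. D x (axis i 1))" by blast
  have "((\<lambda>x. (x - c) $ j * f x) has_derivative (\<lambda>h. (x - c) $ j * D x h + h $ j * f x)) (at x)" for x
    by (rule has_derivative_mult[OF coord_has_derivative D(1)])
  moreover have "bump_class c \<rho> (\<lambda>x. (x - c) $ j * D x (axis i 1) + axis i 1 $ j * f x)" for i
    by (intro bump_class.sum bump_class.coord bump_class.scale D(2) coord.hyps)
  ultimately show ?case by (intro exI[of _ "\<lambda>x h. (x - c) $ j * D x h + h $ j * f x"]) blast
qed

lemma partial_eqI:
  assumes "\<And>x. (f has_derivative D x) (at x)"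
  shows "partial i f = (\<lambda>x. D x (axis i 1))"
  unfolding partial_def[abs_def] by (simp only: frechet_derivative_at[OF assms, symmetric])

lemma bump_class_partial:
  assumes "bump_class c \<rho> f" shows "bump_class c \<rho> (partial i f)"
proof -
  obtain D where D: "\<forall>x. (f has_derivative D x) (at x)" "\<forall>i. bump_class c \<rho> (\<lambda>x. D x (axis i 1))"
    using bump_class_has_derivative[OF assms] by auto
  show ?thesis using D(2) by (simp only: partial_eqI[OF D(1)[rule_format]])
qed

lemma bump_class_smooth:
  assumes "bump_class c \<rho> f" shows "smooth f"
proof -
  have "bump_class c \<rho> (foldr partial is f)" for "is"
    by (induction "is") (auto intro: bump_class_partial assms)
  then show ?thesis unfolding smooth_def differentiable_def
    using bump_class_has_derivative by blast
qed

lemma bump_class_eq_0: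
  assumes "bump_class c \<rho> f" "0 < \<rho>" "\<rho> \<le> norm (x - c)"
  shows "f x = 0"
  using assms(1)
proof induction
  case (base m)
  have "\<rho>\<^sup>2 \<le> (x - c) \<bullet> (x - c)"
    using assms(2,3) by (simp add: dot_square_norm power_mono)
  then have "bump_arg c \<rho> x \<le> 0" using assms(2) by (simp add: bump_arg_def field_simps)
  then show ?case by simp
qed auto

lemma bump_class_test_function:
  assumes f: "bump_class c \<rho> f" and "0 < \<rho>" and sub: "cball c \<rho> \<subseteq> \<Omega>"
  shows "test_function \<Omega> f"
proof -
  have "{x. f x \<noteq> 0} \<subseteq> cball c \<rho>"
    using bump_class_eq_0[OF f \<open>0 < \<rho>\<close>] by (force simp: dist_norm norm_minus_commute)
  then have cl: "closure {x. f x \<noteq> 0} \<subseteq> cball c \<rho>" by (rule closure_minimal) simp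
  then have "compact (closure {x. f x \<noteq> 0})"
    by (meson bounded_cball bounded_subset closed_closure compact_eq_bounded_closed)
  then show ?thesis using cl sub bump_class_smooth[OF f] by (auto simp: test_function_def)
qed

lemma bump_class_continuous: "bump_class c \<rho> f \<Longrightarrow> continuous_on A f"
  using bump_class_has_derivative[of c \<rho> f]
  by (meson continuous_at_imp_continuous_on has_derivative_continuous)

section \<open>A kernel that moves with its centre and radius\<close>

definition bump :: "real ^ 'n \<Rightarrow> real \<Rightarrow> real ^ 'n \<Rightarrow> real" where
  "bump c \<rho> x = flat_exp 0 (bump_arg c \<rho> x) / \<rho> ^ CARD('n)"

text \<open>The time derivative of the kernel \<open>bump (c + \<tau> *\<^sub>R c') (\<rho> + \<tau> * \<rho>')\<close> at \<open>\<tau> = 0\<close>.\<close>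

definition bump_rate :: "real ^ 'n \<Rightarrow> real \<Rightarrow> real ^ 'n \<Rightarrow> real \<Rightarrow> real ^ 'n \<Rightarrow> real" where
  "bump_rate c \<rho> c' \<rho>' x =
     flat_exp 2 (bump_arg c \<rho> x) / \<rho> ^ CARD('n) * (2 * ((x - c) \<bullet> c') / \<rho>\<^sup>2 + 2 * \<rho>' * ((x - c) \<bullet> (x - c)) / \<rho> ^ 3)
     - real CARD('n) * \<rho>' / \<rho> * bump c \<rho> x"

text \<open>The \<open>i\<close>-th component of the kernel times the velocity
  \<open>c' + (\<rho>' / \<rho>) *\<^sub>R (x - c)\<close>, the velocity of the point
  \<open>x\<close> of a ball whose centre and radius change affinely at the rates \<open>c'\<close>
  and \<open>\<rho>'\<close>.\<close>

definition bump_flux :: "real ^ 'n \<Rightarrow> real \<Rightarrow> real ^ 'n \<Rightarrow> real \<Rightarrow> 'n \<Rightarrow> real ^ 'n \<Rightarrow> real" where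
  "bump_flux c \<rho> c' \<rho>' i x = bump c \<rho> x * (c' + (\<rho>' / \<rho>) *\<^sub>R (x - c)) $ i"

lemma bump_flux_class:
  fixes c :: "real ^ 'n"
  shows "bump_class c \<rho> (bump_flux c \<rho> c' \<rho>' i)"
proof -
  have "bump_class c \<rho> (\<lambda>x. (c' $ i / \<rho> ^ CARD('n)) * flat_exp 0 (bump_arg c \<rho> x)
     + (\<rho>' / \<rho> / \<rho> ^ CARD('n)) * ((x - c) $ i * flat_exp 0 (bump_arg c \<rho> x)))"
    by (intro bump_class.intros)
  moreover have "(c' $ i / \<rho> ^ CARD('n)) * flat_exp 0 (bump_arg c \<rho> x)
     + (\<rho>' / \<rho> / \<rho> ^ CARD('n)) * ((x - c) $ i * flat_exp 0 (bump_arg c \<rho> x)) = bump_flux c \<rho> c' \<rho>' i x" for x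
    by (simp add: bump_flux_def bump_def divide_inverse algebra_simps)
  ultimately show ?thesis by simp
qed

text \<open>This is the continuity equation: translation and dilation carry the kernel along as a
  density of constant mass, with the velocity field that appears in \<open>bump_flux\<close>. The
  divergence form is what the definition of the weak gradient can be applied to.\<close>

lemma bump_rate_eq_divergence:
  fixes c :: "real ^ 'n"
  assumes "0 < \<rho>"
  shows "bump_rate c \<rho> c' \<rho>' x = - (\<Sum>i\<in>UNIV. partial i (bump_flux c \<rho> c' \<rho>' i) x)"
proof -
  define P where "P = \<rho> ^ CARD('n)"
  define E2 where "E2 x = flat_exp 2 (bump_arg c \<rho> x)" for x
  have bd: "(bump c \<rho> has_derivative (\<lambda>h. E2 x * (- 2 / \<rho>\<^sup>2 * ((x - c) \<bullet> h)) / P)) (at x)" for x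
    unfolding bump_def[abs_def] P_def[symmetric] E2_def
    using bounded_linear.has_derivative[OF bounded_linear_divide[of P] flat_exp_bump_has_derivative[of 0 c \<rho> x]]
    by (simp add: numeral_2_eq_2)
  have vd: "((\<lambda>x. (c' + (\<rho>' / \<rho>) *\<^sub>R (x - c)) $ i) has_derivative (\<lambda>h. (\<rho>' / \<rho>) * h $ i)) (at x)" for i x
  proof -
    have "((\<lambda>x. c' $ i + (\<rho>' / \<rho>) * (x - c) $ i) has_derivative (\<lambda>h. 0 + (\<rho>' / \<rho>) * h $ i)) (at x)"
      by (intro has_derivative_add has_derivative_const has_derivative_mult_right coord_has_derivative)
    then show ?thesis by simp
  qed
  have "partial i (bump_flux c \<rho> c' \<rho>' i) x
     = bump c \<rho> x * (\<rho>' / \<rho>) + E2 x * (- 2 / \<rho>\<^sup>2 * (x - c) $ i) / P * (c' + (\<rho>' / \<rho>) *\<^sub>R (x - c)) $ i" for i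
  proof -
    have "partial i (bump_flux c \<rho> c' \<rho>' i) = (\<lambda>x. bump c \<rho> x * ((\<rho>' / \<rho>) * axis i 1 $ i)
       + E2 x * (- 2 / \<rho>\<^sup>2 * ((x - c) \<bullet> axis i 1)) / P * (c' + (\<rho>' / \<rho>) *\<^sub>R (x - c)) $ i)"
      unfolding bump_flux_def[abs_def]
      by (rule partial_eqI) (rule has_derivative_mult[OF bd vd])
    moreover have "(x - c) \<bullet> axis i 1 = (x - c) $ i" for x by (simp add: inner_axis)
    moreover have "axis i (1::real) $ i = 1" by (simp add: axis_def)
    ultimately show ?thesis by (simp only: mult_1_right)
  qed
  then have "(\<Sum>i\<in>UNIV. partial i (bump_flux c \<rho> c' \<rho>' i) x)
    = (\<Sum>i\<in>UNIV. bump c \<rho> x * (\<rho>' / \<rho>) + (- 2 * E2 x / (\<rho>\<^sup>2 * P)) * ((x - c) $ i * (c' + (\<rho>' / \<rho>) *\<^sub>R (x - c)) $ i))"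
    by (intro sum.cong) (simp_all add: divide_inverse mult_ac)
  also have "\<dots> = real CARD('n) * (bump c \<rho> x * (\<rho>' / \<rho>))
      + (- 2 * E2 x / (\<rho>\<^sup>2 * P)) * ((x - c) \<bullet> (c' + (\<rho>' / \<rho>) *\<^sub>R (x - c)))"
    by (simp only: sum.distrib sum_distrib_left[symmetric] inner_vec_def inner_real_def sum_constant) simp
  also have "(x - c) \<bullet> (c' + (\<rho>' / \<rho>) *\<^sub>R (x - c)) = (x - c) \<bullet> c' + \<rho>' / \<rho> * ((x - c) \<bullet> (x - c))"
    by (simp only: inner_add_right inner_scaleR_right)
  finally have sum: "(\<Sum>i\<in>UNIV. partial i (bump_flux c \<rho> c' \<rho>' i) x) = real CARD('n) * (bump c \<rho> x * (\<rho>' / \<rho>))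
      + (- 2 * E2 x / (\<rho>\<^sup>2 * P)) * ((x - c) \<bullet> c' + \<rho>' / \<rho> * ((x - c) \<bullet> (x - c)))" .
  have "0 < P" using assms by (simp add: P_def)
  then have "E2 x / P * (2 * A / \<rho>\<^sup>2 + 2 * \<rho>' * B / \<rho> ^ 3) = - ((- 2 * E2 x / (\<rho>\<^sup>2 * P)) * (A + \<rho>' / \<rho> * B))" for A B
    using assms by (simp add: field_simps power2_eq_square power3_eq_cube)
  then show ?thesis unfolding sum bump_rate_def E2_def[symmetric] P_def[symmetric] by simp
qed

lemma bump_has_time_derivative:
  fixes c0 c' x :: "real ^ 'n"
  assumes "0 < \<rho>0 + \<tau> * \<rho>'"
  shows "((\<lambda>\<tau>. bump (c0 + \<tau> *\<^sub>R c') (\<rho>0 + \<tau> * \<rho>') x) has_real_derivative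
     bump_rate (c0 + \<tau> *\<^sub>R c') (\<rho>0 + \<tau> * \<rho>') c' \<rho>' x) (at \<tau>)"
proof -
  define c where "c = c0 + \<tau> *\<^sub>R c'"
  define \<rho> where "\<rho> = \<rho>0 + \<tau> * \<rho>'"
  have rho: "0 < \<rho>" using assms by (simp add: \<rho>_def)
  have d: "((\<lambda>\<tau>. (x - (c0 + \<tau> *\<^sub>R c')) \<bullet> (x - (c0 + \<tau> *\<^sub>R c'))) has_real_derivative - 2 * ((x - c) \<bullet> c')) (at \<tau>)"
  proof -
    have v: "((\<lambda>\<tau>. x - (c0 + \<tau> *\<^sub>R c')) has_derivative (\<lambda>h. - (h *\<^sub>R c'))) (at \<tau>)"
      by (auto intro!: derivative_eq_intros)
    have "((\<lambda>\<tau>. (x - (c0 + \<tau> *\<^sub>R c')) \<bullet> (x - (c0 + \<tau> *\<^sub>R c'))) has_derivative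
       (\<lambda>h. (x - c) \<bullet> - (h *\<^sub>R c') + - (h *\<^sub>R c') \<bullet> (x - c))) (at \<tau>)"
      unfolding c_def by (rule has_derivative_inner[OF v v])
    moreover have "(x - c) \<bullet> - (h *\<^sub>R c') + - (h *\<^sub>R c') \<bullet> (x - c) = - 2 * ((x - c) \<bullet> c') * h" for h
      using inner_commute[of c' "x - c"] by simp
    ultimately show ?thesis unfolding has_field_derivative_def by (simp only:)
  qed
  have r: "((\<lambda>\<tau>. \<rho>0 + \<tau> * \<rho>') has_real_derivative \<rho>') (at \<tau>)"
    by (auto intro!: derivative_eq_intros)
  have r2: "((\<lambda>\<tau>. (\<rho>0 + \<tau> * \<rho>')\<^sup>2) has_real_derivative 2 * \<rho> * \<rho>') (at \<tau>)"
    using DERIV_power[OF r, of 2] by (simp add: \<rho>_def mult_ac)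
  have rN: "((\<lambda>\<tau>. (\<rho>0 + \<tau> * \<rho>') ^ CARD('n)) has_real_derivative real CARD('n) * \<rho>' * \<rho> ^ (CARD('n) - 1)) (at \<tau>)"
    using DERIV_power[OF r, of "CARD('n)"] by (simp add: \<rho>_def mult_ac)
  have "((\<lambda>\<tau>. 1 - (x - (c0 + \<tau> *\<^sub>R c')) \<bullet> (x - (c0 + \<tau> *\<^sub>R c')) / (\<rho>0 + \<tau> * \<rho>')\<^sup>2) has_real_derivative
      0 - ((- 2 * ((x - c) \<bullet> c')) * \<rho>\<^sup>2 - ((x - c) \<bullet> (x - c)) * (2 * \<rho> * \<rho>')) / (\<rho>\<^sup>2 * \<rho>\<^sup>2)) (at \<tau>)"
    using DERIV_diff[OF DERIV_const[of 1] DERIV_divide[OF d r2]] rho by (simp add: c_def \<rho>_def)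
  moreover have "0 - ((- 2 * A) * \<rho>\<^sup>2 - B * (2 * \<rho> * \<rho>')) / (\<rho>\<^sup>2 * \<rho>\<^sup>2) = 2 * A / \<rho>\<^sup>2 + 2 * \<rho>' * B / \<rho> ^ 3" for A B
    using rho by (simp add: field_simps power2_eq_square power3_eq_cube)
  ultimately have a: "((\<lambda>\<tau>. bump_arg (c0 + \<tau> *\<^sub>R c') (\<rho>0 + \<tau> * \<rho>') x) has_real_derivative
      2 * ((x - c) \<bullet> c') / \<rho>\<^sup>2 + 2 * \<rho>' * ((x - c) \<bullet> (x - c)) / \<rho> ^ 3) (at \<tau>)"
    by (simp add: bump_arg_def)
  define G where "G = 2 * ((x - c) \<bullet> c') / \<rho>\<^sup>2 + 2 * \<rho>' * ((x - c) \<bullet> (x - c)) / \<rho> ^ 3"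
  have e: "((\<lambda>\<tau>. flat_exp 0 (bump_arg (c0 + \<tau> *\<^sub>R c') (\<rho>0 + \<tau> * \<rho>') x)) has_real_derivative
      flat_exp 2 (bump_arg c \<rho> x) * G) (at \<tau>)"
    using DERIV_chain2[OF flat_exp_has_derivative[of 0] a] by (simp add: c_def \<rho>_def G_def numeral_2_eq_2)
  have "((\<lambda>\<tau>. bump (c0 + \<tau> *\<^sub>R c') (\<rho>0 + \<tau> * \<rho>') x) has_real_derivative
     (flat_exp 2 (bump_arg c \<rho> x) * G * \<rho> ^ CARD('n) - flat_exp 0 (bump_arg c \<rho> x) * (real CARD('n) * \<rho>' * \<rho> ^ (CARD('n) - 1)))
       / (\<rho> ^ CARD('n) * \<rho> ^ CARD('n))) (at \<tau>)"
    unfolding bump_def[abs_def]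
    using DERIV_divide[OF e rN] rho by (simp add: c_def \<rho>_def)
  moreover have "(F * G * \<rho> ^ CARD('n) - E * (real CARD('n) * \<rho>' * \<rho> ^ (CARD('n) - 1))) / (\<rho> ^ CARD('n) * \<rho> ^ CARD('n))
     = F / \<rho> ^ CARD('n) * G - real CARD('n) * \<rho>' / \<rho> * (E / \<rho> ^ CARD('n))" for F E
  proof -
    have "\<rho> ^ CARD('n) = \<rho> * \<rho> ^ (CARD('n) - 1)" by (simp add: power_eq_if)
    moreover have "0 < \<rho> ^ (CARD('n) - 1)" using rho by simp
    ultimately show ?thesis using rho by (simp add: field_simps)
  qed
  ultimately show ?thesis unfolding bump_rate_def bump_def c_def[symmetric] \<rho>_def[symmetric] G_def[symmetric] by simp
qed

lemma bump_bounds: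
  fixes c :: "real ^ 'n"
  assumes "0 < \<rho>"
  shows "0 \<le> bump c \<rho> x" "bump c \<rho> x \<le> indicator {y. norm (y - c) < \<rho>} x / \<rho> ^ CARD('n)"
proof -
  show "0 \<le> bump c \<rho> x" using assms flat_exp_0_bounds by (simp add: bump_def)
  show "bump c \<rho> x \<le> indicator {y. norm (y - c) < \<rho>} x / \<rho> ^ CARD('n)"
  proof (cases "norm (x - c) < \<rho>")
    case True
    then show ?thesis using assms flat_exp_0_bounds(2) by (simp add: bump_def divide_right_mono)
  next
    case False
    then have "flat_exp 0 (bump_arg c \<rho> x) = 0"
      by (intro bump_class_eq_0[OF bump_class.base assms]) auto
    then show ?thesis using False by (simp add: bump_def)
  qed
qed

text \<open>Functions of the class are bounded, being continuous on a closed ball and zero outside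
  it.\<close>

lemma continuous_bump_class_times_integrable:
  fixes u :: "real ^ 'n \<Rightarrow> real"
  assumes u: "integrable (lebesgue_on \<Omega>) u" and f: "bump_class c \<rho> f" and rho: "0 < \<rho>"
  shows "integrable (lebesgue_on \<Omega>) (\<lambda>x. u x * f x)"
proof -
  have cont: "continuous_on UNIV f" by (rule bump_class_continuous[OF f])
  have "bounded (f ` cball c \<rho>)"
    by (rule compact_imp_bounded[OF compact_continuous_image[OF bump_class_continuous[OF f] compact_cball]])
  then obtain B where "\<forall>z\<in>f ` cball c \<rho>. \<bar>z\<bar> \<le> B" unfolding bounded_real by (rule exE)
  then have B: "\<And>x. x \<in> cball c \<rho> \<Longrightarrow> \<bar>f x\<bar> \<le> B" by (simp only: ball_simps)
  have B0: "0 \<le> B" using B[of c] rho by force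
  have fB: "\<bar>f x\<bar> \<le> B" for x
  proof (cases "x \<in> cball c \<rho>")
    case False
    then have "f x = 0" by (intro bump_class_eq_0[OF f rho]) (auto simp: dist_norm norm_minus_commute)
    then show ?thesis using B0 by simp
  qed (rule B)
  have fm: "f \<in> borel_measurable (lebesgue_on \<Omega>)"
    by (intro measurable_restrict_space1 measurable_completion) (simp add: borel_measurable_continuous_onI cont)
  show ?thesis
  proof (rule Bochner_Integration.integrable_bound)
    show "integrable (lebesgue_on \<Omega>) (\<lambda>x. B * u x)" using u by simp
    show "(\<lambda>x. u x * f x) \<in> borel_measurable (lebesgue_on \<Omega>)"
      using borel_measurable_integrable[OF u] fm by (rule borel_measurable_times)
    show "AE x in lebesgue_on \<Omega>. norm (u x * f x) \<le> norm (B * u x)"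
    proof (rule AE_I2)
      fix x
      have "\<bar>u x\<bar> * \<bar>f x\<bar> \<le> \<bar>u x\<bar> * B" by (intro mult_left_mono fB) simp
      then show "norm (u x * f x) \<le> norm (B * u x)" using B0 by (simp add: abs_mult mult.commute)
    qed
  qed
qed

text \<open>Testing the weak gradient with the components of \<open>bump_flux\<close> turns the
  integral of \<open>u\<close> into one of \<open>g\<close>. On the ball the velocity has norm at
  most \<open>norm c' + \<bar>\<rho>'\<bar>\<close> and the kernel is at most
  \<open>1 / \<rho> ^ CARD('n)\<close>, which cancels the power of \<open>\<rho>\<close> in the
  hypothesis on \<open>Q\<close>.\<close>

lemma weak_gradient_bump_rate:
  fixes u :: "real ^ 'n \<Rightarrow> real" and g :: "real ^ 'n \<Rightarrow> real ^ 'n"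
  assumes wg: "has_weak_gradient \<Omega> u g" and u: "integrable (lebesgue_on \<Omega>) u" and g: "integrable (lebesgue_on \<Omega>) g"
    and rho: "0 < \<rho>" and sub: "cball c \<rho> \<subseteq> \<Omega>"
    and Q: "(LINT y|lebesgue_on \<Omega>. norm (g y) * indicator {y. norm (y - c) < \<rho>} y) \<le> Q * \<rho> ^ CARD('n)"
  shows "\<bar>LINT y|lebesgue_on \<Omega>. u y * bump_rate c \<rho> c' \<rho>' y\<bar> \<le> (norm c' + \<bar>\<rho>'\<bar>) * Q"
proof -
  have gi: "integrable (lebesgue_on \<Omega>) (\<lambda>y. g y $ i)" for i
    using integrable_bounded_linear[OF bounded_linear_vec_nth g] .
  have 1: "integrable (lebesgue_on \<Omega>) (\<lambda>y. u y * partial i (bump_flux c \<rho> c' \<rho>' i) y)" for i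
    by (rule continuous_bump_class_times_integrable[OF u bump_class_partial[OF bump_flux_class] rho])
  have 2: "integrable (lebesgue_on \<Omega>) (\<lambda>y. g y $ i * bump_flux c \<rho> c' \<rho>' i y)" for i
    by (rule continuous_bump_class_times_integrable[OF gi bump_flux_class rho])
  have "(LINT y|lebesgue_on \<Omega>. u y * bump_rate c \<rho> c' \<rho>' y)
     = (LINT y|lebesgue_on \<Omega>. - (\<Sum>i\<in>UNIV. u y * partial i (bump_flux c \<rho> c' \<rho>' i) y))"
    by (simp only: bump_rate_eq_divergence[OF rho] sum_distrib_left mult_minus_right)
  also have "\<dots> = - (\<Sum>i\<in>UNIV. LINT y|lebesgue_on \<Omega>. u y * partial i (bump_flux c \<rho> c' \<rho>' i) y)"
    using 1 by (simp add: Bochner_Integration.integral_sum)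
  also have "\<dots> = (\<Sum>i\<in>UNIV. LINT y|lebesgue_on \<Omega>. g y $ i * bump_flux c \<rho> c' \<rho>' i y)"
  proof -
    have "(LINT y|lebesgue_on \<Omega>. u y * partial i (bump_flux c \<rho> c' \<rho>' i) y)
       = - (LINT y|lebesgue_on \<Omega>. g y $ i * bump_flux c \<rho> c' \<rho>' i y)" for i
      using wg bump_class_test_function[OF bump_flux_class rho sub] unfolding has_weak_gradient_def by simp
    then show ?thesis by (simp add: sum_negf)
  qed
  also have "\<dots> = (LINT y|lebesgue_on \<Omega>. (\<Sum>i\<in>UNIV. g y $ i * bump_flux c \<rho> c' \<rho>' i y))"
    using 2 by (simp add: Bochner_Integration.integral_sum)
  finally have eq: "(LINT y|lebesgue_on \<Omega>. u y * bump_rate c \<rho> c' \<rho>' y)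
     = (LINT y|lebesgue_on \<Omega>. (\<Sum>i\<in>UNIV. g y $ i * bump_flux c \<rho> c' \<rho>' i y))" .
  define A where "A = (norm c' + \<bar>\<rho>'\<bar>) / \<rho> ^ CARD('n)"
  have A: "0 \<le> A" using rho by (simp add: A_def)
  have ball: "{y. norm (y - c) < \<rho>} = ball c \<rho>" by (auto simp: dist_norm norm_minus_commute)
  have "\<Omega> \<inter> ball c \<rho> = ball c \<rho>" using sub ball_subset_cball by blast
  have indm: "(indicator {y. norm (y - c) < \<rho>} :: _ \<Rightarrow> real) \<in> borel_measurable (lebesgue_on \<Omega>)"
    unfolding ball by (intro measurable_restrict_space1 measurable_completion borel_measurable_indicator) simp
  have gind: "integrable (lebesgue_on \<Omega>) (\<lambda>y. norm (g y) * indicator {y. norm (y - c) < \<rho>} y)"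
  proof (rule Bochner_Integration.integrable_bound)
    show "integrable (lebesgue_on \<Omega>) (\<lambda>y. norm (g y))" using g by simp
    show "(\<lambda>y. norm (g y) * indicator {y. norm (y - c) < \<rho>} y) \<in> borel_measurable (lebesgue_on \<Omega>)"
      using borel_measurable_integrable[OF g] indm by measurable
    show "AE y in lebesgue_on \<Omega>. norm (norm (g y) * indicator {y. norm (y - c) < \<rho>} y) \<le> norm (norm (g y))"
      by (rule AE_I2) (simp split: split_indicator)
  qed
  have "\<bar>LINT y|lebesgue_on \<Omega>. u y * bump_rate c \<rho> c' \<rho>' y\<bar>
    \<le> (LINT y|lebesgue_on \<Omega>. \<bar>\<Sum>i\<in>UNIV. g y $ i * bump_flux c \<rho> c' \<rho>' i y\<bar>)"
    unfolding eq by (rule integral_abs_bound)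
  also have "\<dots> \<le> (LINT y|lebesgue_on \<Omega>. A * (norm (g y) * indicator {y. norm (y - c) < \<rho>} y))"
  proof (rule integral_mono)
    show "integrable (lebesgue_on \<Omega>) (\<lambda>y. \<bar>\<Sum>i\<in>UNIV. g y $ i * bump_flux c \<rho> c' \<rho>' i y\<bar>)"
      using 2 by (intro integrable_abs Bochner_Integration.integrable_sum)
    show "integrable (lebesgue_on \<Omega>) (\<lambda>y. A * (norm (g y) * indicator {y. norm (y - c) < \<rho>} y))"
      using gind by simp
    fix y
    define v where "v = c' + (\<rho>' / \<rho>) *\<^sub>R (y - c)"
    have "(\<Sum>i\<in>UNIV. g y $ i * bump_flux c \<rho> c' \<rho>' i y) = bump c \<rho> y * (g y \<bullet> v)"
      by (simp add: bump_flux_def v_def inner_vec_def sum_distrib_left mult_ac)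
    then have "\<bar>\<Sum>i\<in>UNIV. g y $ i * bump_flux c \<rho> c' \<rho>' i y\<bar> = bump c \<rho> y * \<bar>g y \<bullet> v\<bar>"
      using bump_bounds(1)[OF rho, of c y] by (simp only: abs_mult abs_of_nonneg)
    also have "\<dots> \<le> A * (norm (g y) * indicator {y. norm (y - c) < \<rho>} y)"
    proof (cases "norm (y - c) < \<rho>")
      case True
      have "norm v \<le> norm c' + \<bar>\<rho>'\<bar> / \<rho> * norm (y - c)"
        unfolding v_def using norm_triangle_ineq[of c' "(\<rho>' / \<rho>) *\<^sub>R (y - c)"] rho by simp
      also have "\<bar>\<rho>'\<bar> / \<rho> * norm (y - c) \<le> \<bar>\<rho>'\<bar> / \<rho> * \<rho>" using True rho by (intro mult_left_mono) auto
      finally have v: "norm v \<le> norm c' + \<bar>\<rho>'\<bar>" using rho by simp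
      have "bump c \<rho> y * \<bar>g y \<bullet> v\<bar> \<le> (1 / \<rho> ^ CARD('n)) * (norm (g y) * norm v)"
        using bump_bounds[OF rho, of c y] True rho by (intro mult_mono Cauchy_Schwarz_ineq2) auto
      also have "\<dots> \<le> (1 / \<rho> ^ CARD('n)) * (norm (g y) * (norm c' + \<bar>\<rho>'\<bar>))"
        using rho v by (intro mult_left_mono) auto
      finally show ?thesis using True by (simp add: A_def mult_ac)
    next
      case False
      then have "bump c \<rho> y = 0" using bump_bounds[OF rho, of c y] by simp
      then show ?thesis using False by simp
    qed
    finally show "\<bar>\<Sum>i\<in>UNIV. g y $ i * bump_flux c \<rho> c' \<rho>' i y\<bar> \<le> A * (norm (g y) * indicator {y. norm (y - c) < \<rho>} y)" .
  qed
  also have "\<dots> = A * (LINT y|lebesgue_on \<Omega>. norm (g y) * indicator {y. norm (y - c) < \<rho>} y)" by simp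
  also have "\<dots> \<le> A * (Q * \<rho> ^ CARD('n))" by (intro mult_left_mono Q A)
  also have "\<dots> = (norm c' + \<bar>\<rho>'\<bar>) * Q" using rho by (simp add: A_def)
  finally show ?thesis .
qed

lemma continuous_on_bump_rate_path:
  fixes c0 c' :: "real ^ 'n"
  assumes pos: "\<And>\<tau>. \<tau> \<in> I \<Longrightarrow> 0 < \<rho>0 + \<tau> * \<rho>'"
  shows "continuous_on (I \<times> UNIV) (\<lambda>z. bump_rate (c0 + fst z *\<^sub>R c') (\<rho>0 + fst z * \<rho>') c' \<rho>' (snd z))"
proof -
  have ne: "\<rho>0 + fst z * \<rho>' \<noteq> 0" if "z \<in> I \<times> (UNIV :: (real ^ 'n) set)" for z using that pos[of "fst z"] by auto
  have a: "continuous_on (I \<times> UNIV) (\<lambda>z. bump_arg (c0 + fst z *\<^sub>R c') (\<rho>0 + fst z * \<rho>') (snd z))"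
    unfolding bump_arg_def using ne by (intro continuous_intros) auto
  have f: "continuous_on (I \<times> UNIV) (\<lambda>z. flat_exp m (bump_arg (c0 + fst z *\<^sub>R c') (\<rho>0 + fst z * \<rho>') (snd z)))" for m
    by (rule continuous_on_compose2[OF continuous_on_flat_exp a subset_UNIV])
  show ?thesis unfolding bump_rate_def bump_def
    using ne by (intro continuous_intros f) auto
qed

theorem bump_average_path:
  fixes u :: "real ^ 'n \<Rightarrow> real" and g :: "real ^ 'n \<Rightarrow> real ^ 'n"
  assumes wg: "has_weak_gradient \<Omega> u g" and u: "integrable (lebesgue_on \<Omega>) u" and g: "integrable (lebesgue_on \<Omega>) g"
    and bdd: "bounded \<Omega>"
    and rho: "\<And>\<tau>. 0 \<le> \<tau> \<Longrightarrow> \<tau> \<le> 1 \<Longrightarrow> 0 < \<rho>0 + \<tau> * \<rho>'"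
    and sub: "\<And>\<tau>. 0 \<le> \<tau> \<Longrightarrow> \<tau> \<le> 1 \<Longrightarrow> cball (c0 + \<tau> *\<^sub>R c') (\<rho>0 + \<tau> * \<rho>') \<subseteq> \<Omega>"
    and Q: "\<And>\<tau>. 0 \<le> \<tau> \<Longrightarrow> \<tau> \<le> 1 \<Longrightarrow>
      (LINT y|lebesgue_on \<Omega>. norm (g y) * indicator {y. norm (y - (c0 + \<tau> *\<^sub>R c')) < \<rho>0 + \<tau> * \<rho>'} y)
        \<le> Q * (\<rho>0 + \<tau> * \<rho>') ^ CARD('n)"
  shows "\<bar>(LINT y|lebesgue_on \<Omega>. u y * bump (c0 + c') (\<rho>0 + \<rho>') y) - (LINT y|lebesgue_on \<Omega>. u y * bump c0 \<rho>0 y)\<bar>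
    \<le> (norm c' + \<bar>\<rho>'\<bar>) * Q"
proof -
  define b where "b \<tau> y = bump (c0 + \<tau> *\<^sub>R c') (\<rho>0 + \<tau> * \<rho>') y" for \<tau> y
  define b' where "b' \<tau> y = bump_rate (c0 + \<tau> *\<^sub>R c') (\<rho>0 + \<tau> * \<rho>') c' \<rho>' y" for \<tau> y
  define F where "F \<tau> = (LINT y|lebesgue_on \<Omega>. u y * b \<tau> y)" for \<tau>
  define F' where "F' \<tau> = (LINT y|lebesgue_on \<Omega>. u y * b' \<tau> y)" for \<tau>
  have pos: "0 < \<rho>0 + \<tau> * \<rho>'" if "\<tau> \<in> {0..1}" for \<tau> using that rho by auto
  have comp: "compact ({0..1::real} \<times> closure \<Omega>)"
    using bdd by (intro compact_Times compact_Icc) (simp add: compact_closure)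
  have "continuous_on ({0..1} \<times> closure \<Omega>) (\<lambda>z. b' (fst z) (snd z))"
    unfolding b'_def by (rule continuous_on_subset[OF continuous_on_bump_rate_path[OF pos, of "{0..1}"]]) auto
  then have "bounded ((\<lambda>z. b' (fst z) (snd z)) ` ({0..1} \<times> closure \<Omega>))"
    using comp by (intro compact_imp_bounded compact_continuous_image)
  then obtain B where "\<forall>z\<in>(\<lambda>z. b' (fst z) (snd z)) ` ({0..1} \<times> closure \<Omega>). \<bar>z\<bar> \<le> B"
    unfolding bounded_real by (rule exE)
  then have B: "\<And>\<tau> y. \<tau> \<in> {0..1} \<Longrightarrow> y \<in> closure \<Omega> \<Longrightarrow> \<bar>b' \<tau> y\<bar> \<le> B" by auto
  have deriv: "((\<lambda>\<tau>. b \<tau> y) has_real_derivative b' \<tau> y) (at \<tau>)" if "\<tau> \<in> {0..1}" for \<tau> y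
    unfolding b_def b'_def by (rule bump_has_time_derivative[OF pos[OF that]])
  \<comment> \<open>The time derivative is bounded on the compact set
    \<open>{0..1} \<times> closure \<Omega>\<close>, so the difference quotients, multiplied by
    \<open>u\<close>, are dominated by the integrable function
    \<open>B * \<bar>u y\<bar>\<close>.\<close>
  have lip: "\<bar>b \<sigma> y - b \<tau> y\<bar> \<le> B * \<bar>\<sigma> - \<tau>\<bar>" if "\<sigma> \<in> {0..1}" "\<tau> \<in> {0..1}" "y \<in> \<Omega>" for \<sigma> \<tau> y
  proof -
    have "norm (b \<sigma> y - b \<tau> y) \<le> B * norm (\<sigma> - \<tau>)"
    proof (rule field_differentiable_bound[of "{0..1}" "\<lambda>\<tau>. b \<tau> y" "\<lambda>\<tau>. b' \<tau> y"])
      show "((\<lambda>\<tau>. b \<tau> y) has_field_derivative b' z y) (at z within {0..1})" if "z \<in> {0..1}" for z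
        using deriv[OF that] by (rule has_field_derivative_at_within)
      show "norm (b' z y) \<le> B" if "z \<in> {0..1}" for z
        using B[OF that] \<open>y \<in> \<Omega>\<close> closure_subset by auto
    qed (use that in auto)
    then show ?thesis by simp
  qed
  have bi: "integrable (lebesgue_on \<Omega>) (\<lambda>y. u y * b \<tau> y)" if "\<tau> \<in> {0..1}" for \<tau>
  proof -
    have "integrable (lebesgue_on \<Omega>) (\<lambda>y. u y * flat_exp 0 (bump_arg (c0 + \<tau> *\<^sub>R c') (\<rho>0 + \<tau> * \<rho>') y))"
      by (rule continuous_bump_class_times_integrable[OF u bump_class.base pos[OF that]])
    then have "integrable (lebesgue_on \<Omega>) (\<lambda>y. (u y * flat_exp 0 (bump_arg (c0 + \<tau> *\<^sub>R c') (\<rho>0 + \<tau> * \<rho>') y)) / (\<rho>0 + \<tau> * \<rho>') ^ CARD('n))"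
      by simp
    then show ?thesis by (simp add: b_def bump_def)
  qed
  have b'm: "b' \<tau> \<in> borel_measurable (lebesgue_on \<Omega>)" if "\<tau> \<in> {0..1}" for \<tau>
  proof -
    have "continuous_on UNIV (\<lambda>y. bump_rate (c0 + fst (\<tau>, y) *\<^sub>R c') (\<rho>0 + fst (\<tau>, y) * \<rho>') c' \<rho>' (snd (\<tau>, y)))"
      by (rule continuous_on_compose2[OF continuous_on_bump_rate_path[OF pos, of "{0..1}"], where f="\<lambda>y. (\<tau>, y)"])
        (use that in \<open>auto intro!: continuous_intros\<close>)
    then have "continuous_on UNIV (b' \<tau>)" by (simp add: b'_def[abs_def])
    then show ?thesis
      by (intro measurable_restrict_space1 measurable_completion) (simp add: borel_measurable_continuous_onI)
  qed
  have Fderiv: "(F has_field_derivative F' \<tau>) (at \<tau> within {0..1})" if t: "\<tau> \<in> {0..1}" for \<tau>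
    unfolding has_field_derivative_iff tendsto_at_iff_sequentially comp_def
  proof (intro allI impI)
    fix X :: "nat \<Rightarrow> real" assume X: "\<forall>i. X i \<in> {0..1} - {\<tau>}" "X \<longlonglongrightarrow> \<tau>"
    have Xi: "X i \<in> {0..1}" "X i \<noteq> \<tau>" for i using X(1) by auto
    have "(\<lambda>i. LINT y|lebesgue_on \<Omega>. u y * ((b (X i) y - b \<tau> y) / (X i - \<tau>))) \<longlonglongrightarrow> F' \<tau>"
      unfolding F'_def
    proof (rule integral_dominated_convergence)
      show "(\<lambda>y. u y * b' \<tau> y) \<in> borel_measurable (lebesgue_on \<Omega>)"
        by (intro borel_measurable_times borel_measurable_integrable[OF u] b'm t)
      show "integrable (lebesgue_on \<Omega>) (\<lambda>y. B * \<bar>u y\<bar>)" using u by simp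
      show "(\<lambda>y. u y * ((b (X i) y - b \<tau> y) / (X i - \<tau>))) \<in> borel_measurable (lebesgue_on \<Omega>)" for i
      proof -
        have "(\<lambda>y. (u y * b (X i) y - u y * b \<tau> y) / (X i - \<tau>)) \<in> borel_measurable (lebesgue_on \<Omega>)"
          using borel_measurable_integrable[OF bi[OF Xi(1)]] borel_measurable_integrable[OF bi[OF t]] by measurable
        then show ?thesis by (simp add: right_diff_distrib)
      qed
      show "AE y in lebesgue_on \<Omega>. (\<lambda>i. u y * ((b (X i) y - b \<tau> y) / (X i - \<tau>))) \<longlonglongrightarrow> u y * b' \<tau> y"
      proof (rule AE_I2)
        fix y
        have "((\<lambda>\<sigma>. (b \<sigma> y - b \<tau> y) / (\<sigma> - \<tau>)) \<longlongrightarrow> b' \<tau> y) (at \<tau>)"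
          using deriv[OF t] by (simp add: has_field_derivative_iff)
        then have "(\<lambda>i. (b (X i) y - b \<tau> y) / (X i - \<tau>)) \<longlonglongrightarrow> b' \<tau> y"
          using X(2) Xi(2) unfolding tendsto_at_iff_sequentially comp_def by auto
        then show "(\<lambda>i. u y * ((b (X i) y - b \<tau> y) / (X i - \<tau>))) \<longlonglongrightarrow> u y * b' \<tau> y"
          by (rule tendsto_mult_left)
      qed
      show "AE y in lebesgue_on \<Omega>. norm (u y * ((b (X i) y - b \<tau> y) / (X i - \<tau>))) \<le> B * \<bar>u y\<bar>" for i
      proof (rule AE_I2)
        fix y assume "y \<in> space (lebesgue_on \<Omega>)"
        then have "y \<in> \<Omega>" by simp
        then have "\<bar>b (X i) y - b \<tau> y\<bar> \<le> B * \<bar>X i - \<tau>\<bar>" by (rule lip[OF Xi(1) t])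
        then have "\<bar>(b (X i) y - b \<tau> y) / (X i - \<tau>)\<bar> \<le> B" using Xi(2)[of i] by (simp add: abs_divide divide_le_eq)
        then have "\<bar>u y\<bar> * \<bar>(b (X i) y - b \<tau> y) / (X i - \<tau>)\<bar> \<le> \<bar>u y\<bar> * B" by (intro mult_left_mono) auto
        then show "norm (u y * ((b (X i) y - b \<tau> y) / (X i - \<tau>))) \<le> B * \<bar>u y\<bar>"
          by (simp only: real_norm_def abs_mult mult.commute)
      qed
    qed
    moreover have "(LINT y|lebesgue_on \<Omega>. u y * ((b (X i) y - b \<tau> y) / (X i - \<tau>))) = (F (X i) - F \<tau>) / (X i - \<tau>)" for i
    proof -
      have "(LINT y|lebesgue_on \<Omega>. u y * ((b (X i) y - b \<tau> y) / (X i - \<tau>)))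
        = (LINT y|lebesgue_on \<Omega>. (u y * b (X i) y - u y * b \<tau> y) / (X i - \<tau>))"
        by (simp add: right_diff_distrib)
      also have "\<dots> = (F (X i) - F \<tau>) / (X i - \<tau>)"
        unfolding F_def using bi[OF Xi(1)] bi[OF t] by simp
      finally show ?thesis .
    qed
    ultimately show "(\<lambda>i. (F (X i) - F \<tau>) / (X i - \<tau>)) \<longlonglongrightarrow> F' \<tau>" by (simp only:)
  qed
  have "norm (F 1 - F 0) \<le> ((norm c' + \<bar>\<rho>'\<bar>) * Q) * norm (1 - (0::real))"
  proof (rule field_differentiable_bound[of "{0..1}" F F'])
    show "norm (F' z) \<le> (norm c' + \<bar>\<rho>'\<bar>) * Q" if "z \<in> {0..1}" for z
      unfolding F'_def b'_def real_norm_def using that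
      by (intro weak_gradient_bump_rate[OF wg u g] rho sub Q) auto
  qed (use Fderiv in auto)
  then show ?thesis by (simp add: F_def b_def)
qed

section \<open>Mass of the kernel and Lebesgue points\<close>

definition bump_mass :: "'n::finite itself \<Rightarrow> real" where
  "bump_mass _ = (LINT x|lborel. bump (0 :: real ^ 'n) 1 x)"

lemma bump_borel_measurable:
  fixes c :: "real ^ 'n"
  shows "bump c \<rho> \<in> borel_measurable borel"
proof -
  have "continuous_on UNIV (\<lambda>x. flat_exp 0 (bump_arg c \<rho> x))"
    by (rule bump_class_continuous[OF bump_class.base])
  then have "(\<lambda>x. flat_exp 0 (bump_arg c \<rho> x)) \<in> borel_measurable borel"
    by (rule borel_measurable_continuous_onI)
  then show ?thesis unfolding bump_def[abs_def] by measurable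
qed

lemma integrable_bump:
  fixes c :: "real ^ 'n"
  assumes rho: "0 < \<rho>"
  shows "integrable lborel (bump c \<rho>)"
proof (rule Bochner_Integration.integrable_bound)
  have eq: "{y. norm (y - c) < \<rho>} = ball c \<rho>" by (auto simp: dist_norm norm_minus_commute)
  have "emeasure lborel (ball c \<rho>) < \<infinity>" using rho by (simp add: emeasure_ball)
  then show "integrable lborel (\<lambda>x. indicator {y. norm (y - c) < \<rho>} x / \<rho> ^ CARD('n))"
    unfolding eq by (intro integrable_divide integrable_real_indicator) auto
  show "bump c \<rho> \<in> borel_measurable lborel" using bump_borel_measurable by simp
  show "AE x in lborel. norm (bump c \<rho> x) \<le> norm (indicator {y. norm (y - c) < \<rho>} x / \<rho> ^ CARD('n))"
  proof (rule AE_I2)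
    fix x
    show "norm (bump c \<rho> x) \<le> norm (indicator {y. norm (y - c) < \<rho>} x / \<rho> ^ CARD('n))"
      using bump_bounds[OF rho, of c x] by (simp only: real_norm_def)
  qed
qed

text \<open>The factor \<open>1 / \<rho> ^ CARD('n)\<close> in the kernel compensates the Jacobian
  of the affine map from the unit ball. The mass is not normalised to one; its positivity suffices,
  as it is divided out at the end.\<close>

lemma integral_bump:
  fixes c :: "real ^ 'n"
  assumes rho: "0 < \<rho>"
  shows "(LINT x|lborel. bump c \<rho> x) = bump_mass TYPE('n)"
proof -
  have m[measurable]: "bump c \<rho> \<in> borel_measurable borel" by (rule bump_borel_measurable)
  have "(LINT x|lborel. bump c \<rho> x)
     = (LINT x|density (distr lborel borel (\<lambda>x. c + \<rho> *\<^sub>R x)) (\<lambda>_. \<bar>\<rho>\<bar> ^ DIM(real ^ 'n)). bump c \<rho> x)"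
    using rho by (subst lborel_affine[of \<rho> c, symmetric]) auto
  also have "\<dots> = (LINT x|distr lborel borel (\<lambda>x. c + \<rho> *\<^sub>R x). \<bar>\<rho>\<bar> ^ DIM(real ^ 'n) *\<^sub>R bump c \<rho> x)"
    by (rule integral_density) auto
  also have "\<dots> = (LINT x|lborel. \<bar>\<rho>\<bar> ^ DIM(real ^ 'n) *\<^sub>R bump c \<rho> (c + \<rho> *\<^sub>R x))"
    by (rule integral_distr) measurable
  finally have eq: "(LINT x|lborel. bump c \<rho> x) = (LINT x|lborel. \<bar>\<rho>\<bar> ^ DIM(real ^ 'n) *\<^sub>R bump c \<rho> (c + \<rho> *\<^sub>R x))" .
  have pt: "\<bar>\<rho>\<bar> ^ DIM(real ^ 'n) *\<^sub>R bump c \<rho> (c + \<rho> *\<^sub>R x) = bump 0 1 x" for x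
    using rho by (simp add: bump_def bump_arg_def power2_eq_square)
  show ?thesis unfolding eq pt bump_mass_def ..
qed

text \<open>On the ball of radius one half the argument of the flat function is at least
  \<open>1/2\<close>, so the kernel is at least \<open>exp (-2)\<close> there.\<close>

lemma bump_mass_pos: "0 < bump_mass TYPE('n::finite)"
proof -
  have b1: "bump (0 :: real ^ 'n) 1 x = flat_exp 0 (1 - x \<bullet> x)" for x by (simp add: bump_def bump_arg_def)
  have low: "exp (-2) * indicator (ball 0 (1/2)) x \<le> bump (0 :: real ^ 'n) 1 x" for x
  proof (cases "norm x < 1/2")
    case True
    then have "norm x * norm x \<le> 1/2 * (1/2)" by (intro mult_mono) auto
    then have xx: "1/2 \<le> 1 - x \<bullet> x" by (simp add: dot_square_norm power2_eq_square)
    have "exp (- 2) \<le> exp (- 1 / (1 - x \<bullet> x))" using xx by (simp add: divide_simps)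
    then show ?thesis using True xx by (simp add: b1 flat_exp_def)
  next
    case False
    then show ?thesis using bump_bounds(1)[of 1 0 x] by simp
  qed
  have fin: "emeasure lborel (ball (0 :: real ^ 'n) (1/2)) < \<infinity>" by (simp add: emeasure_ball)
  have "0 < exp (-2) * measure lborel (ball (0 :: real ^ 'n) (1/2))"
    by (simp add: content_ball)
  also have "\<dots> = (LINT x|lborel. exp (-2) * indicator (ball (0 :: real ^ 'n) (1/2)) x)" by simp
  also have "\<dots> \<le> (LINT x|lborel. bump (0 :: real ^ 'n) 1 x)"
    using fin low by (intro integral_mono integrable_mult_right integrable_real_indicator integrable_bump) auto
  finally show ?thesis by (simp add: bump_mass_def)
qed

lemma integral_bump_lebesgue_on:
  fixes c :: "real ^ 'n"
  assumes rho: "0 < \<rho>" and sub: "ball c \<rho> \<subseteq> \<Omega>" and \<Omega>: "\<Omega> \<in> sets lebesgue"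
  shows "(LINT x|lebesgue_on \<Omega>. bump c \<rho> x) = bump_mass TYPE('n)"
    and "integrable (lebesgue_on \<Omega>) (bump c \<rho>)"
proof -
  have z: "indicator \<Omega> x *\<^sub>R bump c \<rho> x = bump c \<rho> x" for x
  proof (cases "x \<in> \<Omega>")
    case False
    then have "x \<notin> ball c \<rho>" using sub by blast
    then have "bump c \<rho> x = 0" using bump_bounds[OF rho, of c x] by (simp add: dist_norm norm_minus_commute)
    then show ?thesis by simp
  qed simp
  have bm: "bump c \<rho> \<in> borel_measurable lborel" using bump_borel_measurable by simp
  have "(LINT x|lebesgue_on \<Omega>. bump c \<rho> x) = (LINT x|lebesgue. indicator \<Omega> x *\<^sub>R bump c \<rho> x)"
    using \<Omega> by (intro integral_restrict_space) simp
  also have "\<dots> = (LINT x|lborel. bump c \<rho> x)" unfolding z by (rule integral_completion[OF bm])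
  finally show "(LINT x|lebesgue_on \<Omega>. bump c \<rho> x) = bump_mass TYPE('n)" by (simp add: integral_bump[OF rho])
  have "integrable lebesgue (bump c \<rho>)" using integrable_bump[OF rho, of c] integrable_completion[OF bm] by simp
  then show "integrable (lebesgue_on \<Omega>) (bump c \<rho>)"
    using \<Omega> integrable_restrict_space[of \<Omega> lebesgue "bump c \<rho>"] by (simp add: z[unfolded real_scaleR_def])
qed

text \<open>The differentiation theorem for cubes with lower corner \<open>x\<close> is applied to
  \<open>\<bar>v y - q\<bar>\<close> for every rational \<open>q\<close>, and the countably many
  exceptional sets are united. Outside of them a rational close to \<open>u x\<close> controls the
  mean deviation of \<open>u\<close> from \<open>u x\<close> itself, which is more than convergence
  of the averages of \<open>u\<close>.\<close>

lemma lebesgue_corner_points: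
  fixes u :: "'a::euclidean_space \<Rightarrow> real"
  assumes u: "integrable (lebesgue_on S) u" and S: "S \<in> sets lebesgue"
  obtains Z where "Z \<in> null_sets lebesgue"
    "\<And>x e. x \<in> S - Z \<Longrightarrow> 0 < e \<Longrightarrow> \<exists>d>0. \<forall>h. 0 < h \<longrightarrow> h < d \<longrightarrow> cbox x (x + h *\<^sub>R One) \<subseteq> S \<longrightarrow>
       (LINT y|lebesgue_on S. \<bar>u y - u x\<bar> * indicator (cbox x (x + h *\<^sub>R One)) y) \<le> e * h ^ DIM('a)"
proof -
  define v where "v y = (if y \<in> S then u y else 0)" for y
  have vi: "integrable lebesgue v"
  proof -
    have "integrable lebesgue (\<lambda>x. indicator S x *\<^sub>R u x)" using u S by (subst (asm) integrable_restrict_space) auto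
    moreover have "(\<lambda>x. indicator S x *\<^sub>R u x) = v" by (auto simp: v_def split: split_indicator)
    ultimately show ?thesis by simp
  qed
  have ci: "set_integrable lebesgue (cbox a b) (\<lambda>y. \<bar>v y - q\<bar>)" for a b :: 'a and q
  proof -
    have "set_integrable lebesgue (cbox a b) v"
      unfolding set_integrable_def by (rule integrable_mult_indicator[OF _ vi]) (auto intro: fmeasurableD)
    moreover have "set_integrable lebesgue (cbox a b) (\<lambda>y. q)"
      unfolding set_integrable_def by (intro integrable_scaleR_left integrable_real_indicator) (auto intro: fmeasurableD simp: emeasure_lborel_cbox_eq)
    ultimately show ?thesis by (intro set_integrable_abs set_integral_diff(1))
  qed
  have "\<exists>Z. negligible Z \<and> (\<forall>x e. x \<notin> Z \<longrightarrow> 0 < e \<longrightarrow> (\<exists>d>0. \<forall>h. 0 < h \<and> h < d \<longrightarrow>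
      norm (integral (cbox x (x + h *\<^sub>R One)) (\<lambda>y. \<bar>v y - q\<bar>) /\<^sub>R h ^ DIM('a) - \<bar>v x - q\<bar>) < e))" for q
  proof -
    have int: "(\<lambda>y. \<bar>v y - q\<bar>) integrable_on cbox a b" for a b
      by (rule set_lebesgue_integral_eq_integral(1)[OF ci])
    show ?thesis
    proof (rule integrable_ccontinuous_explicit[OF int])
      fix Z assume Z: "negligible Z" and lim: "\<And>x e. x \<notin> Z \<Longrightarrow> 0 < e \<Longrightarrow> \<exists>d>0. \<forall>h. 0 < h \<and> h < d \<longrightarrow>
        norm (integral (cbox x (x + h *\<^sub>R One)) (\<lambda>y. \<bar>v y - q\<bar>) /\<^sub>R h ^ DIM('a) - \<bar>v x - q\<bar>) < e"
      then show ?thesis by (intro exI[of _ Z] conjI allI impI)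
    qed
  qed
  then obtain Z where Z: "\<And>q. negligible (Z q)"
    "\<And>q x e. x \<notin> Z q \<Longrightarrow> 0 < e \<Longrightarrow> \<exists>d>0. \<forall>h. 0 < h \<and> h < d \<longrightarrow>
      norm (integral (cbox x (x + h *\<^sub>R One)) (\<lambda>y. \<bar>v y - q\<bar>) /\<^sub>R h ^ DIM('a) - \<bar>v x - q\<bar>) < e"
    by metis
  have "Z q \<in> null_sets lebesgue" for q using Z(1) by (simp add: negligible_iff_null_sets)
  then have null: "(\<Union>q\<in>\<rat>. Z q) \<in> null_sets lebesgue" by (intro null_sets_UN' countable_rat)
  show ?thesis
  proof (rule that[OF null])
    fix x e assume x: "x \<in> S - (\<Union>q\<in>\<rat>. Z q)" and e: "0 < (e::real)"
    \<comment> \<open>With \<open>q\<close> within \<open>e/4\<close> of \<open>u x\<close>, the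
      mean of \<open>\<bar>v y - q\<bar>\<close> over small cubes is below \<open>e/2\<close>, and
      passing from \<open>q\<close> to \<open>u x\<close> adds at most \<open>e/4\<close>.\<close>
    obtain q where q: "q \<in> \<rat>" "u x - e/4 < q" "q < u x" using Rats_dense_in_real[of "u x - e/4" "u x"] e by auto
    have vx: "v x = u x" using x by (simp add: v_def)
    have qe: "\<bar>v x - q\<bar> < e/4" using q vx by simp
    have "x \<notin> Z q" "0 < e/4" using x q e by auto
    from Z(2)[OF this] obtain d where d: "0 < d" "\<forall>h. 0 < h \<and> h < d \<longrightarrow>
      norm (integral (cbox x (x + h *\<^sub>R One)) (\<lambda>y. \<bar>v y - q\<bar>) /\<^sub>R h ^ DIM('a) - \<bar>v x - q\<bar>) < e/4"
      by (auto elim!: exE conjE)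
    have "(LINT y|lebesgue_on S. \<bar>u y - u x\<bar> * indicator (cbox x (x + h *\<^sub>R One)) y) \<le> e * h ^ DIM('a)"
      if h: "0 < h" "h < d" and sub: "cbox x (x + h *\<^sub>R One) \<subseteq> S" for h
    proof -
      define C where "C = cbox x (x + h *\<^sub>R One)"
      have cont: "measure lebesgue C = h ^ DIM('a)"
        using h by (simp add: C_def content_cbox_plus)
      have hN: "0 < h ^ DIM('a)" using h by simp
      have "(LINT y|lebesgue_on S. \<bar>u y - u x\<bar> * indicator C y) = (LINT y|lebesgue. indicator S y *\<^sub>R (\<bar>u y - u x\<bar> * indicator C y))"
        using S by (intro integral_restrict_space) simp
      also have "\<dots> = (LINT y:C|lebesgue. \<bar>v y - u x\<bar>)"
        unfolding set_lebesgue_integral_def using sub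
        by (intro Bochner_Integration.integral_cong) (auto simp: v_def C_def split: split_indicator)
      also have "\<dots> = integral C (\<lambda>y. \<bar>v y - u x\<bar>)"
        unfolding C_def by (rule set_lebesgue_integral_eq_integral(2)[OF ci])
      also have "\<dots> \<le> integral C (\<lambda>y. \<bar>v y - q\<bar> + \<bar>v x - q\<bar>)"
      proof (rule integral_le)
        show "(\<lambda>y. \<bar>v y - u x\<bar>) integrable_on C"
          unfolding C_def by (rule set_lebesgue_integral_eq_integral(1)[OF ci])
        show "(\<lambda>y. \<bar>v y - q\<bar> + \<bar>v x - q\<bar>) integrable_on C"
          unfolding C_def by (intro integrable_add set_lebesgue_integral_eq_integral(1)[OF ci] integrable_const)
      qed (use vx in auto)
      also have "\<dots> = integral C (\<lambda>y. \<bar>v y - q\<bar>) + \<bar>v x - q\<bar> * h ^ DIM('a)"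
      proof -
        have "integral C (\<lambda>y. \<bar>v y - q\<bar> + \<bar>v x - q\<bar>) = integral C (\<lambda>y. \<bar>v y - q\<bar>) + integral C (\<lambda>y. \<bar>v x - q\<bar>)"
          unfolding C_def by (intro integral_add set_lebesgue_integral_eq_integral(1)[OF ci] integrable_const)
        then show ?thesis using cont by (simp add: C_def mult.commute)
      qed
      also have "integral C (\<lambda>y. \<bar>v y - q\<bar>) \<le> (e/2) * h ^ DIM('a)"
      proof -
        define J where "J = integral C (\<lambda>y. \<bar>v y - q\<bar>)"
        have "\<bar>J /\<^sub>R h ^ DIM('a) - \<bar>v x - q\<bar>\<bar> < e/4"
          using d(2)[rule_format, OF conjI[OF h]] unfolding C_def J_def real_norm_def .
        moreover have "J /\<^sub>R h ^ DIM('a) = J / h ^ DIM('a)" by (simp only: real_scaleR_def divide_inverse mult.commute)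
        ultimately have "J / h ^ DIM('a) < e/2" using qe by linarith
        then have "J < (e/2) * h ^ DIM('a)" using hN by (simp only: pos_divide_less_eq)
        then show ?thesis unfolding J_def by (rule less_imp_le)
      qed
      also have "\<bar>v x - q\<bar> * h ^ DIM('a) \<le> (e/4) * h ^ DIM('a)" using qe hN by (intro mult_right_mono) auto
      also have "(e/2) * h ^ DIM('a) + (e/4) * h ^ DIM('a) \<le> e * h ^ DIM('a)"
        using e hN by (simp add: distrib_right[symmetric])
      finally show ?thesis by (simp add: C_def)
    qed
    then show "\<exists>d>0. \<forall>h. 0 < h \<longrightarrow> h < d \<longrightarrow> cbox x (x + h *\<^sub>R One) \<subseteq> S \<longrightarrow>
       (LINT y|lebesgue_on S. \<bar>u y - u x\<bar> * indicator (cbox x (x + h *\<^sub>R One)) y) \<le> e * h ^ DIM('a)"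
      using d(1) by (intro exI[of _ d]) simp
  qed
qed

section \<open>Integrability of the gradient and averages of \<open>u\<close> near a point\<close>

lemma locally_integrable_measurable:
  fixes g :: "real ^ 'n \<Rightarrow> 'b::euclidean_space"
  assumes g: "locally_integrable \<Omega> g" and \<Omega>: "open \<Omega>"
  shows "g \<in> borel_measurable (lebesgue_on \<Omega>)"
proof -
  obtain C where C: "\<And>n. compact (C n)" "\<And>n. C n \<subseteq> \<Omega>" "\<And>n. C n \<subseteq> interior (C (Suc n))" "\<Union>(range C) = \<Omega>"
    by (rule open_Union_compact_subsets[OF \<Omega>]) blast
  have mono: "C n \<subseteq> C (Suc n)" for n using C(3) interior_subset by (rule order_trans)
  have incr: "C m \<subseteq> C n" if "m \<le> n" for m n using that by (rule lift_Suc_mono_le[of C, OF mono])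
  have Om: "\<Omega> \<in> sets lebesgue" using \<Omega> by auto
  \<comment> \<open>Local integrability gives measurability on compact sets only. Along an
    exhaustion by compact sets the truncations are eventually constant at each point, and limits of
    measurable functions are measurable.\<close>
  have "(\<lambda>x. indicator \<Omega> x *\<^sub>R g x) \<in> borel_measurable lebesgue"
  proof (rule borel_measurable_LIMSEQ_metric)
    fix n
    have "set_integrable lebesgue (C n) g" using g C(1,2) by (simp add: locally_integrable_def)
    then show "(\<lambda>x. indicator (C n) x *\<^sub>R g x) \<in> borel_measurable lebesgue"
      unfolding set_integrable_def by (rule borel_measurable_integrable)
  next
    fix x
    show "(\<lambda>n. indicator (C n) x *\<^sub>R g x) \<longlonglongrightarrow> indicator \<Omega> x *\<^sub>R g x"
    proof (cases "x \<in> \<Omega>")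
      case True
      then obtain m where m: "x \<in> C m" using C(4) by blast
      have "\<forall>\<^sub>F n in sequentially. indicator (C n) x *\<^sub>R g x = indicator \<Omega> x *\<^sub>R g x"
        using eventually_ge_at_top[of m]
        by eventually_elim (use incr m True in \<open>auto simp: indicator_def\<close>)
      then show ?thesis by (rule tendsto_eventually)
    next
      case False
      then have "x \<notin> C n" for n using C(2) by blast
      then show ?thesis using False by simp
    qed
  qed
  then show ?thesis using Om by (subst borel_measurable_restrict_space_iff) auto
qed

lemma integrable_of_powr:
  fixes f :: "'a \<Rightarrow> 'b::{banach, second_countable_topology}"
  assumes "finite_measure M" and f: "f \<in> borel_measurable M" and p: "1 \<le> p"
    and fin: "(\<integral>\<^sup>+x. ennreal (norm (f x) powr p) \<partial>M) < \<infinity>"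
  shows "integrable M f"
proof (rule integrableI_bounded[OF f])
  interpret finite_measure M by fact
  have le: "norm (f x) \<le> norm (f x) powr p + 1" for x
  proof (cases "norm (f x) \<le> 1")
    case False
    then have "norm (f x) powr 1 \<le> norm (f x) powr p" using p by (intro powr_mono) auto
    then show ?thesis using False by simp
  qed (simp add: add_increasing)
  have "(\<integral>\<^sup>+x. ennreal (norm (f x)) \<partial>M) \<le> (\<integral>\<^sup>+x. ennreal (norm (f x) powr p) + 1 \<partial>M)"
    by (intro nn_integral_mono) (use le in \<open>simp add: ennreal_leI flip: ennreal_plus ennreal_1\<close>)
  also have "\<dots> = (\<integral>\<^sup>+x. ennreal (norm (f x) powr p) \<partial>M) + emeasure M (space M)"
    using f by (subst nn_integral_add) auto
  also have "\<dots> < \<infinity>" using fin emeasure_finite by (auto simp: less_top[symmetric])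
  finally show "(\<integral>\<^sup>+x. ennreal (norm (f x)) \<partial>M) < \<infinity>" .
qed

text \<open>There is a dyadic radius above \<open>r\<close> that is at most \<open>2 * r\<close>,
  whence the factor two. The ball around \<open>c\<close> need not be centred at \<open>x\<close>:
  it only has to lie in the ball of radius \<open>r\<close> around \<open>x\<close>.\<close>

lemma integral_ball_le_dyadic_maximal:
  fixes w :: "real ^ 'n \<Rightarrow> real"
  assumes w: "integrable (lebesgue_on \<Omega>) w" "\<And>y. 0 \<le> w y" and R: "0 < R"
    and fin: "dyadic_maximal \<Omega> R (\<lambda>y. ennreal (w y)) x \<noteq> \<infinity>"
    and r: "norm (c - x) + \<rho> \<le> r" "0 < r" "r < R"
  shows "(LINT y|lebesgue_on \<Omega>. w y * indicator {y. norm (y - c) < \<rho>} y)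
    \<le> (2 * r) ^ CARD('n) * enn2real (dyadic_maximal \<Omega> R (\<lambda>y. ennreal (w y)) x)"
proof -
  define m where "m = enn2real (dyadic_maximal \<Omega> R (\<lambda>y. ennreal (w y)) x)"
  have m: "dyadic_maximal \<Omega> R (\<lambda>y. ennreal (w y)) x = ennreal m" "0 \<le> m"
    using fin by (simp_all add: m_def ennreal_enn2real_if)
  obtain j where j: "(1/2) ^ Suc j \<le> r / R" "r / R < (1/2) ^ j"
    using exists_dyadic_between[of "r / R"] r R by auto
  have rj: "R / 2 ^ j \<le> 2 * r" "r < R / 2 ^ j" using j R by (auto simp: field_simps power_divide)
  have sub: "norm (x - y) < R / 2 ^ j" if "norm (y - c) < \<rho>" for y
  proof -
    have "norm (x - y) \<le> norm (c - x) + norm (y - c)"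
      using norm_triangle_ineq[of "c - x" "y - c"] by (simp add: norm_minus_commute)
    then show ?thesis using that r rj by linarith
  qed
  have "(LINT y|lebesgue_on \<Omega>. w y * indicator {y. norm (y - c) < \<rho>} y)
    \<le> enn2real (\<integral>\<^sup>+y. ennreal (w y * indicator {y. norm (y - c) < \<rho>} y) \<partial>lebesgue_on \<Omega>)"
  proof (cases "(\<lambda>y. w y * indicator {y. norm (y - c) < \<rho>} y) \<in> borel_measurable (lebesgue_on \<Omega>)")
    case True
    then show ?thesis using w(2) by (subst integral_eq_nn_integral) auto
  next
    \<comment> \<open>A non-measurable integrand would have Bochner integral 0 by convention, and
      the bound holds all the same.\<close>
    case False
    then show ?thesis using borel_measurable_integrable by (subst not_integrable_integral_eq) auto
  qed
  also have "\<dots> \<le> enn2real (ennreal ((2 * r) ^ CARD('n) * m))"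
  proof (rule enn2real_mono)
    have "(\<integral>\<^sup>+y. ennreal (w y * indicator {y. norm (y - c) < \<rho>} y) \<partial>lebesgue_on \<Omega>)
      \<le> (\<integral>\<^sup>+y. ennreal (w y) * indicator {y. norm (x - y) < R / 2 ^ j} y \<partial>lebesgue_on \<Omega>)"
      by (intro nn_integral_mono) (use sub in \<open>auto split: split_indicator\<close>)
    also have "\<dots> \<le> ennreal ((R / 2 ^ j) ^ DIM(real ^ 'n)) * dyadic_maximal \<Omega> R (\<lambda>y. ennreal (w y)) x"
      by (rule dyadic_maximal_upper[OF R])
    also have "\<dots> = ennreal ((R / 2 ^ j) ^ CARD('n) * m)" using R m by (simp add: ennreal_mult)
    also have "\<dots> \<le> ennreal ((2 * r) ^ CARD('n) * m)"
      using rj R m by (intro ennreal_leI mult_right_mono power_mono) auto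
    finally show "(\<integral>\<^sup>+y. ennreal (w y * indicator {y. norm (y - c) < \<rho>} y) \<partial>lebesgue_on \<Omega>) \<le> ennreal ((2 * r) ^ CARD('n) * m)" .
  qed simp
  also have "\<dots> = (2 * r) ^ CARD('n) * m" using r m by (intro enn2real_ennreal) auto
  finally show ?thesis by (simp add: m_def)
qed

lemma One_nth: "(One :: real ^ 'n) $ i = 1"
proof -
  have "axis i (1::real) \<in> (Basis :: (real ^ 'n) set)" by (auto simp: Basis_vec_def)
  then have "(One :: real ^ 'n) \<bullet> axis i 1 = 1" by (simp add: inner_sum_left inner_Basis)
  then show ?thesis by (simp only: cart_eq_inner_axis)
qed

lemma cube_nth: "(x + h *\<^sub>R (One :: real ^ 'n)) $ i = x $ i + h"
  by (simp only: vector_add_component vector_scaleR_component One_nth real_scaleR_def mult_1_right)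

text \<open>The ball of radius \<open>h/2\<close> around the centre of the corner cube lies in that
  cube, and the kernel is at most \<open>(2 / h) ^ CARD('n)\<close>. Hence the error is a mean
  deviation of \<open>u\<close> from \<open>u x\<close> over the cube, up to the factor
  \<open>2 ^ CARD('n)\<close>.\<close>

lemma bump_average_corner:
  fixes u :: "real ^ 'n \<Rightarrow> real"
  assumes u: "integrable (lebesgue_on \<Omega>) u" and \<Omega>: "\<Omega> \<in> sets lebesgue" and h: "0 < h"
    and sub: "cbox x (x + h *\<^sub>R One) \<subseteq> \<Omega>"
    and leb: "(LINT y|lebesgue_on \<Omega>. \<bar>u y - u x\<bar> * indicator (cbox x (x + h *\<^sub>R One)) y) \<le> e * h ^ CARD('n)"
  shows "\<bar>(LINT y|lebesgue_on \<Omega>. u y * bump (x + (h/2) *\<^sub>R One) (h/2) y) - bump_mass TYPE('n) * u x\<bar> \<le> 2 ^ CARD('n) * e"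
proof -
  define c where "c = x + (h/2) *\<^sub>R One"
  define C where "C = cbox x (x + h *\<^sub>R One)"
  have h2: "0 < h/2" using h by simp
  have cC: "y \<in> C" if "norm (y - c) < h/2" for y
  proof -
    have "\<bar>(y - c) $ i\<bar> < h/2" for i using that component_le_norm_cart[of "y - c" i] by linarith
    then have "\<bar>y $ i - (x $ i + h/2)\<bar> < h/2" for i by (simp only: c_def vector_minus_component cube_nth)
    then have "x $ i \<le> y $ i \<and> y $ i \<le> x $ i + h" for i
      unfolding abs_less_iff by (smt (verit) field_sum_of_halves)
    then show ?thesis unfolding C_def mem_box_cart cube_nth by blast
  qed
  then have "ball c (h/2) \<subseteq> C" by (auto simp: dist_norm norm_minus_commute)
  then have bsub: "ball c (h/2) \<subseteq> \<Omega>" using sub by (simp add: C_def)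
  note mass = integral_bump_lebesgue_on[OF h2 bsub \<Omega>]
  have ub: "integrable (lebesgue_on \<Omega>) (\<lambda>y. u y * bump c (h/2) y)"
  proof -
    have "integrable (lebesgue_on \<Omega>) (\<lambda>y. (u y * flat_exp 0 (bump_arg c (h/2) y)) / (h/2) ^ CARD('n))"
      by (intro integrable_divide continuous_bump_class_times_integrable[OF u bump_class.base h2])
    then show ?thesis by (simp add: bump_def)
  qed
  have ub': "integrable (lebesgue_on \<Omega>) (\<lambda>y. u x * bump c (h/2) y)" using mass(2) by simp
  have "(LINT y|lebesgue_on \<Omega>. u y * bump c (h/2) y) - bump_mass TYPE('n) * u x
     = (LINT y|lebesgue_on \<Omega>. u y * bump c (h/2) y - u x * bump c (h/2) y)"
    using ub ub' mass(1) by simp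
  also have "\<bar>\<dots>\<bar> \<le> (LINT y|lebesgue_on \<Omega>. \<bar>u y * bump c (h/2) y - u x * bump c (h/2) y\<bar>)"
    by (rule integral_abs_bound)
  also have "\<dots> \<le> (LINT y|lebesgue_on \<Omega>. (2 / h) ^ CARD('n) * (\<bar>u y - u x\<bar> * indicator C y))"
  proof (rule integral_mono_AE')
    have fin: "integrable (lebesgue_on \<Omega>) (\<lambda>y. \<bar>u y - u x\<bar> * indicator C y)"
    proof -
      have Cm: "C \<in> sets lebesgue" "emeasure lebesgue C < \<infinity>"
        by (auto simp: C_def emeasure_lborel_cbox_eq intro: fmeasurableD)
      have Cs: "C \<in> sets (lebesgue_on \<Omega>)" using Cm sub \<Omega> by (auto simp: sets_restrict_space C_def intro!: image_eqI[of _ _ "cbox x (x + h *\<^sub>R One)"])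
      have "emeasure (lebesgue_on \<Omega>) C < \<infinity>" using Cm sub \<Omega> by (subst emeasure_restrict_space) (auto simp: C_def)
      then have "integrable (lebesgue_on \<Omega>) (\<lambda>y. u x * indicator C y)" using Cs by simp
      moreover have "integrable (lebesgue_on \<Omega>) (\<lambda>y. u y * indicator C y)"
        using integrable_mult_indicator[OF Cs u] by (simp add: mult.commute)
      ultimately have "integrable (lebesgue_on \<Omega>) (\<lambda>y. \<bar>u y * indicator C y - u x * indicator C y\<bar>)"
        by (intro integrable_abs Bochner_Integration.integrable_diff)
      moreover have "\<bar>u y * indicator C y - u x * indicator C y\<bar> = \<bar>u y - u x\<bar> * indicator C y" for y
        by (simp split: split_indicator)
      ultimately show ?thesis by (simp only:)
    qed
    then show "integrable (lebesgue_on \<Omega>) (\<lambda>y. (2 / h) ^ CARD('n) * (\<bar>u y - u x\<bar> * indicator C y))" by simp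
    show "AE y in lebesgue_on \<Omega>. \<bar>u y * bump c (h/2) y - u x * bump c (h/2) y\<bar> \<le> (2 / h) ^ CARD('n) * (\<bar>u y - u x\<bar> * indicator C y)"
    proof (rule AE_I2)
      fix y
      have "bump c (h/2) y \<le> (2 / h) ^ CARD('n) * indicator C y"
      proof (cases "norm (y - c) < h/2")
        case True
        then show ?thesis using bump_bounds(2)[OF h2, of c y] cC[OF True] by (simp add: power_divide)
      next
        case False
        then show ?thesis using bump_bounds(2)[OF h2, of c y] h by (simp add: order_trans[OF _ mult_nonneg_nonneg])
      qed
      then have "\<bar>u y - u x\<bar> * bump c (h/2) y \<le> \<bar>u y - u x\<bar> * ((2 / h) ^ CARD('n) * indicator C y)"
        by (intro mult_left_mono) auto
      moreover have "\<bar>u y * bump c (h/2) y - u x * bump c (h/2) y\<bar> = \<bar>u y - u x\<bar> * bump c (h/2) y"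
        using bump_bounds(1)[OF h2, of c y] by (simp only: left_diff_distrib[symmetric] abs_mult abs_of_nonneg)
      ultimately show "\<bar>u y * bump c (h/2) y - u x * bump c (h/2) y\<bar> \<le> (2 / h) ^ CARD('n) * (\<bar>u y - u x\<bar> * indicator C y)"
        by (simp only: mult.left_commute)
    qed
    show "AE y in lebesgue_on \<Omega>. 0 \<le> (2 / h) ^ CARD('n) * (\<bar>u y - u x\<bar> * indicator C y)" using h by simp
  qed
  also have "\<dots> = (2 / h) ^ CARD('n) * (LINT y|lebesgue_on \<Omega>. \<bar>u y - u x\<bar> * indicator C y)" by simp
  also have "\<dots> \<le> (2 / h) ^ CARD('n) * (e * h ^ CARD('n))"
    using leb h by (intro mult_left_mono) (simp_all add: C_def)
  also have "\<dots> = 2 ^ CARD('n) * e" using h by (simp add: power_divide)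
  finally show ?thesis by (simp add: c_def)
qed

text \<open>The kernel starts in a corner cube of small side \<open>h\<close>, where Lebesgue's
  theorem identifies its average, moves to the ball at height \<open>h\<close> on the axis of the
  cone at a cost proportional to \<open>h\<close>, and then climbs the axis to height
  \<open>t\<close>. As \<open>h\<close> tends to 0, only the cost of the climb remains.\<close>

lemma bump_average_cone:
  fixes u :: "real ^ 'n \<Rightarrow> real" and g :: "real ^ 'n \<Rightarrow> real ^ 'n"
  assumes wg: "has_weak_gradient \<Omega> u g" and u: "integrable (lebesgue_on \<Omega>) u" and g: "integrable (lebesgue_on \<Omega>) g"
    and bdd: "bounded \<Omega>" and op: "open \<Omega>" and x: "x \<in> \<Omega>"
    and k: "0 < \<kappa>" "\<kappa> \<le> 1" and e: "norm e = 1" and TR: "0 < T" "2 * T < R"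
    and cone: "\<And>t. 0 < t \<Longrightarrow> t \<le> T \<Longrightarrow> ball (x + t *\<^sub>R e) (\<kappa> * t) \<subseteq> \<Omega>"
    and M: "0 \<le> M" "\<And>c \<rho> r. norm (c - x) + \<rho> \<le> r \<Longrightarrow> 0 < r \<Longrightarrow> r < R \<Longrightarrow>
       (LINT y|lebesgue_on \<Omega>. norm (g y) * indicator {y. norm (y - c) < \<rho>} y) \<le> (2 * r) ^ CARD('n) * M"
    and leb: "\<And>\<epsilon>. 0 < \<epsilon> \<Longrightarrow> \<exists>d>0. \<forall>h. 0 < h \<longrightarrow> h < d \<longrightarrow> cbox x (x + h *\<^sub>R One) \<subseteq> \<Omega> \<longrightarrow>
       (LINT y|lebesgue_on \<Omega>. \<bar>u y - u x\<bar> * indicator (cbox x (x + h *\<^sub>R One)) y) \<le> \<epsilon> * h ^ CARD('n)"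
    and t: "0 < t" "t \<le> T"
  shows "\<bar>(LINT y|lebesgue_on \<Omega>. u y * bump (x + t *\<^sub>R e) (\<kappa> * t / 2) y) - bump_mass TYPE('n) * u x\<bar>
    \<le> 2 * t * ((8 / \<kappa>) ^ CARD('n) * M)"
proof -
  have Om: "\<Omega> \<in> sets lebesgue" using op by auto
  define F where "F c \<rho> = (LINT y|lebesgue_on \<Omega>. u y * bump c \<rho> y)" for c \<rho>
  \<comment> \<open>At height \<open>z\<close> the kernel lives on a ball of radius
    \<open>\<kappa> * z / 2\<close> inside the ball of radius \<open>2 * z\<close> around
    \<open>x\<close>, and \<open>2 * (2 * z)\<close> divided by the former radius is
    \<open>8 / \<kappa>\<close>. During the motion away from the corner cube the moving ball stays
    within \<open>h * L\<close> of \<open>x\<close> while its radius is at least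
    \<open>\<kappa> * h / 2\<close>, which gives \<open>4 * L / \<kappa>\<close> in
    \<open>Q'\<close>.\<close>
  define Q where "Q = (8 / \<kappa>) ^ CARD('n) * M"
  define L where "L = norm (One :: real ^ 'n) + 2"
  have L: "2 \<le> L" by (simp add: L_def)
  define Q' where "Q' = (4 * L / \<kappa>) ^ CARD('n) * M"
  have Q0: "0 \<le> Q" "0 \<le> Q'" using k L M by (auto simp: Q_def Q'_def)
  obtain d0 where d0: "0 < d0" "ball x d0 \<subseteq> \<Omega>" using op x by (meson openE)
  have cone_path: "\<bar>F (x + t *\<^sub>R e) (\<kappa> * t / 2) - F (x + h *\<^sub>R e) (\<kappa> * h / 2)\<bar> \<le> 2 * t * Q" if h: "0 < h" "h \<le> t" for h
  proof -
    have s: "(x + h *\<^sub>R e) + \<tau> *\<^sub>R ((t - h) *\<^sub>R e) = x + (h + \<tau> * (t - h)) *\<^sub>R e" 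
      "\<kappa> * h / 2 + \<tau> * (\<kappa> * (t - h) / 2) = \<kappa> * (h + \<tau> * (t - h)) / 2" for \<tau>
      by (simp add: algebra_simps) (simp only: divide_inverse algebra_simps)
    have t': "0 < h + \<tau> * (t - h)" "h + \<tau> * (t - h) \<le> T" if "0 \<le> \<tau>" "\<tau> \<le> 1" for \<tau>
    proof -
      define q where "q = \<tau> * (t - h)"
      have "0 \<le> q" unfolding q_def using that h by simp
      moreover have "q \<le> t - h" unfolding q_def by (rule mult_left_le_one_le) (use that h in auto)
      ultimately have "0 < h + q" "h + q \<le> T" using h t by linarith+
      then show "0 < h + \<tau> * (t - h)" "h + \<tau> * (t - h) \<le> T" by (simp_all only: q_def)
    qed
    have "\<bar>F ((x + h *\<^sub>R e) + (t - h) *\<^sub>R e) (\<kappa> * h / 2 + \<kappa> * (t - h) / 2) - F (x + h *\<^sub>R e) (\<kappa> * h / 2)\<bar>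
      \<le> (norm ((t - h) *\<^sub>R e) + \<bar>\<kappa> * (t - h) / 2\<bar>) * Q"
      unfolding F_def
    proof (rule bump_average_path[OF wg u g bdd])
      fix \<tau> :: real assume tau: "0 \<le> \<tau>" "\<tau> \<le> 1"
      define z where "z = h + \<tau> * (t - h)"
      have z: "0 < z" "z \<le> T" using t'[OF tau] by (auto simp: z_def)
      show "0 < \<kappa> * h / 2 + \<tau> * (\<kappa> * (t - h) / 2)" unfolding s using z k by (simp add: z_def)
      have "cball (x + z *\<^sub>R e) (\<kappa> * z / 2) \<subseteq> ball (x + z *\<^sub>R e) (\<kappa> * z)"
        using z k by (auto simp: cball_subset_ball_iff)
      then show "cball ((x + h *\<^sub>R e) + \<tau> *\<^sub>R ((t - h) *\<^sub>R e)) (\<kappa> * h / 2 + \<tau> * (\<kappa> * (t - h) / 2)) \<subseteq> \<Omega>"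
        unfolding s using cone[OF z] by (simp add: z_def)
      have "\<kappa> * z \<le> 1 * z" using z k by (intro mult_right_mono) auto
      then have "norm ((x + z *\<^sub>R e) - x) + \<kappa> * z / 2 \<le> 2 * z" using e z by simp
      moreover have "0 < 2 * z" "2 * z < R" using z TR by auto
      ultimately have "(LINT y|lebesgue_on \<Omega>. norm (g y) * indicator {y. norm (y - (x + z *\<^sub>R e)) < \<kappa> * z / 2} y) \<le> (2 * (2 * z)) ^ CARD('n) * M"
        by (rule M(2))
      also have "\<dots> = Q * (\<kappa> * z / 2) ^ CARD('n)"
      proof -
        have "2 * (2 * z) = (8 / \<kappa>) * (\<kappa> * z / 2)" using k by simp
        then show ?thesis unfolding Q_def by (simp only: power_mult_distrib mult_ac)
      qed
      finally show "(LINT y|lebesgue_on \<Omega>. norm (g y) * indicator {y. norm (y - ((x + h *\<^sub>R e) + \<tau> *\<^sub>R ((t - h) *\<^sub>R e))) < \<kappa> * h / 2 + \<tau> * (\<kappa> * (t - h) / 2)} y)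
        \<le> Q * (\<kappa> * h / 2 + \<tau> * (\<kappa> * (t - h) / 2)) ^ CARD('n)"
        unfolding s z_def .
    qed
    moreover have "(x + h *\<^sub>R e) + (t - h) *\<^sub>R e = x + t *\<^sub>R e" "\<kappa> * h / 2 + \<kappa> * (t - h) / 2 = \<kappa> * t / 2"
      using s[of 1] by simp_all
    moreover have "(norm ((t - h) *\<^sub>R e) + \<bar>\<kappa> * (t - h) / 2\<bar>) * Q \<le> 2 * t * Q"
    proof (rule mult_right_mono[OF _ Q0(1)])
      define q where "q = \<kappa> * (t - h)"
      have "0 \<le> q" unfolding q_def using k h by simp
      moreover have "q \<le> t - h" unfolding q_def by (rule mult_left_le_one_le) (use k h in auto)
      moreover have "norm ((t - h) *\<^sub>R e) = t - h" using e h by simp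
      ultimately have "norm ((t - h) *\<^sub>R e) + \<bar>q / 2\<bar> \<le> 2 * t" using h by linarith
      then show "norm ((t - h) *\<^sub>R e) + \<bar>\<kappa> * (t - h) / 2\<bar> \<le> 2 * t" by (simp only: q_def)
    qed
    ultimately show ?thesis by (simp only:)
  qed
  \<comment> \<open>This short path may leave the cone: \<open>h * L < d0\<close> keeps it in a ball
    around \<open>x\<close> that is contained in the domain.\<close>
  have corner_path: "\<bar>F (x + h *\<^sub>R e) (\<kappa> * h / 2) - F (x + (h/2) *\<^sub>R One) (h/2)\<bar> \<le> h * ((L + 1) * Q')"
    if h: "0 < h" "h * L < d0" "h * L < R" for h
  proof -
    define c' where "c' = h *\<^sub>R e - (h/2) *\<^sub>R (One :: real ^ 'n)"
    define \<rho>' where "\<rho>' = \<kappa> * h / 2 - h / 2"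
    have kh: "0 < \<kappa> * h" "\<kappa> * h \<le> 1 * h" using h k by (auto intro!: mult_right_mono)
    have rr: "\<kappa> * h / 2 \<le> h/2 + \<tau> * \<rho>'" "h/2 + \<tau> * \<rho>' \<le> h/2" if "0 \<le> \<tau>" "\<tau> \<le> 1" for \<tau>
    proof -
      have "1 * \<rho>' \<le> \<tau> * \<rho>'" using that kh by (intro mult_right_mono_neg) (auto simp: \<rho>'_def)
      moreover have "\<kappa> * h / 2 = h / 2 + 1 * \<rho>'" by (simp add: \<rho>'_def)
      ultimately show "\<kappa> * h / 2 \<le> h/2 + \<tau> * \<rho>'" by (simp only: add_left_mono)
      have "\<tau> * \<rho>' \<le> 0" using that kh by (intro mult_nonneg_nonpos) (auto simp: \<rho>'_def)
      then show "h/2 + \<tau> * \<rho>' \<le> h/2" by linarith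
    qed
    have cc: "norm ((x + (h/2) *\<^sub>R One + \<tau> *\<^sub>R c') - x) + (h/2 + \<tau> * \<rho>') \<le> h * L" if tau: "0 \<le> \<tau>" "\<tau> \<le> 1" for \<tau>
    proof -
      have "(x + (h/2) *\<^sub>R One + \<tau> *\<^sub>R c') - x = ((1 - \<tau>) * (h/2)) *\<^sub>R (One :: real ^ 'n) + (\<tau> * h) *\<^sub>R e"
      proof -
        have "p *\<^sub>R a + \<tau> *\<^sub>R (h *\<^sub>R b - p *\<^sub>R a) = ((1 - \<tau>) * p) *\<^sub>R a + (\<tau> * h) *\<^sub>R b" for p and a b :: "real ^ 'n"
          by (simp add: algebra_simps)
        from this[of "h/2" One e] show ?thesis by (simp only: c'_def add.assoc add_diff_cancel_left')
      qed
      then have "norm ((x + (h/2) *\<^sub>R One + \<tau> *\<^sub>R c') - x) \<le> norm (((1 - \<tau>) * (h/2)) *\<^sub>R (One :: real ^ 'n)) + norm ((\<tau> * h) *\<^sub>R e)"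
        by (simp only: norm_triangle_ineq)
      also have "\<dots> = (1 - \<tau>) * (h/2) * norm (One :: real ^ 'n) + \<tau> * h" using tau h e by (simp add: abs_mult)
      also have "\<dots> \<le> 1 * (h/2) * norm (One :: real ^ 'n) + 1 * h"
        using tau h by (intro add_mono mult_right_mono) auto
      finally have 1: "norm ((x + (h/2) *\<^sub>R One + \<tau> *\<^sub>R c') - x) \<le> (h/2) * norm (One :: real ^ 'n) + h" by simp
      have 2: "(h/2) * norm (One :: real ^ 'n) \<le> h * norm (One :: real ^ 'n)" using h by (intro mult_right_mono) auto
      have "h * L = h * norm (One :: real ^ 'n) + h * 2" by (simp only: L_def distrib_left)
      then show ?thesis using 1 2 rr(2)[OF tau] h by linarith
    qed
    have "\<bar>F ((x + (h/2) *\<^sub>R One) + c') (h/2 + \<rho>') - F (x + (h/2) *\<^sub>R One) (h/2)\<bar> \<le> (norm c' + \<bar>\<rho>'\<bar>) * Q'"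
      unfolding F_def
    proof (rule bump_average_path[OF wg u g bdd])
      fix \<tau> :: real assume tau: "0 \<le> \<tau>" "\<tau> \<le> 1"
      show "0 < h/2 + \<tau> * \<rho>'" using rr(1)[OF tau] kh by linarith
      show "cball (x + (h/2) *\<^sub>R One + \<tau> *\<^sub>R c') (h/2 + \<tau> * \<rho>') \<subseteq> \<Omega>"
      proof (rule order_trans[OF _ d0(2)])
        show "cball (x + (h/2) *\<^sub>R One + \<tau> *\<^sub>R c') (h/2 + \<tau> * \<rho>') \<subseteq> ball x d0"
          unfolding cball_subset_ball_iff dist_norm using cc[OF tau] h by simp
      qed
      have "(LINT y|lebesgue_on \<Omega>. norm (g y) * indicator {y. norm (y - (x + (h/2) *\<^sub>R One + \<tau> *\<^sub>R c')) < h/2 + \<tau> * \<rho>'} y)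
        \<le> (2 * (h * L)) ^ CARD('n) * M"
        using h L by (intro M(2) cc[OF tau]) auto
      also have "\<dots> = Q' * (\<kappa> * h / 2) ^ CARD('n)"
      proof -
        have "2 * (h * L) = (4 * L / \<kappa>) * (\<kappa> * h / 2)" using k by simp
        then show ?thesis unfolding Q'_def by (simp only: power_mult_distrib mult_ac)
      qed
      also have "\<dots> \<le> Q' * (h/2 + \<tau> * \<rho>') ^ CARD('n)"
        using rr(1)[OF tau] kh Q0 by (intro mult_left_mono power_mono) auto
      finally show "(LINT y|lebesgue_on \<Omega>. norm (g y) * indicator {y. norm (y - (x + (h/2) *\<^sub>R One + \<tau> *\<^sub>R c')) < h/2 + \<tau> * \<rho>'} y)
        \<le> Q' * (h/2 + \<tau> * \<rho>') ^ CARD('n)" .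
    qed
    moreover have "(x + (h/2) *\<^sub>R One) + c' = x + h *\<^sub>R e" "h/2 + \<rho>' = \<kappa> * h / 2" by (simp_all add: c'_def \<rho>'_def)
    moreover have "(norm c' + \<bar>\<rho>'\<bar>) * Q' \<le> (h * (L + 1)) * Q'"
    proof (rule mult_right_mono[OF _ Q0(2)])
      have "norm c' \<le> norm (h *\<^sub>R e) + norm ((h/2) *\<^sub>R (One :: real ^ 'n))" unfolding c'_def by (rule norm_triangle_ineq4)
      also have "\<dots> = h + (h/2) * norm (One :: real ^ 'n)" using e h by simp
      finally have 1: "norm c' \<le> h + (h/2) * norm (One :: real ^ 'n)" .
      have 2: "(h/2) * norm (One :: real ^ 'n) \<le> h * norm (One :: real ^ 'n)" using h by (intro mult_right_mono) auto
      have 3: "\<bar>\<rho>'\<bar> \<le> h" using kh unfolding \<rho>'_def by linarith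
      have "h * (L + 1) = h * norm (One :: real ^ 'n) + 3 * h" by (simp add: L_def algebra_simps)
      then show "norm c' + \<bar>\<rho>'\<bar> \<le> h * (L + 1)" using 1 2 3 h by linarith
    qed
    ultimately show ?thesis by (simp only: mult.assoc)
  qed
  have "\<bar>F (x + t *\<^sub>R e) (\<kappa> * t / 2) - bump_mass TYPE('n) * u x\<bar> \<le> 2 * t * Q + \<epsilon>" if eps: "0 < \<epsilon>" for \<epsilon>
  proof -
    define \<epsilon>' where "\<epsilon>' = \<epsilon> / 2 / 2 ^ CARD('n)"
    have "0 < \<epsilon>'" using eps by (simp add: \<epsilon>'_def)
    from leb[OF this] obtain d where d: "0 < d" "\<forall>h. 0 < h \<longrightarrow> h < d \<longrightarrow> cbox x (x + h *\<^sub>R One) \<subseteq> \<Omega> \<longrightarrow>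
       (LINT y|lebesgue_on \<Omega>. \<bar>u y - u x\<bar> * indicator (cbox x (x + h *\<^sub>R One)) y) \<le> \<epsilon>' * h ^ CARD('n)"
      by (elim exE conjE) 
    define D where "D = (L + 1) * Q' + 1"
    have D: "0 < D" using L Q0 by (simp add: D_def add_nonneg_pos)
    \<comment> \<open>Each entry serves one purpose: the Lebesgue point estimate, a starting height
      not above \<open>t\<close>, a first path inside \<open>ball x d0\<close>, radii below
      \<open>R\<close>, and a cost of at most \<open>\<epsilon> / 2\<close> for that path.\<close>
    define h where "h = Min {d / 2, t, d0 / (2 * L), R / (2 * L), \<epsilon> / 2 / D}"
    have "0 < R" using TR by simp
    have h: "0 < h" unfolding h_def using d t d0 L \<open>0 < R\<close> eps D by simp
    have hle: "h \<le> d / 2" "h \<le> t" "h \<le> d0 / (2 * L)" "h \<le> R / (2 * L)" "h \<le> \<epsilon> / 2 / D"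
      unfolding h_def by simp_all
    have hL: "h * L < d0" "h * L < R"
    proof -
      have "h * L \<le> d0 / (2 * L) * L" by (rule mult_right_mono[OF hle(3)]) (use L in simp)
      moreover have "h * L \<le> R / (2 * L) * L" by (rule mult_right_mono[OF hle(4)]) (use L in simp)
      moreover have "d0 / (2 * L) * L = d0 / 2" "R / (2 * L) * L = R / 2" using L by simp_all
      ultimately have "h * L \<le> d0 / 2" "h * L \<le> R / 2" by (simp_all only:)
      then show "h * L < d0" "h * L < R" using d0 \<open>0 < R\<close> by linarith+
    qed
    have hd: "h < d" using hle(1) d(1) by linarith
    have csub: "cbox x (x + h *\<^sub>R One) \<subseteq> \<Omega>"
    proof (rule order_trans[OF _ d0(2)], rule subsetI)
      fix y assume y: "y \<in> cbox x (x + h *\<^sub>R One)"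
      have "norm ((y - x) $ i) \<le> norm ((h *\<^sub>R (One :: real ^ 'n)) $ i)" for i
      proof -
        have "x $ i \<le> y $ i" "y $ i \<le> x $ i + h" using y unfolding mem_box_cart cube_nth by blast+
        then have "\<bar>(y - x) $ i\<bar> \<le> \<bar>h\<bar>" unfolding vector_minus_component by linarith
        then show ?thesis by (simp only: vector_scaleR_component One_nth real_scaleR_def mult_1_right real_norm_def)
      qed
      then have "norm (y - x) \<le> norm (h *\<^sub>R (One :: real ^ 'n))" by (rule norm_le_componentwise_cart)
      also have "\<dots> \<le> h * L" using h by (simp add: L_def)
      finally show "y \<in> ball x d0" using hL by (simp add: dist_norm norm_minus_commute)
    qed
    have "\<bar>F (x + (h/2) *\<^sub>R One) (h/2) - bump_mass TYPE('n) * u x\<bar> \<le> 2 ^ CARD('n) * \<epsilon>'"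
      unfolding F_def by (rule bump_average_corner[OF u Om h csub d(2)[rule_format, OF h hd csub]])
    also have "\<dots> = \<epsilon> / 2" by (simp add: \<epsilon>'_def)
    finally have 1: "\<bar>F (x + (h/2) *\<^sub>R One) (h/2) - bump_mass TYPE('n) * u x\<bar> \<le> \<epsilon> / 2" .
    have "h * ((L + 1) * Q') \<le> h * D" using h by (intro mult_left_mono) (auto simp: D_def)
    also have "\<dots> \<le> \<epsilon> / 2 / D * D" using hle(5) D by (intro mult_right_mono) auto
    also have "\<dots> = \<epsilon> / 2" using D by simp
    finally show ?thesis using 1 cone_path[OF h hle(2)] corner_path[OF h hL] by linarith
  qed
  then have "\<bar>F (x + t *\<^sub>R e) (\<kappa> * t / 2) - bump_mass TYPE('n) * u x\<bar> \<le> 2 * t * Q" by (rule field_le_epsilon)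
  then show ?thesis by (simp only: F_def Q_def)
qed

text \<open>Only the centre moves, by at most \<open>\<kappa> * t / 4\<close>, so the ball of radius
  \<open>\<kappa> * t / 2\<close> stays inside the ball of radius \<open>\<kappa> * t\<close>
  supplied by the cone at \<open>x\<close>. All averages of the gradient are estimated at the single
  point \<open>x\<close>.\<close>

lemma bump_average_translate:
  fixes u :: "real ^ 'n \<Rightarrow> real" and g :: "real ^ 'n \<Rightarrow> real ^ 'n"
  assumes wg: "has_weak_gradient \<Omega> u g" and u: "integrable (lebesgue_on \<Omega>) u" and g: "integrable (lebesgue_on \<Omega>) g"
    and bdd: "bounded \<Omega>"
    and k: "0 < \<kappa>" "\<kappa> \<le> 1" and e: "norm e = 1" and t: "0 < t" "2 * t < R"
    and cone: "ball (x + t *\<^sub>R e) (\<kappa> * t) \<subseteq> \<Omega>"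
    and M: "\<And>c \<rho> r. norm (c - x) + \<rho> \<le> r \<Longrightarrow> 0 < r \<Longrightarrow> r < R \<Longrightarrow>
       (LINT y|lebesgue_on \<Omega>. norm (g y) * indicator {y. norm (y - c) < \<rho>} y) \<le> (2 * r) ^ CARD('n) * M"
    and y: "norm (y - x) \<le> \<kappa> * t / 4"
  shows "\<bar>(LINT z|lebesgue_on \<Omega>. u z * bump (y + t *\<^sub>R e) (\<kappa> * t / 2) z) - (LINT z|lebesgue_on \<Omega>. u z * bump (x + t *\<^sub>R e) (\<kappa> * t / 2) z)\<bar>
    \<le> norm (y - x) * ((8 / \<kappa>) ^ CARD('n) * M)"
proof -
  have kt: "0 < \<kappa> * t" "\<kappa> * t \<le> 1 * t" using k t by (auto intro!: mult_right_mono)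
  define Q where "Q = (8 / \<kappa>) ^ CARD('n) * M"
  have tau_le: "norm (\<tau> *\<^sub>R (y - x)) \<le> \<kappa> * t / 4" if "0 \<le> \<tau>" "\<tau> \<le> 1" for \<tau>
  proof -
    have "\<tau> * norm (y - x) \<le> 1 * norm (y - x)" using that by (intro mult_right_mono) auto
    then show ?thesis using that y by simp
  qed
  have "\<bar>(LINT z|lebesgue_on \<Omega>. u z * bump ((x + t *\<^sub>R e) + (y - x)) (\<kappa> * t / 2 + 0) z) - (LINT z|lebesgue_on \<Omega>. u z * bump (x + t *\<^sub>R e) (\<kappa> * t / 2) z)\<bar>
    \<le> (norm (y - x) + \<bar>0\<bar>) * Q"
  proof (rule bump_average_path[OF wg u g bdd])
    fix \<tau> :: real assume tau: "0 \<le> \<tau>" "\<tau> \<le> 1"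
    show "0 < \<kappa> * t / 2 + \<tau> * 0" using kt by simp
    have "cball (x + t *\<^sub>R e + \<tau> *\<^sub>R (y - x)) (\<kappa> * t / 2) \<subseteq> ball (x + t *\<^sub>R e) (\<kappa> * t)"
      unfolding cball_subset_ball_iff dist_norm using tau_le[OF tau] kt by simp
    then show "cball (x + t *\<^sub>R e + \<tau> *\<^sub>R (y - x)) (\<kappa> * t / 2 + \<tau> * 0) \<subseteq> \<Omega>" using cone by simp
    have "norm ((x + t *\<^sub>R e + \<tau> *\<^sub>R (y - x)) - x) \<le> norm (t *\<^sub>R e) + norm (\<tau> *\<^sub>R (y - x))"
      using norm_triangle_ineq[of "t *\<^sub>R e" "\<tau> *\<^sub>R (y - x)"] by simp
    moreover have "norm (t *\<^sub>R e) = t" using e t by simp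
    ultimately have "norm ((x + t *\<^sub>R e + \<tau> *\<^sub>R (y - x)) - x) + \<kappa> * t / 2 \<le> 2 * t"
      using tau_le[OF tau] kt by linarith
    moreover have "0 < 2 * t" using t by simp
    ultimately have "(LINT z|lebesgue_on \<Omega>. norm (g z) * indicator {z. norm (z - (x + t *\<^sub>R e + \<tau> *\<^sub>R (y - x))) < \<kappa> * t / 2} z) \<le> (2 * (2 * t)) ^ CARD('n) * M"
      using t(2) by (rule M)
    also have "\<dots> = Q * (\<kappa> * t / 2) ^ CARD('n)"
    proof -
      have "2 * (2 * t) = (8 / \<kappa>) * (\<kappa> * t / 2)" using k by simp
      then show ?thesis unfolding Q_def by (simp only: power_mult_distrib mult_ac)
    qed
    finally show "(LINT z|lebesgue_on \<Omega>. norm (g z) * indicator {z. norm (z - (x + t *\<^sub>R e + \<tau> *\<^sub>R (y - x))) < \<kappa> * t / 2 + \<tau> * 0} z)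
      \<le> Q * (\<kappa> * t / 2 + \<tau> * 0) ^ CARD('n)" by simp
  qed
  then show ?thesis by (simp add: Q_def algebra_simps)
qed

text \<open>Two points at a small distance \<open>r\<close> are compared through the kernels at
  height \<open>4 * r / \<kappa>\<close> above them: two climbs and one translation, each costing a
  multiple of \<open>r\<close> times the maximal function of the gradient at one of the two
  points.\<close>

theorem hajlasz_of_weak_gradient:
  fixes \<Omega> :: "(real ^ 'n) set"
  assumes dom: "bounded_lipschitz_domain \<Omega>" and p: "1 < p"
  obtains K where "0 < K"
    "\<And>u g A. u \<in> borel_measurable (lebesgue_on \<Omega>) \<Longrightarrow> has_weak_gradient \<Omega> u g \<Longrightarrow> 0 < A \<Longrightarrow>
       (\<integral>\<^sup>+x. ennreal (\<bar>u x\<bar> powr p) \<partial>lebesgue_on \<Omega>) \<le> ennreal (A powr p) \<Longrightarrow>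
       (\<integral>\<^sup>+x. ennreal (norm (g x) powr p) \<partial>lebesgue_on \<Omega>) \<le> ennreal (A powr p) \<Longrightarrow>
       \<exists>Z h. hajlasz_gradient \<Omega> Z 1 u h \<and> (\<integral>\<^sup>+x. ennreal (h x powr p) \<partial>lebesgue_on \<Omega>) \<le> ennreal ((K * A) powr p)"
proof -
  have op: "open \<Omega>" and bdd: "bounded \<Omega>" using dom unfolding bounded_lipschitz_domain_def by blast+
  have Om: "\<Omega> \<in> sets lebesgue" using op by auto
  have lm: "\<Omega> \<in> lmeasurable" using bdd Om by (intro bounded_set_imp_lmeasurable)
  have finm: "finite_measure (lebesgue_on \<Omega>)" by (rule finite_measure_lebesgue_on[OF lm])
  obtain \<kappa> T where k: "0 < \<kappa>" "\<kappa> \<le> 1" and T: "0 < T"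
    and cone: "\<And>x y. x \<in> \<Omega> \<Longrightarrow> y \<in> \<Omega> \<Longrightarrow> norm (x - y) < T \<Longrightarrow> \<exists>e. norm e = 1 \<and>
       (\<forall>t. 0 < t \<longrightarrow> t \<le> T \<longrightarrow> ball (x + t *\<^sub>R e) (\<kappa> * t) \<subseteq> \<Omega> \<and> ball (y + t *\<^sub>R e) (\<kappa> * t) \<subseteq> \<Omega>)"
    by (rule uniform_cone[OF dom]) blast
  \<comment> \<open>At heights up to \<open>T\<close> the averages are estimated in balls of radius
    up to \<open>2 * T\<close>, which has to be smaller than \<open>R\<close>.\<close>
  define R where "R = 2 * T + 1"
  have R: "0 < R" "2 * T < R" using T by (auto simp: R_def)
  have "\<exists>KM>0. \<forall>w A. w \<in> borel_measurable (lebesgue_on \<Omega>) \<longrightarrow> (\<forall>x. 0 \<le> w x) \<longrightarrow>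
       (\<integral>\<^sup>+x. ennreal (w x powr p) \<partial>lebesgue_on \<Omega>) \<le> ennreal A \<longrightarrow>
       (AE x in lebesgue_on \<Omega>. dyadic_maximal \<Omega> R (\<lambda>y. ennreal (w y)) x \<noteq> \<infinity>) \<and>
       (\<integral>\<^sup>+x. ennreal (enn2real (dyadic_maximal \<Omega> R (\<lambda>y. ennreal (w y)) x) powr p) \<partial>lebesgue_on \<Omega>) \<le> ennreal (KM * A)"
  proof (rule dyadic_maximal_strong_type[OF lm p R(1)], intro exI conjI allI impI)
    fix K assume *: "0 < K" "\<And>w A. w \<in> borel_measurable (lebesgue_on \<Omega>) \<Longrightarrow> (\<And>x. 0 \<le> w x) \<Longrightarrow>
       (\<integral>\<^sup>+x. ennreal (w x powr p) \<partial>lebesgue_on \<Omega>) \<le> ennreal A \<Longrightarrow>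
       (AE x in lebesgue_on \<Omega>. dyadic_maximal \<Omega> R (\<lambda>y. ennreal (w y)) x \<noteq> \<infinity>) \<and>
       (\<integral>\<^sup>+x. ennreal (enn2real (dyadic_maximal \<Omega> R (\<lambda>y. ennreal (w y)) x) powr p) \<partial>lebesgue_on \<Omega>) \<le> ennreal (K * A)"
    show "0 < K" by fact
    fix w A assume "w \<in> borel_measurable (lebesgue_on \<Omega>)" "\<forall>x. 0 \<le> w x"
      "(\<integral>\<^sup>+x. ennreal (w x powr p) \<partial>lebesgue_on \<Omega>) \<le> ennreal A"
    from *(2)[OF this(1) this(2)[rule_format] this(3)]
    show "AE x in lebesgue_on \<Omega>. dyadic_maximal \<Omega> R (\<lambda>y. ennreal (w y)) x \<noteq> \<infinity>"
      "(\<integral>\<^sup>+x. ennreal (enn2real (dyadic_maximal \<Omega> R (\<lambda>y. ennreal (w y)) x) powr p) \<partial>lebesgue_on \<Omega>) \<le> ennreal (K * A)"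
      by (rule conjunct1, rule conjunct2)
  qed
  then obtain KM where KM0: "0 < KM" "\<forall>w A. w \<in> borel_measurable (lebesgue_on \<Omega>) \<longrightarrow> (\<forall>x. 0 \<le> w x) \<longrightarrow>
       (\<integral>\<^sup>+x. ennreal (w x powr p) \<partial>lebesgue_on \<Omega>) \<le> ennreal A \<longrightarrow>
       (AE x in lebesgue_on \<Omega>. dyadic_maximal \<Omega> R (\<lambda>y. ennreal (w y)) x \<noteq> \<infinity>) \<and>
       (\<integral>\<^sup>+x. ennreal (enn2real (dyadic_maximal \<Omega> R (\<lambda>y. ennreal (w y)) x) powr p) \<partial>lebesgue_on \<Omega>) \<le> ennreal (KM * A)"
    by (elim exE conjE)
  note KM = KM0(1) KM0(2)[rule_format]
  define I where "I = bump_mass TYPE('n)"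
  have I: "0 < I" unfolding I_def by (rule bump_mass_pos)
  define E where "E = (8 / \<kappa>) ^ CARD('n)"
  have E: "0 \<le> E" using k by (simp add: E_def)
  \<comment> \<open>Each climb to \<open>t = 4 * r / \<kappa>\<close> costs
    \<open>2 * t * E\<close>, which is \<open>r * (8 / \<kappa>) * E\<close>, and the translation
    costs \<open>r * E\<close>, both times a maximal function; the mass \<open>I\<close> of the
    kernel is divided out.\<close>
  define C1 where "C1 = (8 / \<kappa> + 1) * E / I"
  have C1: "0 \<le> C1" using k E I by (simp add: C1_def)
  \<comment> \<open>For \<open>r < \<delta>\<close> the height \<open>4 * r / \<kappa>\<close> does
    not exceed \<open>T\<close>, so the uniform cone reaches it.\<close>
  define \<delta> where "\<delta> = \<kappa> * T / 4"
  have d: "0 < \<delta>" "\<delta> < T"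
  proof -
    show "0 < \<delta>" using k T by (simp add: \<delta>_def)
    have "\<kappa> * T \<le> T" by (rule mult_left_le_one_le) (use k T in auto)
    then show "\<delta> < T" using T unfolding \<delta>_def by linarith
  qed
  define K0 where "K0 = 2 powr p * (C1 powr p * KM + (1 / \<delta>) powr p)"
  have K0: "0 < K0" using d KM by (simp add: K0_def add_nonneg_pos)
  define K where "K = K0 powr (1 / p)"
  have K: "0 < K" "K powr p = K0" using K0 p by (simp_all add: K_def powr_powr)
  show ?thesis
  proof (rule that[OF K(1)])
    fix u g and A :: real
    assume u: "u \<in> borel_measurable (lebesgue_on \<Omega>)" and wg: "has_weak_gradient \<Omega> u g" and A: "0 < A"
      and uint: "(\<integral>\<^sup>+x. ennreal (\<bar>u x\<bar> powr p) \<partial>lebesgue_on \<Omega>) \<le> ennreal (A powr p)"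
      and gint: "(\<integral>\<^sup>+x. ennreal (norm (g x) powr p) \<partial>lebesgue_on \<Omega>) \<le> ennreal (A powr p)"
    have g: "g \<in> borel_measurable (lebesgue_on \<Omega>)"
      using wg op unfolding has_weak_gradient_def by (blast intro: locally_integrable_measurable)
    have ui: "integrable (lebesgue_on \<Omega>) u"
      using uint p by (intro integrable_of_powr[OF finm u, of p]) (auto simp: order_le_less_trans)
    have gi: "integrable (lebesgue_on \<Omega>) g"
      using gint p by (intro integrable_of_powr[OF finm g, of p]) (auto simp: order_le_less_trans)
    have wm: "(\<lambda>x. norm (g x)) \<in> borel_measurable (lebesgue_on \<Omega>)" using g by measurable
    have wi: "integrable (lebesgue_on \<Omega>) (\<lambda>x. norm (g x))" using gi by simp
    define \<mu> where "\<mu> = dyadic_maximal \<Omega> R (\<lambda>y. ennreal (norm (g y)))"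
    define M where "M x = enn2real (\<mu> x)" for x
    have max: "AE x in lebesgue_on \<Omega>. \<mu> x \<noteq> \<infinity>"
      "(\<integral>\<^sup>+x. ennreal (M x powr p) \<partial>lebesgue_on \<Omega>) \<le> ennreal (KM * A powr p)"
      using KM(2)[OF wm norm_ge_zero gint] unfolding \<mu>_def M_def by (rule conjunct1, rule conjunct2)
    have M0: "0 \<le> M x" for x by (simp add: M_def)
    have Mm[measurable]: "M \<in> borel_measurable (lebesgue_on \<Omega>)"
    proof -
      have "\<mu> \<in> borel_measurable (lebesgue_on \<Omega>)"
        unfolding \<mu>_def using wm g by (intro dyadic_maximal_measurable lm) measurable
      then show ?thesis unfolding M_def by measurable
    qed
    obtain Z1 where Z1: "Z1 \<in> null_sets lebesgue" "\<And>x. x \<in> \<Omega> - Z1 \<Longrightarrow> \<mu> x \<noteq> \<infinity>"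
      by (rule AE_lebesgue_on_null_set[OF max(1) Om]) blast
    obtain Z2 where Z2: "Z2 \<in> null_sets lebesgue"
      "\<And>x e. x \<in> \<Omega> - Z2 \<Longrightarrow> 0 < e \<Longrightarrow> \<exists>d>0. \<forall>h. 0 < h \<longrightarrow> h < d \<longrightarrow> cbox x (x + h *\<^sub>R One) \<subseteq> \<Omega> \<longrightarrow>
       (LINT y|lebesgue_on \<Omega>. \<bar>u y - u x\<bar> * indicator (cbox x (x + h *\<^sub>R One)) y) \<le> e * h ^ DIM(real ^ 'n)"
      by (rule lebesgue_corner_points[OF ui Om]) blast
    define Z where "Z = Z1 \<union> Z2"
    have Z: "Z \<in> null_sets lebesgue" using Z1(1) Z2(1) by (simp add: Z_def null_sets.Un)
    \<comment> \<open>The second summand settles pairs at distance at least \<open>\<delta>\<close>,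
      for which \<open>\<bar>u x\<bar> + \<bar>u y\<bar>\<close> is at most the distance times the
      two summands.\<close>
    define h where "h x = C1 * M x + \<bar>u x\<bar> / \<delta>" for x
    have h0: "0 \<le> h x" for x using C1 M0 d by (simp add: h_def)
    have hm: "h \<in> borel_measurable (lebesgue_on \<Omega>)" unfolding h_def[abs_def] using u by measurable
    have ballM: "(LINT y|lebesgue_on \<Omega>. norm (g y) * indicator {y. norm (y - c) < \<rho>} y) \<le> (2 * r) ^ CARD('n) * M x"
      if "x \<in> \<Omega> - Z" "norm (c - x) + \<rho> \<le> r" "0 < r" "r < R" for x c \<rho> r
      unfolding M_def \<mu>_def
    proof (rule integral_ball_le_dyadic_maximal[OF wi norm_ge_zero R(1) _ that(2-4)])
      show "dyadic_maximal \<Omega> R (\<lambda>y. ennreal (norm (g y))) x \<noteq> \<infinity>"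
        using Z1(2)[of x] that(1) by (simp add: \<mu>_def Z_def)
    qed
    have leb: "\<exists>d>0. \<forall>h. 0 < h \<longrightarrow> h < d \<longrightarrow> cbox x (x + h *\<^sub>R One) \<subseteq> \<Omega> \<longrightarrow>
       (LINT y|lebesgue_on \<Omega>. \<bar>u y - u x\<bar> * indicator (cbox x (x + h *\<^sub>R One)) y) \<le> e * h ^ CARD('n)"
      if "x \<in> \<Omega> - Z" "0 < e" for x e
    proof -
      have "x \<in> \<Omega> - Z2" using that(1) by (simp add: Z_def)
      from Z2(2)[OF this that(2)] show ?thesis by simp
    qed
    have "\<bar>u x - u y\<bar> \<le> norm (x - y) powr 1 * (h x + h y)" if xy: "x \<in> \<Omega> - Z" "y \<in> \<Omega> - Z" for x y
    proof (cases "norm (x - y) < \<delta>")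
      case False
      have "\<bar>u x\<bar> / \<delta> \<le> h x" "\<bar>u y\<bar> / \<delta> \<le> h y" using C1 M0 by (simp_all add: h_def)
      then have "\<delta> * (\<bar>u x\<bar> / \<delta> + \<bar>u y\<bar> / \<delta>) \<le> norm (x - y) * (h x + h y)"
        using False d h0 by (intro mult_mono add_mono) auto
      moreover have "\<delta> * (\<bar>u x\<bar> / \<delta> + \<bar>u y\<bar> / \<delta>) = \<bar>u x\<bar> + \<bar>u y\<bar>" using d by (simp add: distrib_left)
      ultimately have "\<bar>u x\<bar> + \<bar>u y\<bar> \<le> norm (x - y) * (h x + h y)" by simp
      then show ?thesis by simp
    next
      case True
      show ?thesis
      proof (cases "x = y")
        case False
        define r where "r = norm (x - y)"
        have r: "0 < r" "r < \<delta>" using False True by (simp_all add: r_def)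
        define t where "t = 4 * r / \<kappa>"
        have t: "0 < t" "t \<le> T" "\<kappa> * t / 4 = r" using r k by (simp_all add: t_def \<delta>_def field_simps)
        have tR: "2 * t < R" using t R by linarith
        have xyO: "x \<in> \<Omega>" "y \<in> \<Omega>" using xy by auto
        have "norm (x - y) < T" using r d by (simp add: r_def)
        from cone[OF xyO this] obtain e where e: "norm e = 1" and
          ce: "\<forall>t. 0 < t \<longrightarrow> t \<le> T \<longrightarrow> ball (x + t *\<^sub>R e) (\<kappa> * t) \<subseteq> \<Omega> \<and> ball (y + t *\<^sub>R e) (\<kappa> * t) \<subseteq> \<Omega>"
          by (elim exE conjE)
        have cex: "ball (x + t *\<^sub>R e) (\<kappa> * t) \<subseteq> \<Omega>" and cey: "ball (y + t *\<^sub>R e) (\<kappa> * t) \<subseteq> \<Omega>"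
          if "0 < t" "t \<le> T" for t using ce that by (simp_all)
        define F where "F z = (LINT y|lebesgue_on \<Omega>. u y * bump (z + t *\<^sub>R e) (\<kappa> * t / 2) y)" for z
        have 1: "\<bar>F x - I * u x\<bar> \<le> 2 * t * (E * M x)"
          unfolding F_def I_def E_def
          by (rule bump_average_cone[OF wg ui gi bdd op xyO(1) k e T R(2) cex M0 ballM[OF xy(1)] leb[OF xy(1)] t(1,2)])
        have 2: "\<bar>F y - I * u y\<bar> \<le> 2 * t * (E * M y)"
          unfolding F_def I_def E_def
          by (rule bump_average_cone[OF wg ui gi bdd op xyO(2) k e T R(2) cey M0 ballM[OF xy(2)] leb[OF xy(2)] t(1,2)])
        have yx: "norm (y - x) \<le> \<kappa> * t / 4" unfolding t(3) r_def by (simp add: norm_minus_commute)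
        have 3: "\<bar>F y - F x\<bar> \<le> norm (y - x) * (E * M x)"
          unfolding F_def E_def
          by (rule bump_average_translate[OF wg ui gi bdd k e t(1) tR cex[OF t(1,2)] ballM[OF xy(1)] yx])
        have "norm (y - x) = r" by (simp add: r_def norm_minus_commute)
        then have 4: "\<bar>F y - F x\<bar> \<le> r * (E * M x)" using 3 by simp
        have "I * \<bar>u x - u y\<bar> = \<bar>I * u x - I * u y\<bar>" using I by (simp only: right_diff_distrib[symmetric] abs_mult abs_of_pos)
        also have "\<dots> \<le> 2 * t * (E * M x) + r * (E * M x) + 2 * t * (E * M y)" using 1 2 4 by linarith
        also have "\<dots> \<le> 2 * t * (E * M x) + r * (E * M x) + 2 * t * (E * M y) + r * (E * M y)"
          using r E M0[of y] by simp
        also have "\<dots> = ((8 / \<kappa> + 1) * E) * (r * (M x + M y))" using k by (simp add: t_def field_simps)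
        also have "\<dots> = I * (C1 * (r * (M x + M y)))" using I by (simp add: C1_def)
        finally have "\<bar>u x - u y\<bar> \<le> C1 * (r * (M x + M y))" using I by simp
        also have "\<dots> = r * (C1 * M x + C1 * M y)" by (simp add: algebra_simps)
        also have "\<dots> \<le> r * (h x + h y)" using r d by (intro mult_left_mono add_mono) (simp_all add: h_def)
        finally show ?thesis by (simp add: r_def)
      qed (use h0 in simp)
    qed
    then have "hajlasz_gradient \<Omega> Z 1 u h"
      unfolding hajlasz_gradient_def using Z hm h0 by simp
    moreover have "(\<integral>\<^sup>+x. ennreal (h x powr p) \<partial>lebesgue_on \<Omega>) \<le> ennreal ((K * A) powr p)"
    proof -
      define a where "a = 2 powr p * C1 powr p"
      define b where "b = 2 powr p * (1 / \<delta>) powr p"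
      have ab: "0 \<le> a" "0 \<le> b" by (simp_all add: a_def b_def)
      have "(\<integral>\<^sup>+x. ennreal (h x powr p) \<partial>lebesgue_on \<Omega>)
        \<le> (\<integral>\<^sup>+x. ennreal a * ennreal (M x powr p) + ennreal b * ennreal (\<bar>u x\<bar> powr p) \<partial>lebesgue_on \<Omega>)"
      proof (intro nn_integral_mono)
        fix x
        define m where "m = max (C1 * M x) (\<bar>u x\<bar> / \<delta>)"
        have m0: "0 \<le> m" using C1 M0[of x] by (simp add: m_def le_max_iff_disj)
        have "h x \<le> 2 * m" unfolding h_def m_def by (simp add: max_def)
        then have "h x powr p \<le> (2 * m) powr p" using h0 p by (intro powr_mono2) auto
        also have "\<dots> = 2 powr p * m powr p" by (simp add: powr_mult)
        also have "\<dots> \<le> 2 powr p * ((C1 * M x) powr p + (\<bar>u x\<bar> / \<delta>) powr p)"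
          by (intro mult_left_mono) (auto simp: m_def max_def)
        also have "\<dots> = a * M x powr p + b * \<bar>u x\<bar> powr p"
          by (simp add: a_def b_def powr_mult powr_divide algebra_simps)
        finally have "ennreal (h x powr p) \<le> ennreal (a * M x powr p + b * \<bar>u x\<bar> powr p)" by (rule ennreal_leI)
        also have "\<dots> = ennreal a * ennreal (M x powr p) + ennreal b * ennreal (\<bar>u x\<bar> powr p)"
          using ab by (simp only: ennreal_plus ennreal_mult mult_nonneg_nonneg powr_ge_zero)
        finally show "ennreal (h x powr p) \<le> ennreal a * ennreal (M x powr p) + ennreal b * ennreal (\<bar>u x\<bar> powr p)" .
      qed
      also have "\<dots> = ennreal a * (\<integral>\<^sup>+x. ennreal (M x powr p) \<partial>lebesgue_on \<Omega>) + ennreal b * (\<integral>\<^sup>+x. ennreal (\<bar>u x\<bar> powr p) \<partial>lebesgue_on \<Omega>)"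
        using u by (simp add: nn_integral_add nn_integral_cmult)
      also have "\<dots> \<le> ennreal a * ennreal (KM * A powr p) + ennreal b * ennreal (A powr p)"
        by (intro add_mono mult_left_mono max(2) uint) auto
      also have "\<dots> = ennreal (a * (KM * A powr p) + b * A powr p)"
      proof -
        have "0 \<le> KM * A powr p" using KM by simp
        then show ?thesis using ab by (simp only: ennreal_plus ennreal_mult mult_nonneg_nonneg powr_ge_zero)
      qed
      also have "a * (KM * A powr p) + b * A powr p = K0 * A powr p"
        by (simp add: K0_def a_def b_def algebra_simps)
      also have "\<dots> = (K * A) powr p" by (simp add: powr_mult K(2))
      finally show ?thesis .
    qed
    ultimately show "\<exists>Z h. hajlasz_gradient \<Omega> Z 1 u h \<and> (\<integral>\<^sup>+x. ennreal (h x powr p) \<partial>lebesgue_on \<Omega>) \<le> ennreal ((K * A) powr p)"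
      by (intro exI conjI)
  qed
qed

section \<open>Sobolev embeddings\<close>

lemma ennreal_powr_ennreal: "0 \<le> a \<Longrightarrow> ennreal_powr (ennreal a) r = ennreal (a powr r)"
  by (simp add: ennreal_powr_def)

lemma ennreal_powr_less_top_iff: "ennreal_powr x r < \<infinity> \<longleftrightarrow> x < \<infinity>"
  by (simp add: ennreal_powr_def less_top)

lemma ennreal_powr_le_iff:
  assumes "0 < p" "0 \<le> a"
  shows "ennreal_powr x (1 / p) \<le> ennreal a \<longleftrightarrow> x \<le> ennreal (a powr p)"
proof (cases x)
  case (real r)
  have "r powr (1 / p) \<le> a \<longleftrightarrow> r \<le> a powr p"
  proof
    assume "r powr (1 / p) \<le> a"
    then have "(r powr (1 / p)) powr p \<le> a powr p" using assms by (intro powr_mono2) auto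
    then show "r \<le> a powr p" using real assms by (simp add: powr_powr)
  next
    assume "r \<le> a powr p"
    then have "r powr (1 / p) \<le> (a powr p) powr (1 / p)" using real assms by (intro powr_mono2) auto
    then show "r powr (1 / p) \<le> a" using assms by (simp add: powr_powr)
  qed
  then show ?thesis using real assms by (simp add: ennreal_powr_ennreal)
next
  case top
  then show ?thesis by (simp add: ennreal_powr_def top_unique)
qed

lemma ennreal_powr_inverse: "0 < p \<Longrightarrow> ennreal_powr (ennreal_powr x (1 / p)) p = x"
  by (cases x) (simp_all add: ennreal_powr_ennreal powr_powr, simp add: ennreal_powr_def)

text \<open>Both Gamma functions are evaluated at positive arguments. Positivity is what allows the
  constant to be divided out of the seminorm.\<close>

lemma sobolev_const_pos:
  assumes "0 < s" "s < 1" "1 \<le> p" "1 \<le> N"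
  shows "0 < sobolev_const N s p"
proof -
  have "0 < p * s" using assms by simp
  moreover have "1 \<le> real N" using assms(4) by simp
  ultimately have "0 < p * s + p + real N - 2" using assms(3) by linarith
  then have "0 < (p * s + p + real N - 2) / 2" by simp
  then show ?thesis using assms by (simp add: sobolev_const_def Gamma_real_pos)
qed

lemma sobolev_norm_leD:
  assumes "0 < s" "0 < p" "0 \<le> A" and le: "sobolev_norm \<Omega> s p u \<le> ennreal A"
  shows "sobolev_seminorm \<Omega> s p u \<le> ennreal A" "Lp_norm \<Omega> p u \<le> ennreal A"
proof -
  have "ennreal_powr (sobolev_seminorm \<Omega> s p u) p + ennreal_powr (Lp_norm \<Omega> p u) p \<le> ennreal (A powr p)"
    using le assms ennreal_powr_le_iff[OF assms(2,3)] by (simp add: sobolev_norm_def)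
  then have 1: "ennreal_powr (sobolev_seminorm \<Omega> s p u) p \<le> ennreal (A powr p)"
    and 2: "ennreal_powr (Lp_norm \<Omega> p u) p \<le> ennreal (A powr p)"
    by (rule order_trans[rotated], simp)+
  have "x \<le> ennreal A" if "ennreal_powr x p \<le> ennreal (A powr p)" for x
  proof -
    have "ennreal_powr x p = ennreal_powr x (1 / (1 / p))" by simp
    then have "x \<le> ennreal ((A powr p) powr (1 / p))"
      using that ennreal_powr_le_iff[of "1 / p" "A powr p" x] assms by simp
    then show ?thesis using assms by (simp add: powr_powr)
  qed
  with 1 2 show "sobolev_seminorm \<Omega> s p u \<le> ennreal A" "Lp_norm \<Omega> p u \<le> ennreal A" by blast+
qed

lemma Lp_norm_le_iff:
  "0 < p \<Longrightarrow> 0 \<le> A \<Longrightarrow> Lp_norm \<Omega> p f \<le> ennreal A \<longleftrightarrow>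
    (\<integral>\<^sup>+x. ennreal (norm (f x) powr p) \<partial>lebesgue_on \<Omega>) \<le> ennreal (A powr p)"
  unfolding Lp_norm_def by (rule ennreal_powr_le_iff)

text \<open>An arbitrary positive bound \<open>A\<close> takes the place of the norm, so that
  functions of norm zero need no separate treatment when dividing by it. For \<open>s = 1\<close>
  the hypothesis \<open>s \<noteq> p\<close> becomes \<open>1 < p\<close>.\<close>

lemma hajlasz_of_sobolev:
  fixes \<Omega> :: "(real ^ 'n) set"
  assumes dom: "bounded_lipschitz_domain \<Omega>" and s: "0 < s" "s \<le> 1" "1 \<le> p" "s \<noteq> p"
  shows "\<exists>K>0. \<forall>u A. u \<in> sobolev_space \<Omega> s p \<longrightarrow> 0 < A \<longrightarrow> sobolev_norm \<Omega> s p u \<le> ennreal A \<longrightarrow>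
    (\<exists>Z g. hajlasz_gradient \<Omega> Z s u g \<and> (\<integral>\<^sup>+x. ennreal (g x powr p) \<partial>lebesgue_on \<Omega>) \<le> ennreal ((K * A) powr p))"
proof (cases "s = 1")
  case True
  then have p: "1 < p" using s by simp
  show ?thesis
  proof (rule hajlasz_of_weak_gradient[OF dom p])
    fix K
    assume *: "0 < K" "\<And>u g A. u \<in> borel_measurable (lebesgue_on \<Omega>) \<Longrightarrow> has_weak_gradient \<Omega> u g \<Longrightarrow> 0 < A \<Longrightarrow>
       (\<integral>\<^sup>+x. ennreal (\<bar>u x\<bar> powr p) \<partial>lebesgue_on \<Omega>) \<le> ennreal (A powr p) \<Longrightarrow>
       (\<integral>\<^sup>+x. ennreal (norm (g x) powr p) \<partial>lebesgue_on \<Omega>) \<le> ennreal (A powr p) \<Longrightarrow>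
       \<exists>Z h. hajlasz_gradient \<Omega> Z 1 u h \<and> (\<integral>\<^sup>+x. ennreal (h x powr p) \<partial>lebesgue_on \<Omega>) \<le> ennreal ((K * A) powr p)"
    show ?thesis
    proof (rule exI[of _ K], rule conjI[OF *(1)], intro allI impI)
      fix u A
      assume u: "u \<in> sobolev_space \<Omega> s p" and A: "0 < A" and le: "sobolev_norm \<Omega> s p u \<le> ennreal A"
      have semi: "sobolev_seminorm \<Omega> s p u \<le> ennreal A" and Lp: "Lp_norm \<Omega> p u \<le> ennreal A"
        using sobolev_norm_leD[OF s(1) _ _ le] s A by auto
      have ex: "\<exists>g. has_weak_gradient \<Omega> u g"
      proof (rule ccontr)
        assume "\<not> ?thesis"
        then have "sobolev_seminorm \<Omega> s p u = \<infinity>" using True unfolding sobolev_seminorm_def by auto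
        then show False using semi by (simp add: top_unique)
      qed
      then have wg: "has_weak_gradient \<Omega> u (weak_gradient \<Omega> u)" unfolding weak_gradient_def by (rule someI_ex)
      have "sobolev_seminorm \<Omega> s p u = Lp_norm \<Omega> p (weak_gradient \<Omega> u)"
        using True ex by (simp add: sobolev_seminorm_def)
      then have gi: "(\<integral>\<^sup>+x. ennreal (norm (weak_gradient \<Omega> u x) powr p) \<partial>lebesgue_on \<Omega>) \<le> ennreal (A powr p)"
        using semi Lp_norm_le_iff[of p A \<Omega> "weak_gradient \<Omega> u"] p A by simp
      have ui: "(\<integral>\<^sup>+x. ennreal (\<bar>u x\<bar> powr p) \<partial>lebesgue_on \<Omega>) \<le> ennreal (A powr p)"
        using Lp Lp_norm_le_iff[of p A \<Omega> u] p A by simp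
      have "u \<in> borel_measurable (lebesgue_on \<Omega>)" using u by (simp add: sobolev_space_def)
      from *(2)[OF this wg A ui gi]
      show "\<exists>Z g. hajlasz_gradient \<Omega> Z s u g \<and> (\<integral>\<^sup>+x. ennreal (g x powr p) \<partial>lebesgue_on \<Omega>) \<le> ennreal ((K * A) powr p)"
        unfolding True .
    qed
  qed
next
  case False
  then have s1: "s < 1" using s by simp
  have Om: "\<Omega> \<in> sets lebesgue" and bdd: "bounded \<Omega>" using dom by (auto simp: bounded_lipschitz_domain_def)
  define k where "k = sobolev_const CARD('n) s p"
  have k: "0 < k" unfolding k_def using s s1 by (intro sobolev_const_pos) (simp_all add: Suc_leI)
  \<comment> \<open>Since \<open>B powr p = 1 / k\<close>, a bound \<open>A\<close> on the seminorm
    becomes the bound \<open>B * A\<close> for the double integral without its constant.\<close>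
  define B where "B = k powr (- 1 / p)"
  have "B powr p = k powr (- 1)" unfolding B_def powr_powr using s by simp
  also have "\<dots> = 1 / k" using k powr_minus_divide[of k 1] by simp
  finally have B: "0 < B" "B powr p = 1 / k" using k by (simp_all add: B_def)
  obtain c R where dense: "measure_dense \<Omega> c R" by (rule bounded_lipschitz_domain_measure_dense[OF dom])
  show ?thesis
  proof (rule hajlasz_of_gagliardo[OF dense Om bdd s(1,3)])
    fix K
    assume *: "0 < K" "\<And>u A. u \<in> borel_measurable (lebesgue_on \<Omega>) \<Longrightarrow> 0 < A \<Longrightarrow>
       (\<integral>\<^sup>+(x,y). ennreal (\<bar>u x - u y\<bar> powr p / norm (x - y) powr (real DIM(real ^ 'n) + s * p))
           \<partial>(lebesgue_on \<Omega> \<Otimes>\<^sub>M lebesgue_on \<Omega>)) \<le> ennreal (A powr p) \<Longrightarrow>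
       \<exists>Z g. hajlasz_gradient \<Omega> Z s u g \<and> (\<integral>\<^sup>+x. ennreal (g x powr p) \<partial>lebesgue_on \<Omega>) \<le> ennreal ((K * A) powr p)"
    show ?thesis
    proof (rule exI[of _ "K * B"], rule conjI[OF mult_pos_pos[OF *(1) B(1)]], intro allI impI)
      fix u A
      assume u: "u \<in> sobolev_space \<Omega> s p" and A: "0 < A" and le: "sobolev_norm \<Omega> s p u \<le> ennreal A"
      define J where "J = (\<integral>\<^sup>+(x,y). ennreal (\<bar>u x - u y\<bar> powr p / norm (x - y) powr (real CARD('n) + s * p))
           \<partial>(lebesgue_on \<Omega> \<Otimes>\<^sub>M lebesgue_on \<Omega>))"
      have "sobolev_seminorm \<Omega> s p u \<le> ennreal A"
        using sobolev_norm_leD[OF s(1) _ _ le] s A by auto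
      then have "ennreal_powr (ennreal k * J) (1 / p) \<le> ennreal A"
        using s False by (simp add: sobolev_seminorm_def k_def J_def)
      then have kJ: "ennreal k * J \<le> ennreal (A powr p)"
        using ennreal_powr_le_iff[of p A] s A by simp
      have "J = ennreal (1 / k) * (ennreal k * J)"
      proof -
        have "ennreal (1 / k) * ennreal k = 1" using k by (subst ennreal_mult[symmetric]) auto
        then show ?thesis by (simp only: mult.assoc[symmetric] mult_1)
      qed
      also have "\<dots> \<le> ennreal (1 / k) * ennreal (A powr p)" by (intro mult_left_mono kJ) simp
      also have "\<dots> = ennreal ((B * A) powr p)"
        using k by (subst ennreal_mult[symmetric]) (simp_all add: powr_mult B(2))
      finally have J: "J \<le> ennreal ((B * A) powr p)" .
      have um: "u \<in> borel_measurable (lebesgue_on \<Omega>)" using u by (simp add: sobolev_space_def)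
      have BA: "0 < B * A" using B A by simp
      show "\<exists>Z g. hajlasz_gradient \<Omega> Z s u g \<and> (\<integral>\<^sup>+x. ennreal (g x powr p) \<partial>lebesgue_on \<Omega>) \<le> ennreal ((K * B * A) powr p)"
        using *(2)[OF um BA] J by (simp add: J_def mult.assoc)
    qed
  qed
qed

section \<open>Scaling and the embedding inequality\<close>

lemma hajlasz_gradient_divide:
  assumes "hajlasz_gradient S Z s u g" "0 < (B::real)"
  shows "hajlasz_gradient S Z s (\<lambda>x. u x / B) (\<lambda>x. g x / B)"
proof -
  have g: "Z \<in> null_sets lebesgue" "g \<in> borel_measurable (lebesgue_on S)" "\<And>x. 0 \<le> g x"
    and uxy: "\<And>x y. x \<in> S - Z \<Longrightarrow> y \<in> S - Z \<Longrightarrow> \<bar>u x - u y\<bar> \<le> norm (x - y) powr s * (g x + g y)"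
    using assms by (auto simp: hajlasz_gradient_def)
  have "\<bar>u x / B - u y / B\<bar> \<le> norm (x - y) powr s * (g x / B + g y / B)" if "x \<in> S - Z" "y \<in> S - Z" for x y
  proof -
    have "\<bar>u x / B - u y / B\<bar> = \<bar>u x - u y\<bar> / B" using assms(2) by (simp add: diff_divide_distrib[symmetric] abs_divide)
    also have "\<dots> \<le> (norm (x - y) powr s * (g x + g y)) / B"
      using uxy[OF that] assms(2) by (intro divide_right_mono) auto
    also have "\<dots> = norm (x - y) powr s * (g x / B + g y / B)"
      by (simp only: add_divide_distrib[symmetric] times_divide_eq_right)
    finally show ?thesis .
  qed
  moreover have "(\<lambda>x. g x / B) \<in> borel_measurable (lebesgue_on S)" using g(2) by measurable
  ultimately show ?thesis using g assms(2) unfolding hajlasz_gradient_def by simp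
qed

lemma nn_integral_powr_divide:
  fixes f :: "'b \<Rightarrow> real"
  assumes B: "0 < B" and f: "f \<in> borel_measurable M"
  shows "(\<integral>\<^sup>+x. ennreal (\<bar>f x / B\<bar> powr p) \<partial>M) = ennreal (1 / B powr p) * (\<integral>\<^sup>+x. ennreal (\<bar>f x\<bar> powr p) \<partial>M)"
proof -
  have "ennreal (\<bar>f x / B\<bar> powr p) = ennreal (1 / B powr p) * ennreal (\<bar>f x\<bar> powr p)" for x
    using B by (simp add: ennreal_mult[symmetric] abs_divide powr_divide)
  moreover have "(\<lambda>x. ennreal (\<bar>f x\<bar> powr p)) \<in> borel_measurable M" using f by measurable
  ultimately show ?thesis by (simp add: nn_integral_cmult)
qed

lemma le_mult_of_ennreal_divide_le:
  assumes "0 < a" "0 \<le> c" "ennreal (1 / a) * x \<le> ennreal c"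
  shows "x \<le> ennreal (c * a)"
proof -
  have "ennreal a * ennreal (1 / a) = 1" using assms by (subst ennreal_mult[symmetric]) auto
  then have "x = ennreal a * (ennreal (1 / a) * x)" by (simp only: mult.assoc[symmetric] mult_1)
  also have "\<dots> \<le> ennreal a * ennreal c" by (intro mult_left_mono assms) simp
  also have "\<dots> = ennreal (c * a)" using assms by (subst ennreal_mult[symmetric]) (auto simp: mult.commute)
  finally show ?thesis .
qed

lemma ennreal_divide_le_one:
  assumes "0 < a" "x \<le> ennreal b" "b \<le> a"
  shows "ennreal (1 / a) * x \<le> 1"
proof -
  have "ennreal (1 / a) * x \<le> ennreal (1 / a) * ennreal a"
    using assms by (intro mult_left_mono) (auto intro: order_trans ennreal_leI)
  also have "\<dots> = 1" using assms by (subst ennreal_mult[symmetric]) auto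
  finally show ?thesis .
qed

text \<open>By homogeneity, dividing \<open>u\<close> and its Hajlasz gradient by a common multiple
  of \<open>A\<close> meets both normalisations of \<open>hajlasz_embedding\<close>. The three
  bounds are kept apart because membership in the target space asks for the first two and the norm
  estimate for the third.\<close>

lemma sobolev_norm_bound:
  fixes \<Omega> :: "(real ^ 'n) set"
  assumes dom: "bounded_lipschitz_domain \<Omega>"
    and s: "0 < s" "s \<le> 1" "1 \<le> p" "s * p < real CARD('n)" "s \<noteq> p"
    and s': "0 \<le> s'" "s' < s" "1 \<le> p'"
    and crit: "p' \<le> real CARD('n) * p / (real CARD('n) - (s - s') * p)"
  shows "\<exists>C>0. \<forall>u A. u \<in> sobolev_space \<Omega> s p \<longrightarrow> 0 < A \<longrightarrow> sobolev_norm \<Omega> s p u \<le> ennreal A \<longrightarrow>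
     Lp_norm \<Omega> p' u \<le> ennreal (C * A) \<and> sobolev_seminorm \<Omega> s' p' u \<le> ennreal (C * A) \<and>
     sobolev_norm \<Omega> s' p' u \<le> ennreal (C * A)"
proof -
  have Om: "\<Omega> \<in> sets lebesgue" and bdd: "bounded \<Omega>" and ne: "\<Omega> \<noteq> {}"
    using dom by (auto simp: bounded_lipschitz_domain_def)
  have "(s - s') * p \<le> s * p" using s s' by (intro mult_right_mono) auto
  then have "0 < real CARD('n) - (s - s') * p" using s by linarith
  then have crit': "p' * (real DIM(real ^ 'n) - (s - s') * p) \<le> real DIM(real ^ 'n) * p"
    using crit by (simp add: pos_le_divide_eq)
  have sN: "s * p < real DIM(real ^ 'n)" using s by simp
  obtain c R where dense: "measure_dense \<Omega> c R" by (rule bounded_lipschitz_domain_measure_dense[OF dom])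
  obtain K where K: "0 < K" "\<forall>u A. u \<in> sobolev_space \<Omega> s p \<longrightarrow> 0 < A \<longrightarrow> sobolev_norm \<Omega> s p u \<le> ennreal A \<longrightarrow>
    (\<exists>Z g. hajlasz_gradient \<Omega> Z s u g \<and> (\<integral>\<^sup>+x. ennreal (g x powr p) \<partial>lebesgue_on \<Omega>) \<le> ennreal ((K * A) powr p))"
    using hajlasz_of_sobolev[OF dom s(1-3,5)] by (elim exE conjE)
  \<comment> \<open>Only an upper bound for the constant matters on the target side, and the
    absolute value gives a nonnegative one for every \<open>s'\<close>.\<close>
  define k where "k = \<bar>sobolev_const CARD('n) s' p'\<bar>"
  have k: "0 \<le> k" "ennreal (sobolev_const CARD('n) s' p') \<le> ennreal k" by (auto simp: k_def intro: ennreal_leI)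
  show ?thesis
  proof (rule hajlasz_embedding[OF dense Om bdd ne s(1,3) sN s' crit'])
    fix C0
    assume C0: "0 < C0" "\<And>u g Z. u \<in> borel_measurable (lebesgue_on \<Omega>) \<Longrightarrow> hajlasz_gradient \<Omega> Z s u g \<Longrightarrow>
       (\<integral>\<^sup>+x. ennreal (g x powr p) \<partial>lebesgue_on \<Omega>) \<le> 1 \<Longrightarrow>
       (\<integral>\<^sup>+x. ennreal (\<bar>u x\<bar> powr p) \<partial>lebesgue_on \<Omega>) \<le> 1 \<Longrightarrow>
       (\<integral>\<^sup>+x. ennreal (\<bar>u x\<bar> powr p') \<partial>lebesgue_on \<Omega>) \<le> ennreal C0 \<and>
       (0 < s' \<longrightarrow> (\<integral>\<^sup>+(x,y). ennreal (\<bar>u x - u y\<bar> powr p' / norm (x - y) powr (real DIM(real ^ 'n) + s' * p'))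
           \<partial>(lebesgue_on \<Omega> \<Otimes>\<^sub>M lebesgue_on \<Omega>)) \<le> ennreal C0)"
    \<comment> \<open>In \<open>(k + 1) * C0\<close> the summand \<open>k\<close> pays for the
      seminorm and the summand 1 for the integral of \<open>\<bar>u x\<bar> powr p'\<close>.\<close>
    define C1 where "C1 = ((k + 1) * C0) powr (1 / p')"
    define C where "C = C1 * max 1 K"
    have C1: "0 < C1" "C1 powr p' = (k + 1) * C0" using C0 k s' by (auto simp: C1_def powr_powr)
    have C: "0 < C" using C1 by (simp add: C_def)
    show ?thesis
    proof (rule exI[of _ C], intro conjI allI impI C)
      fix u A
      assume u: "u \<in> sobolev_space \<Omega> s p" and A: "0 < A" and le: "sobolev_norm \<Omega> s p u \<le> ennreal A"
      have um: "u \<in> borel_measurable (lebesgue_on \<Omega>)" using u by (simp add: sobolev_space_def)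
      define B where "B = max 1 K * A"
      have AB: "1 * A \<le> B" "K * A \<le> B" unfolding B_def using A by (intro mult_right_mono; simp)+
      have B: "0 < B" using A AB by simp
      obtain Z g where haj: "hajlasz_gradient \<Omega> Z s u g"
        and gi: "(\<integral>\<^sup>+x. ennreal (g x powr p) \<partial>lebesgue_on \<Omega>) \<le> ennreal ((K * A) powr p)"
        using K(2)[rule_format, OF u A le] by (elim exE conjE)
      have g: "g \<in> borel_measurable (lebesgue_on \<Omega>)" "\<And>x. 0 \<le> g x" using haj by (auto simp: hajlasz_gradient_def)
      have "Lp_norm \<Omega> p u \<le> ennreal A" using sobolev_norm_leD[OF s(1) _ _ le] s A by auto
      then have ui: "(\<integral>\<^sup>+x. ennreal (\<bar>u x\<bar> powr p) \<partial>lebesgue_on \<Omega>) \<le> ennreal (A powr p)"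
        using Lp_norm_le_iff[of p A \<Omega> u] s A by simp
      have gi': "(\<integral>\<^sup>+x. ennreal ((g x / B) powr p) \<partial>lebesgue_on \<Omega>) \<le> 1"
      proof -
        have "(\<integral>\<^sup>+x. ennreal ((g x / B) powr p) \<partial>lebesgue_on \<Omega>) = (\<integral>\<^sup>+x. ennreal (\<bar>g x / B\<bar> powr p) \<partial>lebesgue_on \<Omega>)"
          using g(2) B by simp
        also have "\<dots> = ennreal (1 / B powr p) * (\<integral>\<^sup>+x. ennreal (\<bar>g x\<bar> powr p) \<partial>lebesgue_on \<Omega>)"
          by (rule nn_integral_powr_divide[OF B g(1)])
        also have "\<dots> \<le> 1"
          using gi g(2) B AB K A s by (intro ennreal_divide_le_one[of _ _ "(K * A) powr p"]) (auto intro!: powr_mono2)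
        finally show ?thesis .
      qed
      have ui': "(\<integral>\<^sup>+x. ennreal (\<bar>u x / B\<bar> powr p) \<partial>lebesgue_on \<Omega>) \<le> 1"
        unfolding nn_integral_powr_divide[OF B um]
        using ui B AB A s by (intro ennreal_divide_le_one[of _ _ "A powr p"]) (auto intro!: powr_mono2)
      have um': "(\<lambda>x. u x / B) \<in> borel_measurable (lebesgue_on \<Omega>)" using um by measurable
      note res = C0(2)[OF um' hajlasz_gradient_divide[OF haj B] gi' ui']
      have pos: "0 < B powr p'" using B by simp
      have Iu: "(\<integral>\<^sup>+x. ennreal (\<bar>u x\<bar> powr p') \<partial>lebesgue_on \<Omega>) \<le> ennreal (C0 * B powr p')"
        using conjunct1[OF res] C0 unfolding nn_integral_powr_divide[OF B um]
        by (intro le_mult_of_ennreal_divide_le pos) auto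
      have CA: "C * A = C1 * B" by (simp add: C_def B_def)
      have CAp: "(C * A) powr p' = (k + 1) * C0 * B powr p'" unfolding CA by (simp add: powr_mult C1)
      have CA0: "0 \<le> C * A" using C A by simp
      have "C0 * B powr p' \<le> (C * A) powr p'" unfolding CAp using k C0 by (simp add: mult_le_cancel_right)
      then have Lp: "Lp_norm \<Omega> p' u \<le> ennreal (C * A)"
        using order_trans[OF Iu ennreal_leI] Lp_norm_le_iff[of p' "C * A" \<Omega> u] s' CA0 by simp
      show "Lp_norm \<Omega> p' u \<le> ennreal (C * A)" by (rule Lp)
      have both: "sobolev_seminorm \<Omega> s' p' u \<le> ennreal (C * A) \<and> sobolev_norm \<Omega> s' p' u \<le> ennreal (C * A)"
      proof (cases "s' = 0")
        case True
        then show ?thesis using Lp by (simp add: sobolev_seminorm_def sobolev_norm_def)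
      next
        case False
        \<comment> \<open>As \<open>s' < s \<le> 1\<close>, the target seminorm is never that of a
          weak gradient.\<close>
        then have s0: "0 < s'" "s' \<noteq> 1" using s s' by auto
        define J where "J = (\<integral>\<^sup>+(x,y). ennreal (\<bar>u x - u y\<bar> powr p' / norm (x - y) powr (real CARD('n) + s' * p'))
           \<partial>(lebesgue_on \<Omega> \<Otimes>\<^sub>M lebesgue_on \<Omega>))"
        have "(\<integral>\<^sup>+(x,y). ennreal (\<bar>u x / B - u y / B\<bar> powr p' / norm (x - y) powr (real CARD('n) + s' * p'))
           \<partial>(lebesgue_on \<Omega> \<Otimes>\<^sub>M lebesgue_on \<Omega>)) \<le> ennreal C0"
          using conjunct2[OF res] s0 by simp
        moreover have "(\<integral>\<^sup>+(x,y). ennreal (\<bar>u x / B - u y / B\<bar> powr p' / norm (x - y) powr (real CARD('n) + s' * p'))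
           \<partial>(lebesgue_on \<Omega> \<Otimes>\<^sub>M lebesgue_on \<Omega>)) = ennreal (1 / B powr p') * J"
        proof -
          have "ennreal (\<bar>u x / B - u y / B\<bar> powr p' / norm (x - y) powr (real CARD('n) + s' * p'))
            = ennreal (1 / B powr p') * ennreal (\<bar>u x - u y\<bar> powr p' / norm (x - y) powr (real CARD('n) + s' * p'))" for x y
          proof -
            have "\<bar>u x / B - u y / B\<bar> = \<bar>u x - u y\<bar> / B"
              using B by (simp add: diff_divide_distrib[symmetric] abs_divide)
            then show ?thesis by (simp add: ennreal_mult[symmetric] powr_divide mult.commute)
          qed
          then have "(\<integral>\<^sup>+(x,y). ennreal (\<bar>u x / B - u y / B\<bar> powr p' / norm (x - y) powr (real CARD('n) + s' * p'))
              \<partial>(lebesgue_on \<Omega> \<Otimes>\<^sub>M lebesgue_on \<Omega>))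
            = (\<integral>\<^sup>+z. ennreal (1 / B powr p') * ennreal (\<bar>u (fst z) - u (snd z)\<bar> powr p' / norm (fst z - snd z) powr (real CARD('n) + s' * p'))
              \<partial>(lebesgue_on \<Omega> \<Otimes>\<^sub>M lebesgue_on \<Omega>))"
            by (simp add: case_prod_beta')
          also have "\<dots> = ennreal (1 / B powr p') * J"
            unfolding J_def case_prod_beta' by (rule nn_integral_cmult[OF gagliardo_integrand_measurable[OF um]])
          finally show ?thesis .
        qed
        ultimately have J: "J \<le> ennreal (C0 * B powr p')" using C0 by (intro le_mult_of_ennreal_divide_le pos) auto
        have kJ: "ennreal (sobolev_const CARD('n) s' p') * J \<le> ennreal (k * (C0 * B powr p'))"
          using k J C0 by (subst ennreal_mult) (auto intro!: mult_mono)
        have "k * (C0 * B powr p') \<le> (C * A) powr p'" unfolding CAp using k C0 by (simp add: distrib_right)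
        then have "ennreal (sobolev_const CARD('n) s' p') * J \<le> ennreal ((C * A) powr p')"
          using kJ by (meson ennreal_leI order_trans)
        then have semi: "sobolev_seminorm \<Omega> s' p' u \<le> ennreal (C * A)"
          using False s0 s' CA0 ennreal_powr_le_iff[of p' "C * A"] by (simp add: sobolev_seminorm_def J_def)
        have e1: "ennreal_powr (sobolev_seminorm \<Omega> s' p' u) p' = ennreal (sobolev_const CARD('n) s' p') * J"
          using False s0 s' by (simp add: sobolev_seminorm_def J_def ennreal_powr_inverse)
        have e2: "ennreal_powr (Lp_norm \<Omega> p' u) p' = (\<integral>\<^sup>+x. ennreal (\<bar>u x\<bar> powr p') \<partial>lebesgue_on \<Omega>)"
          using s' by (simp add: Lp_norm_def ennreal_powr_inverse)
        have "ennreal_powr (sobolev_seminorm \<Omega> s' p' u) p' + ennreal_powr (Lp_norm \<Omega> p' u) p'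
          \<le> ennreal (k * (C0 * B powr p')) + ennreal (C0 * B powr p')"
          unfolding e1 e2 by (intro add_mono kJ Iu)
        also have "\<dots> = ennreal (k * (C0 * B powr p') + C0 * B powr p')"
          using k C0 by (intro ennreal_plus[symmetric]) auto
        also have "k * (C0 * B powr p') + C0 * B powr p' = (C * A) powr p'" unfolding CAp by (simp add: algebra_simps)
        finally have "sobolev_norm \<Omega> s' p' u \<le> ennreal (C * A)"
          using False s' CA0 ennreal_powr_le_iff[of p' "C * A"] by (simp add: sobolev_norm_def)
        with semi show ?thesis by blast
      qed
      show "sobolev_seminorm \<Omega> s' p' u \<le> ennreal (C * A)" by (rule conjunct1[OF both])
      show "sobolev_norm \<Omega> s' p' u \<le> ennreal (C * A)" by (rule conjunct2[OF both])
    qed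
  qed
qed

theorem sobolev_embedding:
  fixes \<Omega> :: "(real ^ 'n) set"
  assumes dom: "bounded_lipschitz_domain \<Omega>"
    and s: "0 < s" "s \<le> 1" "1 \<le> p" "s * p < real CARD('n)" "s \<noteq> p"
    and s': "0 \<le> s'" "s' < s" "1 \<le> p'"
    and crit: "p' \<le> real CARD('n) * p / (real CARD('n) - (s - s') * p)"
  shows "continuously_embedded \<Omega> s p s' p'"
proof -
  obtain C where C: "0 < C" "\<forall>u A. u \<in> sobolev_space \<Omega> s p \<longrightarrow> 0 < A \<longrightarrow> sobolev_norm \<Omega> s p u \<le> ennreal A \<longrightarrow>
     Lp_norm \<Omega> p' u \<le> ennreal (C * A) \<and> sobolev_seminorm \<Omega> s' p' u \<le> ennreal (C * A) \<and>
     sobolev_norm \<Omega> s' p' u \<le> ennreal (C * A)"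
    using sobolev_norm_bound[OF assms] by (elim exE conjE)
  have fin: "sobolev_norm \<Omega> s p u < \<infinity>" if "u \<in> sobolev_space \<Omega> s p" for u
  proof -
    have "ennreal_powr (sobolev_seminorm \<Omega> s p u) p + ennreal_powr (Lp_norm \<Omega> p u) p < \<infinity>"
      using that by (simp add: sobolev_space_def ennreal_powr_less_top_iff[unfolded infinity_ennreal_def])
    then show ?thesis using s by (simp add: sobolev_norm_def ennreal_powr_less_top_iff[unfolded infinity_ennreal_def])
  qed
  have main: "Lp_norm \<Omega> p' u \<le> ennreal (C * A)" "sobolev_seminorm \<Omega> s' p' u \<le> ennreal (C * A)"
     "sobolev_norm \<Omega> s' p' u \<le> ennreal (C * A)"
    if "u \<in> sobolev_space \<Omega> s p" "0 < A" "sobolev_norm \<Omega> s p u \<le> ennreal A" for u A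
    using C(2)[rule_format, OF that] by auto
  have sub: "u \<in> sobolev_space \<Omega> s' p'" if u: "u \<in> sobolev_space \<Omega> s p" for u
  proof -
    obtain a where a: "sobolev_norm \<Omega> s p u = ennreal a" "0 \<le> a"
      using fin[OF u] by (cases "sobolev_norm \<Omega> s p u") auto
    have le: "0 < a + 1" "sobolev_norm \<Omega> s p u \<le> ennreal (a + 1)" using a by (auto intro: ennreal_leI)
    have "x < \<infinity>" if "x \<le> ennreal b" for x b using that by (simp add: le_less_trans)
    then show ?thesis using main[OF u le] u by (simp add: sobolev_space_def)
  qed
  have bound: "sobolev_norm \<Omega> s' p' u \<le> ennreal C * sobolev_norm \<Omega> s p u" if u: "u \<in> sobolev_space \<Omega> s p" for u
  proof -
    obtain a where a: "sobolev_norm \<Omega> s p u = ennreal a" "0 \<le> a"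
      using fin[OF u] by (cases "sobolev_norm \<Omega> s p u") auto
    \<comment> \<open>The norm \<open>a\<close> may be 0, whereas the bound is available for
      positive \<open>A\<close> only; it is applied with \<open>a + e / C\<close>, and
      \<open>e\<close> then tends to 0.\<close>
    have "sobolev_norm \<Omega> s' p' u \<le> ennreal (C * a) + ennreal e" if "0 < e" for e
    proof -
      have "0 < a + e / C" "sobolev_norm \<Omega> s p u \<le> ennreal (a + e / C)"
        using a that C(1) by (auto intro!: ennreal_leI add_nonneg_pos)
      from main(3)[OF u this] have "sobolev_norm \<Omega> s' p' u \<le> ennreal (C * (a + e / C))" .
      also have "C * (a + e / C) = C * a + e" using C(1) by (simp add: distrib_left)
      also have "ennreal (C * a + e) = ennreal (C * a) + ennreal e"
        using a C(1) that by (intro ennreal_plus) auto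
      finally show ?thesis .
    qed
    then have "sobolev_norm \<Omega> s' p' u \<le> ennreal (C * a)" by (rule ennreal_le_epsilon)
    then show ?thesis using a C(1) by (simp add: ennreal_mult)
  qed
  show ?thesis unfolding continuously_embedded_def
  proof (intro conjI exI[of _ C] ballI subsetI C(1))
    fix u assume u: "u \<in> sobolev_space \<Omega> s p"
    show "u \<in> sobolev_space \<Omega> s' p'" by (rule sub[OF u])
    show "sobolev_norm \<Omega> s' p' u \<le> ennreal C * sobolev_norm \<Omega> s p u" by (rule bound[OF u])
  qed
qed

text \<open>In the coordinates \<open>s\<close> and \<open>1 / p\<close> the curve is a segment, and
  the critical condition reads \<open>1 / p - 1 / p' \<le> (s - s') / N\<close>, a bound on its
  slope that every subsegment inherits. What remains is that the point at \<open>\<theta>1\<close>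
  satisfies the hypotheses imposed on a source space.\<close>

theorem sobolev_embedding_along_curve:
  fixes \<Omega> :: "(real ^ 'n) set"
  assumes dom: "bounded_lipschitz_domain \<Omega>"
    and s: "0 < s" "s \<le> 1" "1 \<le> p" "s * p < real CARD('n)" "s \<noteq> p"
    and s': "0 \<le> s'" "s' < s" "1 \<le> p'"
    and crit: "p' \<le> real CARD('n) * p / (real CARD('n) - (s - s') * p)"
    and th: "0 \<le> \<theta>1" "\<theta>1 \<le> \<theta>2" "\<theta>2 \<le> 1"
  defines "S \<theta> \<equiv> \<theta> * s' + (1 - \<theta>) * s" and "P \<theta> \<equiv> p * p' / (p' + \<theta> * (p - p'))"
  shows "continuously_embedded \<Omega> (S \<theta>1) (P \<theta>1) (S \<theta>2) (P \<theta>2)"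
proof (cases "\<theta>1 = \<theta>2")
  \<comment> \<open>\<open>sobolev_embedding\<close> asks for a strict loss of smoothness, so equal
    parameters are treated by the identity with constant one.\<close>
  case True
  then show ?thesis by (auto simp: continuously_embedded_def intro!: exI[of _ 1])
next
  case False
  then have lt: "\<theta>1 < \<theta>2" using th by simp
  define N where "N = real CARD('n)"
  \<comment> \<open>\<open>D \<theta>\<close> is \<open>p * p' / P \<theta>\<close>, an affine
    function of \<open>\<theta>\<close>; in terms of it all conditions become linear.\<close>
  define D where "D \<theta> = p' + \<theta> * (p - p')" for \<theta>
  define d where "d = s - s'"
  have d: "0 < d" using s' by (simp add: d_def)
  have pp: "0 < p * p'" using s s' by simp
  have Dpos: "0 < D \<theta>" "D \<theta> \<le> p * p'" if "0 \<le> \<theta>" "\<theta> \<le> 1" for \<theta>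
  proof -
    have D: "D \<theta> = (1 - \<theta>) * p' + \<theta> * p" by (simp add: D_def algebra_simps)
    have "(1 - \<theta>) * 1 + \<theta> * 1 \<le> (1 - \<theta>) * p' + \<theta> * p" using that s s' by (intro add_mono mult_left_mono) auto
    then show "0 < D \<theta>" using D by simp
    have "1 * p' \<le> p * p'" "p * 1 \<le> p * p'" using s s' by (auto intro!: mult_right_mono mult_left_mono)
    then have "(1 - \<theta>) * p' + \<theta> * p \<le> (1 - \<theta>) * (p * p') + \<theta> * (p * p')"
      using that by (intro add_mono mult_left_mono) auto
    then show "D \<theta> \<le> p * p'" using D by (simp add: algebra_simps)
  qed
  have PD: "P \<theta> = p * p' / D \<theta>" for \<theta> by (simp add: P_def D_def)
  have SD: "S \<theta> = s - \<theta> * d" for \<theta> by (simp add: S_def d_def algebra_simps)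
  have "d * p \<le> s * p" using s s' by (intro mult_right_mono) (auto simp: d_def)
  then have "0 < N - d * p" using s(4) unfolding N_def by linarith
  \<comment> \<open>The critical condition with its denominator cleared. Multiplied by
    \<open>\<theta>1\<close> it gives \<open>S \<theta>1 * P \<theta>1 < N\<close>, multiplied by
    \<open>\<theta>2 - \<theta>1\<close> the critical condition between the two points of the
    curve.\<close>
  then have star: "N * p' - N * p \<le> d * (p * p')"
    using crit by (simp add: N_def d_def pos_le_divide_eq algebra_simps)
  have t1: "0 \<le> \<theta>1" "\<theta>1 \<le> 1" "0 \<le> \<theta>2" "\<theta>2 \<le> 1" using th lt by auto
  note D1 = Dpos[OF t1(1,2)] and D2 = Dpos[OF t1(3,4)]
  have P1: "1 \<le> P \<theta>1" "1 \<le> P \<theta>2" using D1 D2 by (simp_all add: PD)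
  have S12: "S \<theta>1 - S \<theta>2 = (\<theta>2 - \<theta>1) * d" by (simp add: SD algebra_simps)
  have "0 < (\<theta>2 - \<theta>1) * d" using lt d by simp
  then have Slt: "S \<theta>2 < S \<theta>1" using S12 by linarith
  have "\<theta>2 * d \<le> 1 * d" using t1 d by (intro mult_right_mono) auto
  then have S2: "0 \<le> S \<theta>2" using s'(1) d_def unfolding SD by linarith
  have S1: "0 < S \<theta>1" "S \<theta>1 \<le> 1"
  proof -
    show "0 < S \<theta>1" using Slt S2 by simp
    have "0 \<le> \<theta>1 * d" using t1 d by simp
    then show "S \<theta>1 \<le> 1" using s by (simp add: SD)
  qed
  \<comment> \<open>At \<open>\<theta>1 = 0\<close> this is the hypothesis
    \<open>s \<noteq> p\<close>; for later parameters
    \<open>S \<theta>1 < 1 \<le> P \<theta>1\<close>.\<close>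
  have ne: "S \<theta>1 \<noteq> P \<theta>1"
  proof (cases "\<theta>1 = 0")
    case True
    then show ?thesis using s s' by (simp add: S_def P_def)
  next
    case False
    then have "0 < \<theta>1 * d" using t1 d by simp
    then have "S \<theta>1 < 1" using s by (simp add: SD)
    then show ?thesis using P1 by simp
  qed
  have SP: "S \<theta>1 * P \<theta>1 < N"
  proof -
    have "\<theta>1 * (N * p' - N * p) \<le> \<theta>1 * (d * (p * p'))" using t1 star by (intro mult_left_mono)
    moreover have "(s * p) * p' < N * p'" using s s' by (intro mult_strict_right_mono) (auto simp: N_def)
    moreover have "S \<theta>1 * (p * p') = (s * p) * p' - \<theta>1 * (d * (p * p'))" by (simp add: SD algebra_simps)
    moreover have "N * D \<theta>1 = N * p' - \<theta>1 * (N * p' - N * p)" by (simp add: D_def algebra_simps)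
    ultimately have "S \<theta>1 * (p * p') < N * D \<theta>1" by linarith
    then show ?thesis using D1 by (simp add: PD pos_divide_less_eq)
  qed
  have den: "0 < N - (S \<theta>1 - S \<theta>2) * P \<theta>1"
  proof -
    have "(S \<theta>1 - S \<theta>2) * P \<theta>1 \<le> S \<theta>1 * P \<theta>1" using S2 P1 by (intro mult_right_mono) auto
    then show ?thesis using SP by linarith
  qed
  have crit2: "P \<theta>2 \<le> N * P \<theta>1 / (N - (S \<theta>1 - S \<theta>2) * P \<theta>1)"
  proof -
    have "(\<theta>2 - \<theta>1) * (N * p' - N * p) \<le> (\<theta>2 - \<theta>1) * (d * (p * p'))" using lt star by (intro mult_left_mono) auto
    moreover have "N * D \<theta>1 - N * D \<theta>2 = (\<theta>2 - \<theta>1) * (N * p' - N * p)" by (simp add: D_def algebra_simps)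
    moreover have "(S \<theta>1 - S \<theta>2) * (p * p') = (\<theta>2 - \<theta>1) * (d * (p * p'))" unfolding S12 by (simp only: mult.assoc)
    ultimately have key: "N * D \<theta>1 - (S \<theta>1 - S \<theta>2) * (p * p') \<le> N * D \<theta>2" by linarith
    have "P \<theta>2 * (N - (S \<theta>1 - S \<theta>2) * P \<theta>1) = (p * p') / (D \<theta>1 * D \<theta>2) * (N * D \<theta>1 - (S \<theta>1 - S \<theta>2) * (p * p'))"
      using D1(1) D2(1) unfolding PD by (simp add: field_simps)
    also have "\<dots> \<le> (p * p') / (D \<theta>1 * D \<theta>2) * (N * D \<theta>2)"
      using key D1 D2 pp by (intro mult_left_mono) auto
    also have "\<dots> = N * P \<theta>1" using D1 D2 by (simp add: PD)
    finally show ?thesis using den by (simp add: pos_le_divide_eq)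
  qed
  show ?thesis
    by (rule sobolev_embedding[OF dom S1 P1(1) SP[unfolded N_def] ne S2 Slt P1(2) crit2[unfolded N_def]])
qed

theorem theorem1p2:
  fixes \<Omega> :: "(real ^ 'n) set" and s p s' p' :: real
  assumes "0 < s" and "s \<le> 1" and "1 \<le> p"
    and "s * p < real CARD('n)" and "s \<noteq> p"
    and "bounded_lipschitz_domain \<Omega>"
    and "0 \<le> s'" and "s' < s"
    and "1 \<le> p'" and "p' \<le> real CARD('n) * p / (real CARD('n) - (s - s') * p)"
  defines "\<gamma> \<equiv> embedding_curve s p s' p'"
  shows "(\<exists>C>0. \<forall>u \<in> sobolev_space \<Omega> s p.
            sobolev_norm \<Omega> s' p' u \<le> ennreal C * sobolev_norm \<Omega> s p u)
    \<and> continuously_embedded \<Omega> s p s' p'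
    \<and> (\<forall>\<theta>1 \<theta>2. 0 \<le> \<theta>1 \<and> \<theta>1 \<le> \<theta>2 \<and> \<theta>2 \<le> 1 \<longrightarrow>
          continuously_embedded \<Omega> (fst (\<gamma> \<theta>1)) (snd (\<gamma> \<theta>1)) (fst (\<gamma> \<theta>2)) (snd (\<gamma> \<theta>2)))"
proof (intro conjI allI impI)
  show emb: "continuously_embedded \<Omega> s p s' p'"
    by (rule sobolev_embedding[OF assms(6,1-5,7-10)])
  show "\<exists>C>0. \<forall>u \<in> sobolev_space \<Omega> s p. sobolev_norm \<Omega> s' p' u \<le> ennreal C * sobolev_norm \<Omega> s p u"
    using emb unfolding continuously_embedded_def by (rule conjunct2)
  fix \<theta>1 \<theta>2 :: real assume "0 \<le> \<theta>1 \<and> \<theta>1 \<le> \<theta>2 \<and> \<theta>2 \<le> 1"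
  then show "continuously_embedded \<Omega> (fst (\<gamma> \<theta>1)) (snd (\<gamma> \<theta>1)) (fst (\<gamma> \<theta>2)) (snd (\<gamma> \<theta>2))"
    using sobolev_embedding_along_curve[OF assms(6,1-5,7-10), of \<theta>1 \<theta>2]
    by (simp add: \<gamma>_def embedding_curve_def)
qed

end
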